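(* Let $\mathcal{Y}\subset\mathbb{R}^m$ be closed, $G\in\mathbb{S}[\boldsymbol{x},\boldsymbol{y}]^q$, $\mathcal{X}=\{\boldsymbol{x}\in\mathbb{R}^n\mid G(\boldsymbol{x},\boldsymbol{y})\succeq 0,\ \forall\boldsymbol{y}\in\mathcal{Y}\}$, and let $\nu$ be a Borel measure on $\mathbb{R}^m$ with $\mathrm{supp}(\nu)=\mathcal{Y}$ and $\int_{\mathcal{Y}}|h|\,\mathrm{d}\nu<\infty$ for all $h\in\mathbb{R}[\boldsymbol{y}]$. Let $\boldsymbol{c}\in\mathbb{R}^r$, $\Lambda_0,\ldots,\Lambda_r\in\mathbb{S}[\boldsymbol{x}]^p$, $\Lambda(\boldsymbol{x},\gamma)=\Lambda_0(\boldsymbol{x})-\sum_{i=1}^r\Lambda_i(\boldsymbol{x})\gamma_i$ for $\gamma\in\mathbb{R}^r$, and $$\tau^\star=\inf_{\gamma\in\mathbb{R}^r}\{\boldsymbol{c}^{\intercal}\gamma\mid\Lambda(\boldsymbol{x},\gamma)\succeq 0,\ \forall\boldsymbol{x}\in\mathcal{X}\}.$$ For $k\in\mathbb{N}$ with $k\ge\max\{\lceil\deg_{\boldsymbol{x}}G/2\rceil,\lceil\deg_{\boldsymbol{y}}G/2\rceil\}$ let $\tau(k)$ be the infimum of $\boldsymbol{c}^{\intercal}\gamma$ over all $\gamma\in\mathbb{R}^r$ for which there exist SOS matrices $S_0\in\mathbb{S}[\boldsymbol{x}]^p$ and $S\in\mathbb{S}[\boldsymbol{x},\boldsymbol{y}]^{pq}$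 with $$\Lambda(\boldsymbol{x},\gamma)=S_0(\boldsymbol{x})+\int_{\mathcal{Y}}\langle S(\boldsymbol{x},\boldsymbol{y}),G(\boldsymbol{x},\boldsymbol{y})\rangle_p\,\mathrm{d}\nu(\boldsymbol{y}),$$ $\deg S_0\le 2k$, $\deg_{\boldsymbol{x}}S\le 2(k-\lceil\deg_{\boldsymbol{x}}G/2\rceil)$ and $\deg_{\boldsymbol{y}}S\le 2(k-\lceil\deg_{\boldsymbol{y}}G/2\rceil)$. Suppose that there is $C>0$ with $C-\Vert\boldsymbol{x}\Vert^2\in\mathcal{Q}^1(G,\nu)$, that $\sum_{d=1}^{\infty}\left(\int_{\mathcal{Y}}y_j^{2d}\,\mathrm{d}\nu(\boldsymbol{y})\right)^{-\frac{1}{2d}}=\infty$ for every $j\in\{1,\ldots,m\}$, and that there exists $\bar\gamma\in\mathbb{R}^r$ such that $\Lambda(\boldsymbol{x},\bar\gamma)\succ 0$ for all $\boldsymbol{x}\in\mathcal{X}$. Then $\lim_{k\to\infty}\tau(k)=\tau^\star$.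
   Context: $\boldsymbol{x}=(x_1,\ldots,x_n)$, $\boldsymbol{y}=(y_1,\ldots,y_m)$. $\mathbb{S}[\cdot]^q$ denotes $q\times q$ symmetric matrices with real polynomial entries in the indicated variables; $\deg,\deg_{\boldsymbol{x}},\deg_{\boldsymbol{y}}$ of a polynomial matrix are the maxima over entries of the total degree, the total degree in $\boldsymbol{x}$, the total degree in $\boldsymbol{y}$. Infima are taken in $[-\infty,+\infty]$, with $\inf\emptyset=+\infty$. An $r\times r$ SOS matrix is one of the form $T^{\intercal}T$ with $T$ an $l\times r$ real polynomial matrix in the same variables, $l\in\mathbb{N}$. For $A\in\mathbb{R}^{pq\times pq}$, $B\in\mathbb{R}^{q\times q}$, $\langle A,B\rangle_p:=\mathrm{tr}_p(A^{\intercal}(I_p\otimes B))\in\mathbb{R}^{p\times p}$, where for $C=[C_{ij}]_{i,j=1}^p$ with blocks $C_{ij}\in\mathbb{R}^{q\times q}$, $\mathrm{tr}_p(C):=[\mathrm{tr}(C_{ij})]_{i,j=1}^p$; the same definition is used for polynomial matrices. For $H(\boldsymbol{x},\boldsymbol{y})=\sum_\beta H_\beta(\boldsymbol{x})\boldsymbol{y}^\beta$, $\int_{\mathcal{Y}}H\,\mathrm{d}\nu(\boldsymbol{y}):=\sum_\beta H_\beta(\boldsymbol{x})\int_{\mathcal{Y}}\boldsymbol{y}^\beta\,\mathrm{d}\nu(\boldsymbol{y})$. $\mathcal{Q}^1(G,\nu)$ is the set of polynomials $\sigma_0+\int_{\mathcal{Y}}\mathrm{tr}(S^{\intercal}G)\,\mathrm{d}\nu(\boldsymbol{y})$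 with $\sigma_0\in\mathbb{R}[\boldsymbol{x}]$ a sum of squares and $S\in\mathbb{S}[\boldsymbol{x},\boldsymbol{y}]^q$ an SOS matrix. *)

theory Defs
  imports "HOL-Analysis.Analysis" "HOL-Library.Poly_Mapping"
begin

text \<open>
  Real polynomials are finitely supported maps from exponents to coefficients, with the
  convolution product of \<^theory>\<open>HOL-Library.Poly_Mapping\<close>. An exponent of a polynomial in
  \<open>(x, y)\<close> is a pair \<open>(\<alpha>, \<beta>)\<close>, standing for the monomial \<open>x\<^sup>\<alpha> y\<^sup>\<beta>\<close>; pairs are added
  componentwise, so the product is that of \<open>\<real>[x, y]\<close>.
\<close>

type_synonym 'n expo = "'n \<Rightarrow>\<^sub>0 nat"
type_synonym 'n xpoly = "'n expo \<Rightarrow>\<^sub>0 real"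
type_synonym ('n, 'm) xypoly = "('n expo \<times> 'm expo) \<Rightarrow>\<^sub>0 real"

definition Const :: "real \<Rightarrow> 'n xpoly" where
  "Const c = Poly_Mapping.single 0 c"

definition Var :: "'n \<Rightarrow> 'n xpoly" where
  "Var i = Poly_Mapping.single (Poly_Mapping.single i 1) 1"

definition monom_eval :: "'n::finite expo \<Rightarrow> real^'n \<Rightarrow> real" where
  "monom_eval \<alpha> x = (\<Prod>i\<in>UNIV. (x $ i) ^ Poly_Mapping.lookup \<alpha> i)"

definition eval_x :: "'n::finite xpoly \<Rightarrow> real^'n \<Rightarrow> real" where
  "eval_x f x = (\<Sum>\<alpha>\<in>Poly_Mapping.keys f. Poly_Mapping.lookup f \<alpha> * monom_eval \<alpha> x)"

definition eval_xy ::
    "('n::finite, 'm::finite) xypoly \<Rightarrow> real^'n \<Rightarrow> real^'m \<Rightarrow> real" where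
  "eval_xy f x y = (\<Sum>(\<alpha>, \<beta>)\<in>Poly_Mapping.keys f.
     Poly_Mapping.lookup f (\<alpha>, \<beta>) * monom_eval \<alpha> x * monom_eval \<beta> y)"

definition meval_x :: "'n::finite xpoly^'q^'p \<Rightarrow> real^'n \<Rightarrow> real^'q^'p" where
  "meval_x M x = (\<chi> i j. eval_x (M $ i $ j) x)"

definition meval_xy ::
    "('n::finite, 'm::finite) xypoly^'q^'p \<Rightarrow> real^'n \<Rightarrow> real^'m \<Rightarrow> real^'q^'p" where
  "meval_xy M x y = (\<chi> i j. eval_xy (M $ i $ j) x y)"


text \<open>Degrees; the zero polynomial (matrix) has degree 0.\<close>

definition expo_deg :: "'n::finite expo \<Rightarrow> nat" where
  "expo_deg \<alpha> = (\<Sum>i\<in>UNIV. Poly_Mapping.lookup \<alpha> i)"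

definition mdeg :: "'n::finite xpoly^'q^'p \<Rightarrow> nat" where
  "mdeg M = Max (insert 0 {expo_deg \<alpha> | \<alpha> i j. \<alpha> \<in> Poly_Mapping.keys (M $ i $ j)})"

definition mdeg_x :: "('n::finite, 'm::finite) xypoly^'q^'p \<Rightarrow> nat" where
  "mdeg_x M = Max (insert 0 {expo_deg \<alpha> | \<alpha> \<beta> i j. (\<alpha>, \<beta>) \<in> Poly_Mapping.keys (M $ i $ j)})"

definition mdeg_y :: "('n::finite, 'm::finite) xypoly^'q^'p \<Rightarrow> nat" where
  "mdeg_y M = Max (insert 0 {expo_deg \<beta> | \<alpha> \<beta> i j. (\<alpha>, \<beta>) \<in> Poly_Mapping.keys (M $ i $ j)})"

definition half_up :: "nat \<Rightarrow> nat" where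
  "half_up d = nat \<lceil>real d / 2\<rceil>"


definition symmetric_matrices :: "('a^'q^'q) set" where
  "symmetric_matrices = {M. transpose M = M}"

definition psd :: "real^'q^'q \<Rightarrow> bool" where
  "psd A \<longleftrightarrow> A \<in> symmetric_matrices \<and> (\<forall>v. 0 \<le> v \<bullet> (A *v v))"

definition pd :: "real^'q^'q \<Rightarrow> bool" where
  "pd A \<longleftrightarrow> A \<in> symmetric_matrices \<and> (\<forall>v. v \<noteq> 0 \<longrightarrow> 0 < v \<bullet> (A *v v))"

definition sos_polys :: "'n xpoly set" where
  "sos_polys = {(\<Sum>k<l. (f k)\<^sup>2) | (l::nat) f. True}"

text \<open>
  The matrices \<open>T\<^sup>T T\<close> with \<open>T\<close> having \<open>l\<close> rows, \<open>l\<close> arbitrary. As \<open>l\<close> varies inside the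
  definition, \<open>T\<close> is given by its entries \<open>T k i\<close> with \<open>k < l\<close>.
\<close>

definition sos_matrices :: "('a::semiring_0^'r^'r) set" where
  "sos_matrices = {(\<chi> i j. \<Sum>k<l. T k i * T k j) | (l::nat) T. True}"

lemma sos_matrices_symmetric:
  fixes S :: "'a::comm_semiring_0^'r^'r"
  assumes "S \<in> sos_matrices"
  shows "S \<in> symmetric_matrices"
  using assms
  by (auto simp: sos_matrices_def symmetric_matrices_def transpose_def vec_eq_iff mult.commute)


text \<open>
  The rows and columns of a \<open>pq \<times> pq\<close> matrix are indexed by pairs: \<open>(i, k)\<close> is the \<open>k\<close>-th
  index inside the \<open>i\<close>-th block.
\<close>

definition kronecker ::
    "'a::times^'p^'p \<Rightarrow> 'a^'q^'q \<Rightarrow> 'a^('p::finite \<times> 'q::finite)^('p \<times> 'q)" where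
  "kronecker A B = (\<chi> a b. A $ fst a $ fst b * B $ snd a $ snd b)"

definition partial_trace :: "'a::semiring_1^('p::finite \<times> 'q::finite)^('p \<times> 'q) \<Rightarrow> 'a^'p^'p" where
  "partial_trace C = (\<chi> i j. trace (\<chi> k l. C $ (i, k) $ (j, l)))"

definition block_inner ::
    "'a::semiring_1^('p::finite \<times> 'q::finite)^('p \<times> 'q) \<Rightarrow> 'a^'q^'q \<Rightarrow> 'a^'p^'p" where
  "block_inner A B = partial_trace (transpose A ** kronecker (mat 1) B)"


definition support :: "'a::topological_space measure \<Rightarrow> 'a set" where
  "support \<nu> = {y. \<forall>U. open U \<and> y \<in> U \<longrightarrow> 0 < emeasure \<nu> U}"

definition integral_y ::
    "(real^'m::finite) set \<Rightarrow> (real^'m) measure \<Rightarrow> ('n, 'm) xypoly \<Rightarrow> 'n xpoly" where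
  "integral_y Y \<nu> h = (\<Sum>(\<alpha>, \<beta>)\<in>Poly_Mapping.keys h.
     Poly_Mapping.single \<alpha> (Poly_Mapping.lookup h (\<alpha>, \<beta>) * (LINT y:Y|\<nu>. monom_eval \<beta> y)))"

definition mintegral_y ::
    "(real^'m::finite) set \<Rightarrow> (real^'m) measure \<Rightarrow> ('n, 'm) xypoly^'q^'p \<Rightarrow> 'n xpoly^'q^'p" where
  "mintegral_y Y \<nu> H = (\<chi> i j. integral_y Y \<nu> (H $ i $ j))"

definition quad_module ::
    "(real^'m::finite) set \<Rightarrow> (real^'m) measure \<Rightarrow> ('n, 'm) xypoly^'q^'q \<Rightarrow> 'n xpoly set" where
  "quad_module Y \<nu> G =
     {\<sigma>\<^sub>0 + integral_y Y \<nu> (trace (transpose S ** G)) | \<sigma>\<^sub>0 S.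
        \<sigma>\<^sub>0 \<in> sos_polys \<and> S \<in> sos_matrices}"

text \<open>
  Carleman's condition for the \<open>j\<close>-th coordinate. The series is taken in \<^typ>\<open>ennreal\<close>, so that
  a vanishing moment contributes \<open>0\<^sup>-\<^sup>1 = \<infinity>\<close> (whereas \<open>0 powr a = 0\<close> in \<^typ>\<open>real\<close>, also for
  negative \<open>a\<close>). The sum over \<open>d \<ge> 1\<close> is written with \<^term>\<open>Suc d\<close>.
\<close>

definition carleman :: "(real^'m::finite) set \<Rightarrow> (real^'m) measure \<Rightarrow> 'm \<Rightarrow> bool" where
  "carleman Y \<nu> j \<longleftrightarrow>
     suminf (\<lambda>d. inverse (ennreal
        ((LINT y:Y|\<nu>. (y $ j) ^ (2 * Suc d)) powr (1 / (2 * real (Suc d)))))) = \<infinity>"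


definition feasible_set ::
    "(real^'m) set \<Rightarrow> ('n::finite, 'm::finite) xypoly^'q^'q \<Rightarrow> (real^'n) set" where
  "feasible_set Y G = {x. \<forall>y\<in>Y. psd (meval_xy G x y)}"

definition pencil ::
    "'n xpoly^'p^'p \<Rightarrow> ('r::finite \<Rightarrow> 'n xpoly^'p^'p) \<Rightarrow> real^'r \<Rightarrow> 'n xpoly^'p^'p" where
  "pencil \<Lambda>\<^sub>0 \<Lambda> \<gamma> = (\<chi> a b. \<Lambda>\<^sub>0 $ a $ b - (\<Sum>i\<in>UNIV. \<Lambda> i $ a $ b * Const (\<gamma> $ i)))"

definition tau_star ::
    "(real^'m) set \<Rightarrow> ('n::finite, 'm::finite) xypoly^'q^'q \<Rightarrow> real^'r \<Rightarrow>
     'n xpoly^'p^'p \<Rightarrow> ('r::finite \<Rightarrow> 'n xpoly^'p^'p) \<Rightarrow> ereal" where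
  "tau_star Y G c \<Lambda>\<^sub>0 \<Lambda> =
     (INF \<gamma>\<in>{\<gamma>. \<forall>x\<in>feasible_set Y G. psd (meval_x (pencil \<Lambda>\<^sub>0 \<Lambda> \<gamma>) x)}. ereal (c \<bullet> \<gamma>))"

text \<open>
  The natural-number differences are genuine for \<open>k\<close> at least
  \<open>max (half_up (mdeg_x G)) (half_up (mdeg_y G))\<close>, the range in which the relaxation is
  considered; smaller \<open>k\<close> are irrelevant for the limit.
\<close>

definition tau ::
    "(real^'m) set \<Rightarrow> (real^'m) measure \<Rightarrow> ('n::finite, 'm::finite) xypoly^'q^'q \<Rightarrow> real^'r \<Rightarrow>
     'n xpoly^'p^'p \<Rightarrow> ('r::finite \<Rightarrow> 'n xpoly^'p^'p) \<Rightarrow> nat \<Rightarrow> ereal" where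
  "tau Y \<nu> G c \<Lambda>\<^sub>0 \<Lambda> k =
     (INF \<gamma>\<in>{\<gamma>. \<exists>S\<^sub>0 S.
          S\<^sub>0 \<in> sos_matrices \<and> S \<in> sos_matrices \<and>
          pencil \<Lambda>\<^sub>0 \<Lambda> \<gamma> = S\<^sub>0 + mintegral_y Y \<nu> (block_inner S G) \<and>
          mdeg S\<^sub>0 \<le> 2 * k \<and>
          mdeg_x S \<le> 2 * (k - half_up (mdeg_x G)) \<and>
          mdeg_y S \<le> 2 * (k - half_up (mdeg_y G))}. ereal (c \<bullet> \<gamma>))"

end

theory Submission
  imports Defs "HOL-Real_Asymp.Real_Asymp"
begin

text \<open>
  One inequality is easy: integrating a matrix that is positive semidefinite for every \<open>y \<in> Y\<close>
  gives a positive semidefinite matrix, so a \<open>\<gamma>\<close> admitted by some relaxation is feasible for the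
  original problem and every \<open>\<tau>(k)\<close> is at least \<open>\<tau>\<^sup>\<star>\<close>. For the other one, mix a feasible \<open>\<gamma>\<close> with
  a little of the strictly feasible point. The mixture makes the pencil positive definite on \<open>X\<close>
  and changes the objective by as little as desired. It therefore suffices that a pencil which is
  positive definite on \<open>X\<close> has a representation \<open>S\<^sub>0 + \<integral>\<langle>S, G\<rangle> d\<nu>\<close> of some degree. Two facts give this.

  The first is a Positivstellensatz for matrices over an arbitrary Archimedean quadratic module
  \<open>Q\<close> of \<open>\<real>[x]\<close> (\<open>matrix_positivstellensatz\<close>): a symmetric polynomial matrix that is positive definite
  wherever all elements of \<open>Q\<close> are nonnegative is a sum of matrices \<open>g t t\<^sup>T\<close> with \<open>g \<in> Q\<close> and real
  vectors \<open>t\<close>. On a large box, finitely many \<open>g \<in> Q\<close> suffice to recognise, by a negative value, all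
  points at which the matrix fails to be positive definite (\<open>finite_negativity_cover\<close>). Subtracting multiples of \<open>(g - 1)\<^sup>2\<^sup>k g\<close> makes the matrix positive
  definite on the whole box. There its Bernstein coefficients of high degree are positive definite
  real matrices, because they approximate its values (\<open>bernstein_coeff_approx\<close>), and the Bernstein
  basis polynomials belong to \<open>Q\<close> (\<open>bernstein_basis_mem\<close>).

  The second identifies the points where the scalar module of the problem is nonnegative
  (\<open>nonneg_quad_module_imp_feasible\<close>): they lie in \<open>X\<close>. If \<open>v\<^sup>T G(x, y\<^sub>0) v < 0\<close> for some \<open>y\<^sub>0 \<in> Y\<close>,
  then some polynomial \<open>p\<close> has \<open>\<integral> p\<^sup>2 v\<^sup>T G(x, y) v d\<nu>(y) < 0\<close> (\<open>exists_square_weight_negative\<close>), which is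
  the value at \<open>x\<close> of an element of the module. A narrow Gaussian around \<open>y\<^sub>0\<close> has this property,
  and Carleman's condition makes it a limit of polynomials in a weighted \<open>L\<^sup>2\<close> space
  (\<open>approximable_gaussian\<close>). The reason is quasi-analyticity: at \<open>t = 0\<close> all derivatives of
  \<open>t \<mapsto> cos (t y\<^sub>j + \<theta>)\<close> are polynomials, their norms satisfy the Denjoy-Carleman condition, and Bang's
  argument (\<open>quasi_analytic_propagation\<close>), applied to the distance from the polynomials instead of
  the absolute value, keeps this distance at \<open>0\<close> for all \<open>t\<close>. Products of cosines converge
  boundedly to Gaussians.
\<close>

section \<open>Linear extensions of maps on monomials\<close>

text \<open>Two linear maps on polynomials agree as soon as they agree on monomials.\<close>

lemma poly_mapping_induct_single [case_names single add]:
  fixes f :: "'a \<Rightarrow>\<^sub>0 'b::comm_monoid_add"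
  assumes single: "\<And>a c. P (Poly_Mapping.single a c)"
    and add: "\<And>f g. P f \<Longrightarrow> P g \<Longrightarrow> P (f + g)"
  shows "P f"
proof -
  have sums: "P (\<Sum>a\<in>A. Poly_Mapping.single a (Poly_Mapping.lookup f a))" if "finite A" for A
    using that
  proof induction
    case empty
    then show ?case using single[of undefined 0] by simp
  qed (simp add: single add)
  have "f = (\<Sum>a\<in>Poly_Mapping.keys f. Poly_Mapping.single a (Poly_Mapping.lookup f a))"
    by (rule poly_mapping_eqI)
      (auto simp: lookup_sum lookup_single when_def sum.delta in_keys_iff)
  then show ?thesis using sums[of "Poly_Mapping.keys f"] by simp
qed

text \<open>
  The reals as scalars of a commutative ring. Evaluation at a point, the inclusions of \<open>\<real>[x]\<close> and
  \<open>\<real>[y]\<close> into \<open>\<real>[x, y]\<close>, integration over \<open>y\<close> and substitutions are all linear extensions of maps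
  defined on monomials. Their additivity, and their multiplicativity if the map on monomials is
  multiplicative, are proved here once.
\<close>

locale real_hom =
  fixes h :: "real \<Rightarrow> 'b::comm_ring_1"
  assumes hom_0: "h 0 = 0" and hom_1: "h 1 = 1"
    and hom_add: "h (a + b) = h a + h b"
    and hom_mult: "h (a * b) = h a * h b"
begin

definition extend :: "('a \<Rightarrow> 'b) \<Rightarrow> ('a \<Rightarrow>\<^sub>0 real) \<Rightarrow> 'b" where
  "extend \<phi> f = (\<Sum>a\<in>Poly_Mapping.keys f. h (Poly_Mapping.lookup f a) * \<phi> a)"

lemma extend_superset:
  assumes "finite A" "Poly_Mapping.keys f \<subseteq> A"
  shows "extend \<phi> f = (\<Sum>a\<in>A. h (Poly_Mapping.lookup f a) * \<phi> a)"
  unfolding extend_def using assms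
  by (intro sum.mono_neutral_left) (auto simp: in_keys_iff hom_0)

lemma extend_zero [simp]: "extend \<phi> 0 = 0"
  by (simp add: extend_def)

lemma extend_single: "extend \<phi> (Poly_Mapping.single a c) = h c * \<phi> a"
  by (subst extend_superset[where A = "{a}"]) (auto simp: hom_0)

lemma extend_add: "extend \<phi> (f + g) = extend \<phi> f + extend \<phi> g"
proof -
  let ?A = "Poly_Mapping.keys f \<union> Poly_Mapping.keys g"
  have "extend \<phi> (f + g) = (\<Sum>a\<in>?A. h (Poly_Mapping.lookup (f + g) a) * \<phi> a)"
    using keys_add[of f g] by (intro extend_superset) auto
  also have "\<dots> = (\<Sum>a\<in>?A. h (Poly_Mapping.lookup f a) * \<phi> a)
      + (\<Sum>a\<in>?A. h (Poly_Mapping.lookup g a) * \<phi> a)"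
    by (simp add: lookup_add hom_add distrib_right sum.distrib)
  also have "\<dots> = extend \<phi> f + extend \<phi> g"
    by (simp add: extend_superset[of ?A])
  finally show ?thesis .
qed

lemma extend_mult:
  fixes \<phi> :: "'a::comm_monoid_add \<Rightarrow> 'b"
  assumes "\<And>a b. \<phi> (a + b) = \<phi> a * \<phi> b"
  shows "extend \<phi> (f * g) = extend \<phi> f * extend \<phi> g"
proof (induction f rule: poly_mapping_induct_single)
  case (single a c)
  show ?case
    by (induction g rule: poly_mapping_induct_single)
      (simp_all add: mult_single extend_single extend_add hom_mult assms algebra_simps)
qed (simp add: extend_add algebra_simps)

end

interpretation id_hom: real_hom "\<lambda>c::real. c"
  by unfold_locales auto

interpretation single_hom: real_hom "\<lambda>c. Poly_Mapping.single (0::'a::comm_monoid_add) c"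
  by (rule real_hom.intro) (simp_all only: single_zero single_one single_add mult_single add_0)

interpretation Const_hom: real_hom "Const :: real \<Rightarrow> 'n xpoly"
  by (rule real_hom.intro)
    (simp_all only: Const_def single_zero single_one single_add mult_single add_0)

lemma monom_eval_zero [simp]: "monom_eval 0 x = 1"
  by (simp add: monom_eval_def)

lemma monom_eval_add: "monom_eval (\<alpha> + \<beta>) x = monom_eval \<alpha> x * monom_eval \<beta> x"
  by (simp add: monom_eval_def lookup_add power_add prod.distrib)

lemma eval_x_extend: "eval_x f x = id_hom.extend (\<lambda>\<alpha>. monom_eval \<alpha> x) f"
  by (simp add: eval_x_def id_hom.extend_def)

lemma eval_xy_extend:
  "eval_xy f x y = id_hom.extend (\<lambda>(\<alpha>, \<beta>). monom_eval \<alpha> x * monom_eval \<beta> y) f"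
  by (simp add: eval_xy_def id_hom.extend_def case_prod_unfold mult.assoc)

lemma eval_x_add [simp]: "eval_x (f + g) x = eval_x f x + eval_x g x"
  by (simp add: eval_x_extend id_hom.extend_add)

lemma eval_x_mult [simp]: "eval_x (f * g) x = eval_x f x * eval_x g x"
  by (simp add: eval_x_extend id_hom.extend_mult monom_eval_add)

lemma eval_x_single [simp]: "eval_x (Poly_Mapping.single \<alpha> c) x = c * monom_eval \<alpha> x"
  by (simp add: eval_x_extend id_hom.extend_single)

lemma eval_x_Const [simp]: "eval_x (Const c) x = c"
  by (simp add: Const_def)

lemma eval_x_zero [simp]: "eval_x 0 x = 0"
  by (simp add: eval_x_extend)

lemma eval_x_one [simp]: "eval_x 1 x = 1"
  using eval_x_Const[of 1 x] by (simp only: Const_hom.hom_1)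

lemma eval_x_uminus [simp]: "eval_x (- f) x = - eval_x f x"
  using eval_x_add[of f "- f" x] by simp

lemma eval_x_diff [simp]: "eval_x (f - g) x = eval_x f x - eval_x g x"
  using eval_x_add[of f "- g" x] by simp

lemma eval_x_sum [simp]: "eval_x (\<Sum>i\<in>A. f i) x = (\<Sum>i\<in>A. eval_x (f i) x)"
  by (induction A rule: infinite_finite_induct) auto

lemma eval_x_power [simp]: "eval_x (f ^ k) x = eval_x f x ^ k"
  by (induction k) auto

lemma eval_x_prod [simp]: "eval_x (\<Prod>i\<in>A. f i) x = (\<Prod>i\<in>A. eval_x (f i) x)"
  by (induction A rule: infinite_finite_induct) auto

lemma eval_x_Var [simp]: "eval_x (Var i) x = x $ i"
proof -
  have "(\<Prod>k\<in>UNIV. (x $ k) ^ Poly_Mapping.lookup (Poly_Mapping.single i (1::nat)) k)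
      = (\<Prod>k\<in>UNIV. if k = i then x $ k else 1)"
    by (intro prod.cong) (auto simp: lookup_single when_def)
  then show ?thesis by (simp add: Var_def monom_eval_def)
qed

lemma eval_xy_add [simp]: "eval_xy (f + g) x y = eval_xy f x y + eval_xy g x y"
  by (simp add: eval_xy_extend id_hom.extend_add)

lemma eval_xy_mult [simp]: "eval_xy (f * g) x y = eval_xy f x y * eval_xy g x y"
  unfolding eval_xy_extend
  by (rule id_hom.extend_mult) (auto simp: monom_eval_add)

lemma eval_xy_single [simp]:
  "eval_xy (Poly_Mapping.single (\<alpha>, \<beta>) c) x y = c * (monom_eval \<alpha> x * monom_eval \<beta> y)"
  by (simp add: eval_xy_extend id_hom.extend_single)

lemma eval_xy_zero [simp]: "eval_xy 0 x y = 0"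
  by (simp add: eval_xy_extend)

lemma eval_xy_sum [simp]: "eval_xy (\<Sum>i\<in>A. f i) x y = (\<Sum>i\<in>A. eval_xy (f i) x y)"
  by (induction A rule: infinite_finite_induct) auto

definition embed_x :: "'n xpoly \<Rightarrow> ('n, 'm) xypoly" where
  "embed_x = single_hom.extend (\<lambda>\<alpha>. Poly_Mapping.single (\<alpha>, 0) 1)"

definition embed_y :: "'m xpoly \<Rightarrow> ('n, 'm) xypoly" where
  "embed_y = single_hom.extend (\<lambda>\<beta>. Poly_Mapping.single (0, \<beta>) 1)"

lemma embed_x_single: "embed_x (Poly_Mapping.single \<alpha> c) = Poly_Mapping.single (\<alpha>, 0) c"
  by (simp only: embed_x_def single_hom.extend_single mult_single add_0 mult_1_right)

lemma embed_y_single: "embed_y (Poly_Mapping.single \<beta> c) = Poly_Mapping.single (0, \<beta>) c"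
  by (simp only: embed_y_def single_hom.extend_single mult_single add_0 mult_1_right)

lemma embed_x_add: "embed_x (f + g) = embed_x f + embed_x g"
  by (simp add: embed_x_def single_hom.extend_add)

lemma embed_y_add: "embed_y (f + g) = embed_y f + embed_y g"
  by (simp add: embed_y_def single_hom.extend_add)

lemma embed_x_mult: "embed_x (f * g) = embed_x f * embed_x g"
  unfolding embed_x_def by (rule single_hom.extend_mult) (simp add: mult_single)

lemma eval_xy_embed_x [simp]: "eval_xy (embed_x f) x y = eval_x f x"
  by (induction f rule: poly_mapping_induct_single) (simp_all add: embed_x_single embed_x_add)

lemma eval_xy_embed_y [simp]: "eval_xy (embed_y f) x y = eval_x f y"
  by (induction f rule: poly_mapping_induct_single) (simp_all add: embed_y_single embed_y_add)

lemma integral_y_extend: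
  "integral_y Y \<nu> =
     Const_hom.extend (\<lambda>(\<alpha>, \<beta>). Poly_Mapping.single \<alpha> (LINT y:Y|\<nu>. monom_eval \<beta> y))"
  by (simp add: fun_eq_iff integral_y_def Const_hom.extend_def case_prod_unfold Const_def mult_single)

lemma integral_y_single:
  "integral_y Y \<nu> (Poly_Mapping.single (\<alpha>, \<beta>) c) =
     Poly_Mapping.single \<alpha> (c * (LINT y:Y|\<nu>. monom_eval \<beta> y))"
  by (simp add: integral_y_extend Const_hom.extend_single Const_def mult_single)

lemma integral_y_add: "integral_y Y \<nu> (f + g) = integral_y Y \<nu> f + integral_y Y \<nu> g"
  by (simp add: integral_y_extend Const_hom.extend_add)

lemma integral_y_zero [simp]: "integral_y Y \<nu> 0 = 0"
  by (simp add: integral_y_extend)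

text \<open>
  Linearity over \<open>\<real>[x]\<close> is what allows squares and vectors in \<open>x\<close> to be moved under the integral,
  and hence what makes the representable polynomials a quadratic module.
\<close>

lemma integral_y_embed_x_mult: "integral_y Y \<nu> (embed_x f * h) = f * integral_y Y \<nu> h"
proof (induction f rule: poly_mapping_induct_single)
  case (single a c)
  show ?case
  proof (induction h rule: poly_mapping_induct_single)
    case (single b d)
    show ?case
      by (cases b) (simp add: embed_x_single mult_single integral_y_single mult.assoc)
  qed (simp add: integral_y_add distrib_left)
qed (simp add: integral_y_add embed_x_add distrib_right)

lemma real_polynomial_function_monom_eval:
  "real_polynomial_function (\<lambda>y::real^'m::finite. monom_eval \<beta> y)"
  unfolding monom_eval_def
  by (intro real_polynomial_function_prod real_polynomial_function_power
      real_polynomial_function.intros(1) bounded_linear_vec_nth) auto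

lemma borel_measurable_polynomial:
  fixes p :: "real^'m::finite \<Rightarrow> real"
  assumes "real_polynomial_function p" shows "p \<in> borel_measurable borel"
  using assms continuous_real_polymonial_function
  by (intro borel_measurable_continuous_onI continuous_at_imp_continuous_on) auto

lemma real_polynomial_function_eval_x: "real_polynomial_function (\<lambda>x. eval_x f x)"
  by (induction f rule: poly_mapping_induct_single)
    (auto intro: real_polynomial_function.intros(2-) real_polynomial_function_monom_eval)

lemma real_polynomial_function_eval_xy: "real_polynomial_function (\<lambda>y. eval_xy f x y)"
proof (induction f rule: poly_mapping_induct_single)
  case (single a c)
  show ?case
    by (cases a)
      (simp add: real_polynomial_function.intros(2-) real_polynomial_function_monom_eval)
qed (auto intro: real_polynomial_function.intros(2-))

text \<open>
  The measure is analysed with polynomial functions; the function found there has to become a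
  formal polynomial again before it can be an entry of an SOS matrix.
\<close>

lemma real_polynomial_function_eq_eval:
  fixes p :: "real^'m::finite \<Rightarrow> real"
  assumes "real_polynomial_function p"
  obtains f where "p = (\<lambda>x. eval_x f x)"
proof -
  have "\<exists>f. p = (\<lambda>x. eval_x f x)" using assms
  proof induction
    case (linear p)
    have p_sum: "p x = (\<Sum>j\<in>UNIV. x $ j * p (axis j 1))" for x
    proof -
      have "p x = p (\<Sum>j\<in>UNIV. x $ j *\<^sub>R axis j 1)"
        by (simp only: basis_expansion scalar_mult_eq_scaleR[symmetric])
      also have "\<dots> = (\<Sum>j\<in>UNIV. x $ j * p (axis j 1))"
        using linear by (simp add: linear_sum linear_cmul bounded_linear.linear)
      finally show ?thesis .
    qed
    have "p = (\<lambda>x. eval_x (\<Sum>j\<in>UNIV. Var j * Const (p (axis j 1))) x)"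
      by (rule ext, rule trans[OF p_sum]) simp
    then show ?case ..
  next
    case (const c)
    have "(\<lambda>x. c) = (\<lambda>x::real^'m. eval_x (Const c) x)" by simp
    then show ?case ..
  next
    case (add p q)
    then obtain f g where "p = (\<lambda>x. eval_x f x)" "q = (\<lambda>x. eval_x g x)" by blast
    then have "(\<lambda>x. p x + q x) = (\<lambda>x. eval_x (f + g) x)" by auto
    then show ?case ..
  next
    case (mult p q)
    then obtain f g where "p = (\<lambda>x. eval_x f x)" "q = (\<lambda>x. eval_x g x)" by blast
    then have "(\<lambda>x. p x * q x) = (\<lambda>x. eval_x (f * g) x)" by auto
    then show ?case ..
  qed
  then show ?thesis using that by blast
qed

lemma eval_x_integral_y:
  assumes "\<And>p. real_polynomial_function p \<Longrightarrow> set_integrable \<nu> Y p"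
  shows "eval_x (integral_y Y \<nu> h) x = (LINT y:Y|\<nu>. eval_xy h x y)"
proof (induction h rule: poly_mapping_induct_single)
  case (single a c)
  then show ?case
    by (cases a) (simp add: integral_y_single mult.assoc mult.left_commute)
next
  case (add f g)
  then show ?case
    by (simp add: integral_y_add set_integral_add assms real_polynomial_function_eval_xy)
qed

section \<open>Quasi-analyticity and Carleman sequences\<close>

lemma sum_inverse_fact_le_exp: "(\<Sum>j<n. 1 / fact j) \<le> exp (1::real)"
proof -
  have "(\<Sum>j<n. inverse (fact j) *\<^sub>R (1::real) ^ j) \<le> suminf (\<lambda>j. inverse (fact j) *\<^sub>R 1 ^ j)"
    by (rule sum_le_suminf[OF summable_exp_generic]) auto
  then show ?thesis by (simp add: exp_def divide_inverse)
qed

text \<open>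
  Bang's proof of the Denjoy-Carleman theorem, stated for upper bounds: read \<open>P n t r\<close> as ``the
  \<open>n\<close>-th derivative at \<open>t\<close> has size at most \<open>r\<close>'', with a priori bound \<open>M n\<close>. Say that level \<open>N\<close>
  holds at \<open>t\<close> if the \<open>n\<close>-th derivative there is at most \<open>M n e\<^sup>n\<^sup>-\<^sup>N\<close> for all \<open>n\<close>. Losing one level takes
  a step of length at least \<open>1 / (e \<mu>)\<close> with \<open>\<mu> = M (N + 1) / M N\<close>. Indeed, in the Taylor expansion of
  the \<open>n\<close>-th derivative up to order \<open>N + 1\<close>, log-convexity bounds \<open>M (n + j) / M n\<close> by \<open>\<mu>\<^sup>j\<close>, so the
  expansion is dominated by the exponential series of \<open>e \<mu> h \<le> 1\<close>. For \<open>n > N\<close> the a priori bound is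
  already good enough.
\<close>

lemma quasi_analytic_propagation_step:
  fixes P :: "nat \<Rightarrow> real \<Rightarrow> real \<Rightarrow> bool" and M :: "nat \<Rightarrow> real"
  assumes M_pos: "\<And>n. M n > 0"
    and ratio: "incseq (\<lambda>n. M (Suc n) / M n)"
    and bound: "\<And>n t. P n t (M n)"
    and mono: "\<And>n t r s. P n t r \<Longrightarrow> r \<le> s \<Longrightarrow> P n t s"
    and taylor: "\<And>n t h J r. 0 \<le> h \<Longrightarrow> (\<And>j. j < J \<Longrightarrow> P (n + j) t (r j)) \<Longrightarrow>
      P n (t + h) ((\<Sum>j<J. h ^ j / fact j * r j) + h ^ J / fact J * M (n + J))"
    and level: "\<And>n. P n t (M n * exp (real n - real (Suc N)))"
    and h: "0 \<le> h" "h \<le> M N / (exp 1 * M (Suc N))"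
  shows "P n (t + h) (M n * exp (real n - real N))"
proof (cases "n \<le> N")
  case False
  then have "M n * 1 \<le> M n * exp (real n - real N)"
    using M_pos[of n] by (intro mult_left_mono) auto
  then show ?thesis using mono[OF bound] by simp
next
  case True
  define \<mu> where "\<mu> = M (Suc N) / M N"
  have \<mu>_pos: "\<mu> > 0" using M_pos by (simp add: \<mu>_def)
  have h\<mu>: "h * \<mu> * exp 1 \<le> 1"
    using h(2) M_pos[of N] M_pos[of "Suc N"] by (simp add: \<mu>_def field_simps)
  define J where "J = Suc N - n"
  have J: "n + J = Suc N" using True by (simp add: J_def)
  have M_le: "M (n + j) \<le> M n * \<mu> ^ j" if "n + j \<le> Suc N" for j
    using that
  proof (induction j)
    case (Suc j)
    have "M (Suc (n + j)) / M (n + j) \<le> \<mu>"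
      unfolding \<mu>_def using incseqD[OF ratio, of "n + j" N] Suc.prems by simp
    then have "M (Suc (n + j)) \<le> \<mu> * M (n + j)"
      using M_pos[of "n + j"] by (simp add: field_simps)
    also have "\<dots> \<le> \<mu> * (M n * \<mu> ^ j)"
      using Suc \<mu>_pos by (intro mult_left_mono) auto
    finally show ?case by (simp add: ac_simps)
  qed simp
  define e where "e = M n * exp (real n - real (Suc N))"
  have e_pos: "e > 0" using M_pos by (simp add: e_def)
  \<comment> \<open>The term of order \<open>j\<close> carries the factor \<open>e\<^sup>j\<close> of its own level; it combines with \<open>h \<mu>\<close>.\<close>
  have term_le: "h ^ j / fact j * (M (n + j) * exp (real (n + j) - real (Suc N))) \<le> e * (1 / fact j)"
    if "n + j \<le> Suc N" for j
  proof -
    have "h ^ j * M (n + j) * exp (real (n + j) - real (Suc N))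
        \<le> h ^ j * (M n * \<mu> ^ j) * exp (real (n + j) - real (Suc N))"
      using M_le[OF that] h by (intro mult_right_mono mult_left_mono) auto
    also have "\<dots> = e * (h * \<mu> * exp 1) ^ j"
    proof -
      have "exp (real (n + j) - real (Suc N)) = exp (real n - real (Suc N)) * exp 1 ^ j"
        by (simp add: exp_of_nat_mult[symmetric] exp_add[symmetric] algebra_simps)
      then show ?thesis by (simp add: e_def power_mult_distrib)
    qed
    also have "\<dots> \<le> e * 1"
      using h\<mu> h \<mu>_pos e_pos by (intro mult_left_mono power_le_one) auto
    finally show ?thesis by (simp add: field_simps)
  qed
  define r where "r j = M (n + j) * exp (real (n + j) - real (Suc N))" for j
  have "real n + real J = real (Suc N)"
    using J by (simp only: of_nat_add[symmetric])
  then have "(\<Sum>j<J. h ^ j / fact j * r j) + h ^ J / fact J * M (n + J)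
      = (\<Sum>j<Suc J. h ^ j / fact j * r j)"
    by (simp add: r_def)
  also have "\<dots> \<le> (\<Sum>j<Suc J. e * (1 / fact j))"
    unfolding r_def by (intro sum_mono term_le) (use J in auto)
  also have "\<dots> = e * (\<Sum>j<Suc J. 1 / fact j)"
    by (simp only: sum_distrib_left)
  also have "\<dots> \<le> e * exp 1"
    using sum_inverse_fact_le_exp[of "Suc J"] e_pos by (intro mult_left_mono) auto
  also have "\<dots> = M n * exp (real n - real N)"
    by (simp add: e_def exp_add[symmetric] algebra_simps)
  finally show ?thesis
    using mono[OF taylor[OF h(1), of J n t r]] level unfolding r_def by blast
qed

text \<open>
  At \<open>t = 0\<close> all levels hold. Descending from level \<open>K\<close> to level \<open>k\<close> takes a time of at least
  \<open>\<Sum>N\<in>{k..<K}. M N / (e M (N + 1))\<close>, which tends to infinity with \<open>K\<close>. So at every \<open>t \<ge> 0\<close> level \<open>k\<close>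
  holds, for each \<open>k\<close>.
\<close>

theorem quasi_analytic_propagation:
  fixes P :: "nat \<Rightarrow> real \<Rightarrow> real \<Rightarrow> bool" and M :: "nat \<Rightarrow> real"
  assumes M_pos: "\<And>n. M n > 0"
    and ratio: "incseq (\<lambda>n. M (Suc n) / M n)"
    and div: "\<not> summable (\<lambda>n. M n / M (Suc n))"
    and start: "\<And>n. P n 0 0"
    and bound: "\<And>n t. P n t (M n)"
    and mono: "\<And>n t r s. P n t r \<Longrightarrow> r \<le> s \<Longrightarrow> P n t s"
    and taylor: "\<And>n t h J r. 0 \<le> h \<Longrightarrow> (\<And>j. j < J \<Longrightarrow> P (n + j) t (r j)) \<Longrightarrow>
      P n (t + h) ((\<Sum>j<J. h ^ j / fact j * r j) + h ^ J / fact J * M (n + J))"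
    and "t \<ge> 0" "\<epsilon> > 0"
  shows "P n t \<epsilon>"
proof -
  define s where "s N = M N / (exp 1 * M (Suc N))" for N
  have s_pos: "s N > 0" for N using M_pos by (simp add: s_def)
  have level: "P n t (M n * exp (real n - real k))"
    if "k \<le> K" "0 \<le> t" "t \<le> (\<Sum>N\<in>{k..<K}. s N)" for k K t n
    using that
  proof (induction arbitrary: n t rule: inc_induct)
    case base
    then have "t = 0" by simp
    moreover have "0 \<le> M n * exp (real n - real K)" using M_pos[of n] by simp
    ultimately show ?case using mono[OF start] by blast
  next
    case (step k)
    \<comment> \<open>The part of the way up to \<open>t'\<close> is covered by the induction hypothesis, the rest is one step.\<close>
    define t' where "t' = min t (\<Sum>N\<in>{Suc k..<K}. s N)"
    have sum_nonneg: "(\<Sum>N\<in>{Suc k..<K}. s N) \<ge> 0"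
      by (intro sum_nonneg less_imp_le[OF s_pos])
    have "(\<Sum>N\<in>{k..<K}. s N) = s k + (\<Sum>N\<in>{Suc k..<K}. s N)"
      using step.hyps by (simp add: sum.atLeast_Suc_lessThan)
    then have h: "0 \<le> t - t'" "t - t' \<le> s k"
      using step.prems s_pos[of k] by (auto simp: t'_def)
    have "P n t' (M n * exp (real n - real (Suc k)))" for n
      by (rule step.IH) (use step.prems sum_nonneg in \<open>auto simp: t'_def\<close>)
    then have "P n (t' + (t - t')) (M n * exp (real n - real k))"
      using h unfolding s_def
      by (intro quasi_analytic_propagation_step[where P = P and M = M, OF M_pos ratio bound mono taylor])
    then show ?case by simp
  qed
  obtain k :: nat where k: "M n * exp (real n - real k) \<le> \<epsilon>"
  proof -
    obtain k :: nat where "ln (M n * exp (real n) / \<epsilon>) \<le> real k"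
      using real_arch_simple by blast
    then have "exp (ln (M n * exp (real n) / \<epsilon>)) \<le> exp (real k)" by simp
    then have "M n * exp (real n) / \<epsilon> \<le> exp (real k)"
      using M_pos[of n] \<open>\<epsilon> > 0\<close> by simp
    then have "M n * exp (real n - real k) \<le> \<epsilon>"
      using \<open>\<epsilon> > 0\<close> by (simp add: exp_diff field_simps)
    then show ?thesis by (rule that)
  qed
  have "\<not> summable s"
    using div summable_mult[of s "exp 1"] by (auto simp: s_def)
  then have "\<not> summable (\<lambda>i. s (i + k))" by simp
  then have "\<exists>n. \<not> (\<Sum>i<n. s (i + k)) \<le> t"
    using summableI_nonneg_bounded[of "\<lambda>i. s (i + k)" t] s_pos less_imp_le by blast
  then obtain n' where "t \<le> (\<Sum>i<n'. s (i + k))" using linorder_linear by blast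
  also have "\<dots> = (\<Sum>N\<in>{k..<n' + k}. s N)"
    by (simp add: sum.shift_bounds_nat_ivl[of s 0 k n', simplified] lessThan_atLeast0)
  finally show ?thesis
    using level[of k "n' + k" t n] k mono \<open>t \<ge> 0\<close> by auto
qed

text \<open>
  Polya's proof: the weights \<open>c\<close> are chosen such that \<open>c 0 \<cdots> c n = (n + 2)\<^sup>n\<^sup>+\<^sup>1\<close>. The inequality between
  the means for \<open>a k * c k\<close> then brings in the telescoping factor \<open>1 / ((n + 1) (n + 2))\<close>, and after
  exchanging the sums only \<open>c k / (k + 1) \<le> e\<close> is left.
\<close>

lemma carleman_inequality:
  fixes a :: "nat \<Rightarrow> real"
  assumes pos: "\<And>n. a n > 0" and sm: "summable a"
  shows "summable (\<lambda>n. (\<Prod>k\<le>n. a k) powr (1 / real (Suc n)))"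
proof -
  define c where "c k = real (k + 2) ^ Suc k / real (Suc k) ^ k" for k
  define d where "d n = 1 / (real (Suc n) * real (n + 2))" for n
  have c_pos: "c k > 0" for k by (simp add: c_def)
  have prod_c: "(\<Prod>k\<le>n. c k) = real (n + 2) ^ Suc n" for n
  proof (induction n)
    case (Suc n)
    have "c (Suc n) = real (Suc n + 2) ^ Suc (Suc n) / real (n + 2) ^ Suc n"
      by (simp add: c_def del: power_Suc)
    then show ?case by (simp add: Suc del: power_Suc)
  qed (simp add: c_def)
  have c_le: "c k / real (Suc k) \<le> exp 1" for k
  proof -
    have "c k / real (Suc k) = (real (k + 2) / real (Suc k)) ^ Suc k"
      by (simp add: c_def power_divide)
    also have "real (k + 2) / real (Suc k) = 1 + 1 / real (Suc k)"
      by (simp add: field_simps)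
    also have "\<dots> ^ Suc k \<le> exp (1 / real (Suc k)) ^ Suc k"
      by (intro power_mono exp_ge_add_one_self) auto
    also have "\<dots> = exp 1"
      by (simp only: exp_of_nat_mult[symmetric]) simp
    finally show ?thesis .
  qed
  have amgm: "(\<Prod>k\<le>n. a k) powr (1 / real (Suc n))
      \<le> (\<Sum>k\<le>n. a k * c k) * d n" for n
  proof -
    have "(\<Prod>k\<le>n. a k * c k) powr (1 / real (Suc n)) \<le> (\<Sum>k\<le>n. a k * c k / real (Suc n))"
      using arith_geom_mean[of "{..n}" "\<lambda>k. a k * c k"] less_imp_le[OF pos] less_imp_le[OF c_pos]
      by (auto simp: root_powr_inverse prod_pos pos c_pos)
    moreover have "(\<Prod>k\<le>n. a k * c k) powr (1 / real (Suc n))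
        = (\<Prod>k\<le>n. a k) powr (1 / real (Suc n)) * real (n + 2)"
    proof -
      have "(real (n + 2) ^ Suc n) powr (1 / real (Suc n)) = real (n + 2)"
        by (simp only: powr_realpow[symmetric] of_nat_0_less_iff powr_powr) simp
      then show ?thesis
        by (simp only: prod.distrib prod_c powr_mult)
    qed
    ultimately have "(\<Prod>k\<le>n. a k) powr (1 / real (Suc n)) * real (n + 2)
        \<le> (\<Sum>k\<le>n. a k * c k) / real (Suc n)"
      by (simp only: sum_divide_distrib)
    then have "(\<Prod>k\<le>n. a k) powr (1 / real (Suc n))
        \<le> (\<Sum>k\<le>n. a k * c k) / real (Suc n) / real (n + 2)"
      by (subst pos_le_divide_eq) auto
    then show ?thesis by (simp add: d_def)
  qed
  have telescope: "(\<Sum>n\<in>{k..<N}. d n) \<le> 1 / real (Suc k)" for k N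
  proof (cases "k \<le> N")
    case True
    have "(\<Sum>n\<in>{k..<N}. d n)
        = (\<Sum>n\<in>{k..<N}. - (1 / real (Suc (Suc n))) - - (1 / real (Suc n)))"
      by (intro sum.cong) (auto simp: d_def field_simps)
    also have "\<dots> = - (1 / real (Suc N)) - - (1 / real (Suc k))"
      using True by (rule sum_Suc_diff'[of k N "\<lambda>n. - (1 / real (Suc n))"])
    finally show ?thesis by simp
  qed simp
  have "(\<Sum>n<N. (\<Prod>k\<le>n. a k) powr (1 / real (Suc n))) \<le> exp 1 * suminf a" for N
  proof -
    have "(\<Sum>n<N. (\<Prod>k\<le>n. a k) powr (1 / real (Suc n)))
        \<le> (\<Sum>n<N. \<Sum>k\<le>n. a k * c k * d n)"
      by (intro sum_mono) (use amgm in \<open>simp only: sum_distrib_right\<close>)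
    also have "\<dots> = (\<Sum>k<N. \<Sum>n\<in>{k..<N}. a k * c k * d n)"
      by (subst sum.Sigma; (subst sum.Sigma)?)
        (auto intro!: sum.reindex_bij_witness[of _ "\<lambda>(k, n). (n, k)" "\<lambda>(n, k). (k, n)"])
    also have "\<dots> \<le> (\<Sum>k<N. a k * exp 1)"
    proof (intro sum_mono)
      fix k
      have "(\<Sum>n\<in>{k..<N}. a k * c k * d n)
          = a k * c k * (\<Sum>n\<in>{k..<N}. d n)"
        by (simp only: sum_distrib_left)
      also have "\<dots> \<le> a k * c k * (1 / real (Suc k))"
        using less_imp_le[OF pos] less_imp_le[OF c_pos]
        by (intro mult_left_mono[OF telescope]) auto
      also have "\<dots> = a k * (c k / real (Suc k))" by simp
      also have "\<dots> \<le> a k * exp 1"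
        using less_imp_le[OF pos] by (intro mult_left_mono[OF c_le]) auto
      finally show "(\<Sum>n\<in>{k..<N}. a k * c k * d n) \<le> a k * exp 1" .
    qed
    also have "\<dots> = exp 1 * (\<Sum>k<N. a k)"
      by (simp add: sum_distrib_right[symmetric])
    also have "\<dots> \<le> exp 1 * suminf a"
      using sm less_imp_le[OF pos] by (intro mult_left_mono sum_le_suminf) auto
    finally show ?thesis .
  qed
  then show ?thesis
    by (intro summableI_nonneg_bounded) auto
qed


lemma not_summable_odd_subsequence:
  fixes q :: "nat \<Rightarrow> real"
  assumes "decseq q" "\<And>n. q n \<ge> 0" "\<not> summable q"
  shows "\<not> summable (\<lambda>n. q (2 * n + 1))"
proof
  assume sm: "summable (\<lambda>n. q (2 * n + 1))"
  have partial: "(\<Sum>k<2 * N + 1. q k) \<le> q 0 + 2 * (\<Sum>n<N. q (2 * n + 1))" for N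
  proof (induction N)
    case (Suc N)
    have "q (2 * N + 2) \<le> q (2 * N + 1)" using decseqD[OF assms(1)] by simp
    then show ?case using Suc by (simp add: eval_nat_numeral)
  qed simp
  have "(\<Sum>k<n. q k) \<le> q 0 + 2 * suminf (\<lambda>n. q (2 * n + 1))" for n
  proof -
    have "(\<Sum>k<n. q k) \<le> (\<Sum>k<2 * n + 1. q k)"
      using assms(2) by (intro sum_mono2) auto
    also have "\<dots> \<le> q 0 + 2 * (\<Sum>n<n. q (2 * n + 1))" by (rule partial)
    also have "\<dots> \<le> q 0 + 2 * suminf (\<lambda>n. q (2 * n + 1))"
      using sum_le_suminf[OF sm, of "{..<n}"] assms(2) by simp
    finally show ?thesis .
  qed
  then show False using assms(2,3) summableI_nonneg_bounded by blast
qed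

text \<open>
  The numbers \<open>1 + m n\<close> are the even moments of the measure with a unit mass added at \<open>1\<close>; they are
  positive even if the moments \<open>m n\<close> vanish. The product of the first \<open>n + 1\<close> ratios telescopes to
  \<open>(1 + m 0) / (1 + m (n + 1))\<close>, so by Carleman's inequality convergence of the series of their
  square roots would force convergence of the series in Carleman's condition.
\<close>

lemma carleman_imp_ratio_divergence:
  fixes m :: "nat \<Rightarrow> real"
  assumes nonneg: "\<And>n. m n \<ge> 0"
    and logconvex: "\<And>n. (m (Suc n))\<^sup>2 \<le> m n * m (Suc (Suc n))"
    and carleman: "suminf (\<lambda>d. inverse (ennreal (m (Suc d) powr (1 / (2 * real (Suc d)))))) = \<infinity>"
  shows "\<not> summable (\<lambda>n. sqrt ((1 + m n) / (1 + m (Suc n))))"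
proof
  assume sm: "summable (\<lambda>n. sqrt ((1 + m n) / (1 + m (Suc n))))"
  have pos: "1 + m n > 0" for n using nonneg[of n] by linarith
  define \<rho> where "\<rho> k = (1 + m k) / (1 + m (Suc k))" for k
  have prod_ratio: "(\<Prod>k\<le>n. \<rho> k) = (1 + m 0) / (1 + m (Suc n))" for n
    by (induction n) (use pos in \<open>auto simp: \<rho>_def less_imp_neq[symmetric]\<close>)
  define z where "z n = (1 / (1 + m (Suc n))) powr (1 / (2 * real (Suc n)))" for n
  have z_le: "z n \<le> (\<Prod>k\<le>n. sqrt (\<rho> k)) powr (1 / real (Suc n))" for n
  proof -
    have "(\<Prod>k\<le>n. sqrt (\<rho> k)) = sqrt ((1 + m 0) / (1 + m (Suc n)))"
      unfolding prod_ratio[symmetric]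
      by (induction n) (simp_all add: real_sqrt_mult[symmetric])
    also have "\<dots> = ((1 + m 0) / (1 + m (Suc n))) powr (1 / 2)"
      using pos by (simp add: powr_half_sqrt less_imp_le)
    finally have "(\<Prod>k\<le>n. sqrt (\<rho> k)) powr (1 / real (Suc n))
        = ((1 + m 0) / (1 + m (Suc n))) powr (1 / (2 * real (Suc n)))"
      by (simp add: powr_powr)
    moreover have "1 / (1 + m (Suc n)) \<le> (1 + m 0) / (1 + m (Suc n))"
      using pos[of "Suc n"] nonneg[of 0] by (intro divide_right_mono) auto
    ultimately show ?thesis
      unfolding z_def using pos[of "Suc n"] by (auto intro!: powr_mono2)
  qed
  have sm_z: "summable z"
  proof (rule summable_comparison_test'[OF carleman_inequality[OF _ sm[folded \<rho>_def]]])
    show "0 < sqrt (\<rho> n)" for n using pos by (simp add: \<rho>_def)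
    show "norm (z n) \<le> (\<Prod>k\<le>n. sqrt (\<rho> k)) powr (1 / real (Suc n))" for n
      using z_le[of n] by (simp add: z_def)
  qed
  have half_le: "1 / 2 \<le> (1 / 2) powr (1 / (2 * real (Suc n)))" for n
    using powr_mono'[of "1 / (2 * real (Suc n))" 1 "1 / 2"] by simp
  have "eventually (\<lambda>n. z n < 1 / 2) sequentially"
    using summable_LIMSEQ_zero[OF sm_z] by (rule order_tendstoD) simp
  then have ev: "eventually (\<lambda>n. m (Suc n) \<ge> 1) sequentially"
  proof eventually_elim
    case (elim n)
    show ?case
    proof (rule ccontr)
      assume "\<not> ?thesis"
      then have "1 / 2 \<le> 1 / (1 + m (Suc n))" using pos[of "Suc n"] by (simp add: field_simps)
      then have "(1 / 2) powr (1 / (2 * real (Suc n))) \<le> z n"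
        unfolding z_def by (intro powr_mono2) auto
      then show False using half_le[of n] elim by linarith
    qed
  qed
  \<comment> \<open>By log-convexity a vanishing moment would make all later ones vanish.\<close>
  have m_pos: "m (Suc n) > 0" for n
  proof (rule ccontr)
    assume "\<not> ?thesis"
    then have 0: "m (Suc n) = 0" using nonneg[of "Suc n"] by simp
    have "m (Suc (n + k)) = 0" for k
    proof (induction k)
      case (Suc k)
      have "(m (Suc (Suc (n + k))))\<^sup>2 \<le> 0"
        using logconvex[of "Suc (n + k)"] Suc by simp
      then show ?case by simp
    qed (simp add: 0)
    moreover obtain K where "\<And>n. n \<ge> K \<Longrightarrow> m (Suc n) \<ge> 1"
      using ev unfolding eventually_sequentially by blast
    ultimately show False by (metis le_add2 not_one_le_zero)
  qed
  define w where "w n = (1 / m (Suc n)) powr (1 / (2 * real (Suc n)))" for n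
  have w_nonneg: "w n \<ge> 0" for n by (simp add: w_def)
  \<comment> \<open>Once \<open>m \<ge> 1\<close>, replacing \<open>m\<close> by \<open>1 + m \<le> 2 m\<close> costs at most the factor \<open>2\<close>.\<close>
  have "eventually (\<lambda>n. norm (w n) \<le> 2 * z n) sequentially"
    using ev
  proof eventually_elim
    case (elim n)
    have "w n / 2 \<le> w n * (1 / 2) powr (1 / (2 * real (Suc n)))"
      using mult_left_mono[OF half_le[of n], of "w n"] w_nonneg by simp
    also have "\<dots> = (1 / m (Suc n) * (1 / 2)) powr (1 / (2 * real (Suc n)))"
      using m_pos[of n] by (simp only: w_def powr_mult)
    also have "\<dots> \<le> z n"
      unfolding z_def using elim m_pos[of n]
      by (intro powr_mono2) (auto simp: field_simps)
    finally show ?case using w_nonneg by simp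
  qed
  then have sm_w: "summable w"
    by (rule summable_comparison_test_ev) (intro summable_mult sm_z)
  have "inverse (ennreal (m (Suc d) powr (1 / (2 * real (Suc d))))) = ennreal (w d)" for d
    using m_pos[of d] by (simp add: w_def inverse_ennreal powr_divide inverse_eq_divide)
  then have "suminf (\<lambda>d. inverse (ennreal (m (Suc d) powr (1 / (2 * real (Suc d)))))) = ennreal (suminf w)"
    using suminf_ennreal2[OF w_nonneg sm_w] by simp
  then show False using carleman by simp
qed

text \<open>
  Fourth roots of \<open>m (2 n)\<close>, the moment of order \<open>4 n\<close>, arise when the Cauchy-Schwarz inequality is
  used to bound the norm of \<open>y\<^sub>j\<^sup>n p\<close> in a weighted \<open>L\<^sup>2\<close> space. The quotient of two
  consecutive ones is the geometric mean of two neighbouring terms of the divergent series in the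
  preceding lemma; as its terms decrease, it is harmless to keep only every second one.
\<close>

lemma fourth_root_moment_growth:
  fixes m :: "nat \<Rightarrow> real"
  assumes nonneg: "\<And>n. m n \<ge> 0"
    and logconvex: "\<And>n. (m (Suc n))\<^sup>2 \<le> m n * m (Suc (Suc n))"
    and carleman: "suminf (\<lambda>d. inverse (ennreal (m (Suc d) powr (1 / (2 * real (Suc d)))))) = \<infinity>"
  defines "M \<equiv> \<lambda>n. sqrt (sqrt (1 + m (2 * n)))"
  shows "M n > 0" "incseq (\<lambda>n. M (Suc n) / M n)" "\<not> summable (\<lambda>n. M n / M (Suc n))"
proof -
  define b where "b n = 1 + m n" for n
  have b_pos: "b n > 0" for n unfolding b_def using nonneg[of n] by linarith
  have M: "M n = sqrt (sqrt (b (2 * n)))" for n by (simp add: M_def b_def)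
  show "M n > 0" using b_pos by (simp add: M)
  have b_logconvex: "(b (Suc n))\<^sup>2 \<le> b n * b (Suc (Suc n))" for n
  proof -
    have "(2 * m (Suc n))\<^sup>2 \<le> 4 * (m n * m (Suc (Suc n)))"
      using logconvex[of n] by (simp add: power_mult_distrib)
    also have "\<dots> \<le> (m n + m (Suc (Suc n)))\<^sup>2"
      using sum_squares_bound[of "m n" "m (Suc (Suc n))"] by (simp add: power2_sum)
    finally have "(2 * m (Suc n))\<^sup>2 \<le> (m n + m (Suc (Suc n)))\<^sup>2" .
    then have "2 * m (Suc n) \<le> m n + m (Suc (Suc n))"
      by (rule power2_le_imp_le) (use nonneg[of n] nonneg[of "Suc (Suc n)"] in linarith)
    then show ?thesis
      using logconvex[of n] by (simp add: b_def power2_eq_square algebra_simps)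
  qed
  have ratio_dec: "decseq (\<lambda>n. b n / b (Suc n))"
    unfolding decseq_Suc_iff
  proof
    fix n
    show "b (Suc n) / b (Suc (Suc n)) \<le> b n / b (Suc n)"
      using b_logconvex[of n] b_pos[of "Suc n"] b_pos[of "Suc (Suc n)"]
      by (simp add: divide_le_eq le_divide_eq power2_eq_square mult.commute)
  qed
  have two_step: "b (2 * n) / b (2 * Suc n)
      = (b (2 * n) / b (Suc (2 * n))) * (b (Suc (2 * n)) / b (Suc (Suc (2 * n))))" for n
    using b_pos[of "Suc (2 * n)"] by simp
  have M_ratio: "M n / M (Suc n) = sqrt (sqrt (b (2 * n) / b (2 * Suc n)))" for n
    by (simp add: M real_sqrt_divide)
  have two_dec: "b (2 * Suc n) / b (2 * Suc (Suc n)) \<le> b (2 * n) / b (2 * Suc n)" for n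
    unfolding two_step
    using decseqD[OF ratio_dec, of "2 * n" "2 * Suc n"]
      decseqD[OF ratio_dec, of "Suc (2 * n)" "Suc (2 * Suc n)"] b_pos
    by (intro mult_mono) (auto simp: less_imp_le)
  have M_pos: "M n > 0" for n using b_pos by (simp add: M)
  have "M (Suc n) / M (Suc (Suc n)) \<le> M n / M (Suc n)" for n
    unfolding M_ratio using two_dec by simp
  then show "incseq (\<lambda>n. M (Suc n) / M n)"
    unfolding incseq_Suc_iff using M_pos by (simp add: field_simps)
  define q where "q n = sqrt (b n / b (Suc n))" for n
  have "\<not> summable (\<lambda>n. q (2 * n + 1))"
  proof (rule not_summable_odd_subsequence)
    show "decseq q" unfolding decseq_Suc_iff q_def
      using decseq_SucD[OF ratio_dec] by simp
    show "q n \<ge> 0" for n using b_pos by (simp add: q_def less_imp_le)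
    show "\<not> summable q"
      unfolding q_def b_def by (rule carleman_imp_ratio_divergence[OF nonneg logconvex carleman])
  qed
  moreover have "norm (q (2 * n + 1)) \<le> M n / M (Suc n)" for n
  proof -
    have "(b (Suc (2 * n)) / b (Suc (Suc (2 * n))))\<^sup>2 \<le> b (2 * n) / b (2 * Suc n)"
      unfolding two_step power2_eq_square
      using decseq_SucD[OF ratio_dec, of "2 * n"] b_pos
      by (intro mult_right_mono) (auto simp: less_imp_le)
    then have "b (Suc (2 * n)) / b (Suc (Suc (2 * n))) \<le> sqrt (b (2 * n) / b (2 * Suc n))"
      by (rule real_le_rsqrt)
    then show ?thesis unfolding M_ratio q_def using b_pos by (simp add: less_imp_le)
  qed
  ultimately show "\<not> summable (\<lambda>n. M n / M (Suc n))"
    using summable_comparison_test'[of "\<lambda>n. M n / M (Suc n)" 0 "\<lambda>n. q (2 * n + 1)"] by blast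
qed

section \<open>Polynomial approximation in weighted spaces\<close>

lemmas polynomial_closure = real_polynomial_function.intros(2-4)

text \<open>
  Writing the derivatives of the cosine as phase shifts keeps everything real-valued.
\<close>

lemma cos_shift_taylor:
  fixes a x :: real
  shows "\<bar>cos (a + x) - (\<Sum>j<J. x ^ j / fact j * cos (a + real j * (pi / 2)))\<bar> \<le> \<bar>x\<bar> ^ J / fact J"
proof -
  define D where "D m z = cos (a + z + real m * (pi / 2))" for m z
  have D_Suc: "D (Suc m) z = - sin (a + z + real m * (pi / 2))" for m z
  proof -
    have "D (Suc m) z = cos ((a + z + real m * (pi / 2)) + pi / 2)"
      unfolding D_def of_nat_Suc by (simp only: distrib_right mult_1 add_ac)
    also have "\<dots> = - sin (a + z + real m * (pi / 2))" by (simp add: cos_add)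
    finally show ?thesis .
  qed
  have deriv: "(D m has_real_derivative D (Suc m) z) (at z)" for m z
    unfolding D_Suc unfolding D_def by (auto intro!: derivative_eq_intros)
  have "\<exists>t. \<bar>t\<bar> \<le> \<bar>x\<bar> \<and> D 0 x = (\<Sum>m<J. D m 0 / fact m * x ^ m) + D J t / fact J * x ^ J"
    by (rule Maclaurin_all_le) (use deriv in auto)
  then obtain t where t: "D 0 x = (\<Sum>m<J. D m 0 / fact m * x ^ m) + D J t / fact J * x ^ J"
    by blast
  have "D 0 x = cos (a + x)" by (simp add: D_def)
  moreover have "(\<Sum>m<J. D m 0 / fact m * x ^ m)
      = (\<Sum>j<J. x ^ j / fact j * cos (a + real j * (pi / 2)))"
    by (intro sum.cong) (auto simp: D_def)
  ultimately have "cos (a + x) - (\<Sum>j<J. x ^ j / fact j * cos (a + real j * (pi / 2)))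
      = D J t / fact J * x ^ J"
    using t by simp
  moreover have "\<bar>D J t / fact J * x ^ J\<bar> \<le> 1 / fact J * \<bar>x\<bar> ^ J"
    unfolding abs_mult power_abs abs_divide
    by (intro mult_right_mono) (auto simp: D_def intro!: divide_right_mono)
  ultimately show ?thesis by simp
qed

text \<open>
  The convergence is bounded by \<open>1\<close> on the whole line, so that it holds in every \<open>L\<^sup>2\<close> space of a finite
  measure; this is how Gaussians are reached from cosines.
\<close>

lemma cos_power_tendsto_gaussian:
  "(\<lambda>n. cos (s / sqrt (real (Suc n))) ^ Suc n) \<longlonglongrightarrow> exp (- (s\<^sup>2 / 2))"
proof -
  have lim: "((\<lambda>x::real. cos (s / sqrt x) powr x) \<longlongrightarrow> exp (- (s * s / 2))) at_top"
    by real_asymp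
  have pos: "eventually (\<lambda>x::real. cos (s / sqrt x) > 0) at_top"
    by real_asymp
  have "filterlim (\<lambda>n. real (Suc n)) at_top sequentially" by real_asymp
  note comp = filterlim_compose[OF lim this]
  have "eventually (\<lambda>n. cos (s / sqrt (real (Suc n))) > 0) sequentially"
    by (rule eventually_compose_filterlim[OF pos]) real_asymp
  then have "eventually (\<lambda>n. cos (s / sqrt (real (Suc n))) powr real (Suc n)
      = cos (s / sqrt (real (Suc n))) ^ Suc n) sequentially"
    by eventually_elim (simp only: powr_realpow)
  from Lim_transform_eventually[OF comp this] show ?thesis by (simp only: power2_eq_square)
qed

locale moment_measure =
  fixes \<mu> :: "(real^'m::finite) measure"
  assumes sets_\<mu>: "sets \<mu> = sets borel"
    and integrable_polynomial: "real_polynomial_function p \<Longrightarrow> integrable \<mu> p"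
begin

lemma measurable_\<mu> [simp]: "borel_measurable \<mu> = borel_measurable borel"
  by (rule measurable_cong_sets) (auto simp: sets_\<mu>)

text \<open>
  All functions below are dominated by polynomials, which settles the existence of every integral.
\<close>

definition poly_bounded :: "(real^'m \<Rightarrow> real) \<Rightarrow> bool" where
  "poly_bounded f \<longleftrightarrow> f \<in> borel_measurable borel \<and>
     (\<exists>p. real_polynomial_function p \<and> (\<forall>y. \<bar>f y\<bar> \<le> p y))"

lemma poly_bounded_measurable: "poly_bounded f \<Longrightarrow> f \<in> borel_measurable borel"
  by (simp add: poly_bounded_def)

lemma poly_bounded_integrable:
  assumes "poly_bounded f" shows "integrable \<mu> f"
proof -
  obtain p where p: "real_polynomial_function p" "\<And>y. \<bar>f y\<bar> \<le> p y"
    using assms unfolding poly_bounded_def by blast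
  have "AE y in \<mu>. norm (f y) \<le> norm (p y)"
    using p(2) by (intro AE_I2) (simp add: order_trans[OF p(2) abs_ge_self])
  then show ?thesis
    using integrable_polynomial[OF p(1)] poly_bounded_measurable[OF assms]
    by (intro Bochner_Integration.integrable_bound[of \<mu> p f]) auto
qed

lemma poly_bounded_mult:
  assumes "poly_bounded f" "poly_bounded g" shows "poly_bounded (\<lambda>y. f y * g y)"
proof -
  obtain p q where pq: "real_polynomial_function p" "\<And>y. \<bar>f y\<bar> \<le> p y"
    "real_polynomial_function q" "\<And>y. \<bar>g y\<bar> \<le> q y"
    using assms unfolding poly_bounded_def by blast
  have "\<bar>f y * g y\<bar> \<le> p y * q y" for y
    unfolding abs_mult using pq(2)[of y] pq(4)[of y] by (intro mult_mono) auto
  moreover have "real_polynomial_function (\<lambda>y. p y * q y)"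
    using pq by (intro polynomial_closure)
  ultimately show ?thesis using assms unfolding poly_bounded_def by auto
qed

lemma poly_bounded_add:
  assumes "poly_bounded f" "poly_bounded g" shows "poly_bounded (\<lambda>y. f y + g y)"
proof -
  obtain p q where pq: "real_polynomial_function p" "\<And>y. \<bar>f y\<bar> \<le> p y"
    "real_polynomial_function q" "\<And>y. \<bar>g y\<bar> \<le> q y"
    using assms unfolding poly_bounded_def by blast
  have "\<bar>f y + g y\<bar> \<le> p y + q y" for y
    using pq(2)[of y] pq(4)[of y] by linarith
  moreover have "real_polynomial_function (\<lambda>y. p y + q y)"
    using pq by (intro polynomial_closure)
  ultimately show ?thesis using assms unfolding poly_bounded_def by auto
qed

lemma poly_bounded_bounded:
  assumes "f \<in> borel_measurable borel" "\<And>y. \<bar>f y\<bar> \<le> c"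
  shows "poly_bounded f"
  unfolding poly_bounded_def using assms real_polynomial_function.intros(2)[of c] by auto

lemma poly_bounded_polynomial:
  assumes "real_polynomial_function p" shows "poly_bounded p"
proof -
  have "\<bar>p y\<bar> \<le> 1 + p y * p y" for y
  proof (rule abs_leI)
    show "p y \<le> 1 + p y * p y" "- p y \<le> 1 + p y * p y"
      using sum_squares_bound[of "p y" 1] sum_squares_bound[of "- p y" 1]
        zero_le_square[of "p y"] by (auto simp: power2_eq_square)
  qed
  moreover have "real_polynomial_function (\<lambda>y. 1 + p y * p y)"
    using assms by (intro polynomial_closure)
  moreover have "p \<in> borel_measurable borel"
    by (rule borel_measurable_polynomial[OF assms])
  ultimately show ?thesis unfolding poly_bounded_def by blast
qed

lemma poly_bounded_cmult: "poly_bounded f \<Longrightarrow> poly_bounded (\<lambda>y. c * f y)"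
  by (rule poly_bounded_mult[OF poly_bounded_bounded[where c = "\<bar>c\<bar>"]]) auto

lemma poly_bounded_diff:
  assumes "poly_bounded f" "poly_bounded g" shows "poly_bounded (\<lambda>y. f y - g y)"
  using poly_bounded_add[OF assms(1) poly_bounded_cmult[OF assms(2), of "- 1"]] by simp

lemma poly_bounded_sum:
  assumes "\<And>i. i \<in> I \<Longrightarrow> poly_bounded (f i)" shows "poly_bounded (\<lambda>y. \<Sum>i\<in>I. f i y)"
  using assms
proof (induction I rule: infinite_finite_induct)
  case (insert i I)
  then show ?case by (simp add: poly_bounded_add)
qed (auto intro: poly_bounded_bounded[where c = 0])

definition l2 :: "(real^'m \<Rightarrow> real) \<Rightarrow> real" where
  "l2 f = sqrt (\<integral>y. (f y)\<^sup>2 \<partial>\<mu>)"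

lemma l2_nonneg [simp]: "l2 f \<ge> 0"
  by (simp add: l2_def)

lemma l2_square: "(l2 f)\<^sup>2 = (\<integral>y. (f y)\<^sup>2 \<partial>\<mu>)"
  by (simp add: l2_def)

lemma l2_cauchy_schwarz:
  assumes f: "poly_bounded f" and g: "poly_bounded g"
  shows "\<bar>\<integral>y. f y * g y \<partial>\<mu>\<bar> \<le> l2 f * l2 g"
proof -
  let ?A = "\<integral>y. f y * f y \<partial>\<mu>" and ?B = "\<integral>y. f y * g y \<partial>\<mu>" and ?C = "\<integral>y. g y * g y \<partial>\<mu>"
  note int = poly_bounded_integrable[OF poly_bounded_mult]
  have quad_form: "0 \<le> ?A * s\<^sup>2 + 2 * ?B * s * t + ?C * t\<^sup>2" for s t
  proof -
    have "0 \<le> (\<integral>y. (s * f y + t * g y)\<^sup>2 \<partial>\<mu>)" by simp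
    also have "\<dots> = (\<integral>y. s\<^sup>2 * (f y * f y) + (2 * s * t * (f y * g y) + t\<^sup>2 * (g y * g y)) \<partial>\<mu>)"
      by (simp add: power2_eq_square algebra_simps)
    also have "\<dots> = s\<^sup>2 * ?A + (2 * s * t * ?B + t\<^sup>2 * ?C)"
      using int[OF f f] int[OF f g] int[OF g g] by simp
    finally show ?thesis by (simp add: algebra_simps)
  qed
  have A: "?A \<ge> 0" and C: "?C \<ge> 0" by simp_all
  have "?B\<^sup>2 \<le> ?A * ?C"
  proof (cases "?A = 0")
    case True
    have "?B = 0"
    proof (rule ccontr)
      assume B: "?B \<noteq> 0"
      have "0 \<le> 2 * ?B * (- (?C + 1) / (2 * ?B)) * 1 + ?C * 1\<^sup>2"
        using quad_form[of "- (?C + 1) / (2 * ?B)" 1] True by simp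
      also have "\<dots> = - 1" using B by simp
      finally show False by simp
    qed
    then show ?thesis using A C by simp
  next
    case False
    have "0 \<le> ?A * ?B\<^sup>2 + 2 * ?B * ?B * (- ?A) + ?C * (- ?A)\<^sup>2"
      using quad_form[of ?B "- ?A"] by simp
    also have "\<dots> = ?A * (?A * ?C - ?B\<^sup>2)" by (simp add: power2_eq_square algebra_simps)
    finally show ?thesis using A False by (simp add: zero_le_mult_iff)
  qed
  then have "sqrt (?B\<^sup>2) \<le> sqrt (?A * ?C)" by (rule real_sqrt_le_mono)
  then show ?thesis by (simp add: l2_def power2_eq_square real_sqrt_mult)
qed

lemma l2_add_le:
  assumes f: "poly_bounded f" and g: "poly_bounded g"
  shows "l2 (\<lambda>y. f y + g y) \<le> l2 f + l2 g"
proof (rule power2_le_imp_le)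
  note int = poly_bounded_integrable[OF poly_bounded_mult]
  have "(l2 (\<lambda>y. f y + g y))\<^sup>2 = (\<integral>y. f y * f y + (2 * (f y * g y) + g y * g y) \<partial>\<mu>)"
    unfolding l2_square by (simp add: power2_eq_square algebra_simps)
  also have "\<dots> = (\<integral>y. f y * f y \<partial>\<mu>) + (2 * (\<integral>y. f y * g y \<partial>\<mu>) + (\<integral>y. g y * g y \<partial>\<mu>))"
    using int[OF f f] int[OF f g] int[OF g g] by simp
  also have "\<dots> \<le> (l2 f)\<^sup>2 + (2 * (l2 f * l2 g) + (l2 g)\<^sup>2)"
    using l2_cauchy_schwarz[OF f g] unfolding l2_square by (simp add: power2_eq_square)
  finally show "(l2 (\<lambda>y. f y + g y))\<^sup>2 \<le> (l2 f + l2 g)\<^sup>2"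
    by (simp add: power2_sum)
qed simp

lemma l2_cmult: "l2 (\<lambda>y. c * f y) = \<bar>c\<bar> * l2 f"
  by (simp add: l2_def power_mult_distrib real_sqrt_mult)

lemma l2_mono:
  assumes "poly_bounded f" "poly_bounded g" "\<And>y. \<bar>f y\<bar> \<le> \<bar>g y\<bar>"
  shows "l2 f \<le> l2 g"
proof -
  have sq: "f y * f y \<le> g y * g y" for y
    using assms(3)[of y] by (simp add: abs_le_square_iff power2_eq_square)
  show ?thesis
    unfolding l2_def power2_eq_square
    by (intro real_sqrt_le_mono integral_mono sq poly_bounded_integrable[OF poly_bounded_mult] assms)
qed

text \<open>
  An upper bound for the \<open>L\<^sup>2\<close> distance from \<open>f\<close> to the polynomials. Stating the bound instead of an
  infimum makes it monotone and subadditive at once, in the form required by Bang's argument.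
\<close>

definition near :: "(real^'m \<Rightarrow> real) \<Rightarrow> real \<Rightarrow> bool" where
  "near f r \<longleftrightarrow> (\<forall>\<epsilon>>0. \<exists>p. real_polynomial_function p \<and> l2 (\<lambda>y. f y - p y) < r + \<epsilon>)"

lemma near_mono: "near f r \<Longrightarrow> r \<le> s \<Longrightarrow> near f s"
  unfolding near_def by (meson add_right_mono less_le_trans)

lemma near_l2: "near f (l2 f)"
  unfolding near_def using real_polynomial_function.intros(2)[of 0] by auto

lemma near_polynomial: "real_polynomial_function p \<Longrightarrow> near p 0"
  unfolding near_def by (intro allI impI exI[of _ p]) (auto simp: l2_def)

lemma near_add:
  assumes f: "poly_bounded f" "near f r" and g: "poly_bounded g" "near g s"
  shows "near (\<lambda>y. f y + g y) (r + s)"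
  unfolding near_def
proof (intro allI impI)
  fix \<epsilon> :: real assume "\<epsilon> > 0"
  then obtain p q where p: "real_polynomial_function p" "l2 (\<lambda>y. f y - p y) < r + \<epsilon> / 2"
    and q: "real_polynomial_function q" "l2 (\<lambda>y. g y - q y) < s + \<epsilon> / 2"
    using f(2) g(2) unfolding near_def by (meson half_gt_zero)
  have "l2 (\<lambda>y. (f y - p y) + (g y - q y)) \<le> l2 (\<lambda>y. f y - p y) + l2 (\<lambda>y. g y - q y)"
    by (intro l2_add_le poly_bounded_diff poly_bounded_polynomial[OF p(1)]
        poly_bounded_polynomial[OF q(1)] f(1) g(1))
  moreover have "(\<lambda>y. (f y - p y) + (g y - q y)) = (\<lambda>y. f y + g y - (p y + q y))"
    by (simp add: fun_eq_iff)
  ultimately show "\<exists>p. real_polynomial_function p \<and> l2 (\<lambda>y. f y + g y - p y) < r + s + \<epsilon>"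
    using p q by (intro exI[of _ "\<lambda>y. p y + q y"] conjI polynomial_closure) auto
qed

lemma near_cmult:
  assumes "near f r" "c \<ge> 0"
  shows "near (\<lambda>y. c * f y) (c * r)"
proof (cases "c = 0")
  case True
  then show ?thesis using near_polynomial[OF real_polynomial_function.intros(2)[of 0]] by simp
next
  case False
  show ?thesis unfolding near_def
  proof (intro allI impI)
    fix \<epsilon> :: real assume "\<epsilon> > 0"
    with False assms(2) have "\<epsilon> / c > 0" by simp
    then obtain p where p: "real_polynomial_function p" "l2 (\<lambda>y. f y - p y) < r + \<epsilon> / c"
      using assms(1) unfolding near_def by blast
    have "l2 (\<lambda>y. c * f y - c * p y) = c * l2 (\<lambda>y. f y - p y)"
      using l2_cmult[of c "\<lambda>y. f y - p y"] assms(2) by (simp add: right_diff_distrib)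
    also have "\<dots> < c * (r + \<epsilon> / c)" using p(2) False assms(2) by simp
    also have "\<dots> = c * r + \<epsilon>" using False by (simp add: field_simps)
    finally show "\<exists>p. real_polynomial_function p \<and> l2 (\<lambda>y. c * f y - p y) < c * r + \<epsilon>"
      using p(1) by (intro exI[of _ "\<lambda>y. c * p y"] conjI polynomial_closure)
  qed
qed

lemma near_sum:
  assumes "finite I" "\<And>i. i \<in> I \<Longrightarrow> poly_bounded (f i)" "\<And>i. i \<in> I \<Longrightarrow> near (f i) (r i)"
  shows "near (\<lambda>y. \<Sum>i\<in>I. f i y) (\<Sum>i\<in>I. r i)"
  using assms
proof (induction I rule: finite_induct)
  case (insert i I)
  then show ?case by (simp add: near_add poly_bounded_sum)
qed (auto intro: near_polynomial real_polynomial_function.intros(2))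

lemma near_zero_limit:
  assumes "poly_bounded f" and "\<And>n. poly_bounded (g n)" "\<And>n. near (g n) 0"
    and lim: "(\<lambda>n. l2 (\<lambda>y. f y - g n y)) \<longlonglongrightarrow> 0"
  shows "near f 0"
  unfolding near_def
proof (intro allI impI)
  fix \<epsilon> :: real assume \<epsilon>: "\<epsilon> > 0"
  then obtain n where n: "l2 (\<lambda>y. f y - g n y) < \<epsilon> / 2"
    using order_tendstoD(2)[OF lim, of "\<epsilon> / 2"] by (auto simp: eventually_sequentially)
  obtain p where p: "real_polynomial_function p" "l2 (\<lambda>y. g n y - p y) < 0 + \<epsilon> / 2"
    using assms(3)[of n] \<epsilon> unfolding near_def by (meson half_gt_zero)
  have "l2 (\<lambda>y. (f y - g n y) + (g n y - p y)) \<le> l2 (\<lambda>y. f y - g n y) + l2 (\<lambda>y. g n y - p y)"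
    by (intro l2_add_le poly_bounded_diff poly_bounded_polynomial[OF p(1)] assms(1,2))
  then show "\<exists>p. real_polynomial_function p \<and> l2 (\<lambda>y. f y - p y) < 0 + \<epsilon>"
    using p n by (intro exI[of _ p]) auto
qed

text \<open>
  Multiplication by arbitrary polynomials is built in, because it lets the class grow by one cosine
  factor at a time: the derivatives of the new factor bring in powers of a coordinate, and the
  factors already present need no separate treatment.
\<close>

definition approximable :: "(real^'m \<Rightarrow> real) \<Rightarrow> bool" where
  "approximable u \<longleftrightarrow> u \<in> borel_measurable borel \<and> (\<forall>y. \<bar>u y\<bar> \<le> 1) \<and>
     (\<forall>p. real_polynomial_function p \<longrightarrow> near (\<lambda>y. p y * u y) 0)"

lemma approximable_one: "approximable (\<lambda>y. 1)"
  by (simp add: approximable_def near_polynomial)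

lemma approximable_poly_bounded:
  assumes "approximable u" shows "poly_bounded u"
  using assms by (intro poly_bounded_bounded[where c = 1]) (auto simp: approximable_def)

text \<open>
  The Denjoy-Carleman condition for the norms of \<open>y\<^sub>j\<^sup>n p\<close>, with one sequence for all polynomials \<open>p\<close>.
\<close>

definition quasi_analytic_growth :: "'m \<Rightarrow> bool" where
  "quasi_analytic_growth j \<longleftrightarrow> (\<exists>M::nat \<Rightarrow> real. (\<forall>n. M n > 0) \<and>
     incseq (\<lambda>n. M (Suc n) / M n) \<and> \<not> summable (\<lambda>n. M n / M (Suc n)) \<and>
     (\<forall>p. real_polynomial_function p \<longrightarrow>
       (\<exists>C>0. \<forall>n. l2 (\<lambda>y. (y $ j) ^ n * p y) \<le> C * M n)))"

text \<open>
  Up to phase, the derivatives of \<open>t \<mapsto> cos (t y\<^sub>j + \<theta>) p u\<close> are \<open>y\<^sub>j\<^sup>n cos (t y\<^sub>j + \<theta>) p u\<close>. At \<open>t = 0\<close> they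
  are limits of polynomials, as \<open>u\<close> is approximable, and their norms are at most \<open>C M n\<close>. Bang's
  argument applies to their distances from the polynomials, taken for all phases simultaneously,
  since differentiation shifts the phase.
\<close>

lemma approximable_cos_mult_nonneg:
  assumes growth: "quasi_analytic_growth j" and u: "approximable u" and t: "t \<ge> 0"
  shows "approximable (\<lambda>y. cos (t * y $ j + \<theta>) * u y)"
proof -
  obtain M :: "nat \<Rightarrow> real" where M_pos: "\<And>n. M n > 0"
    and ratio: "incseq (\<lambda>n. M (Suc n) / M n)"
    and div: "\<not> summable (\<lambda>n. M n / M (Suc n))"
    and M_bound: "\<And>p. real_polynomial_function p \<Longrightarrow>
      \<exists>C>0. \<forall>n. l2 (\<lambda>y. (y $ j) ^ n * p y) \<le> C * M n"
    using growth unfolding quasi_analytic_growth_def by blast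
  have u_meas: "u \<in> borel_measurable borel" and u_le: "\<And>y. \<bar>u y\<bar> \<le> 1"
    and u_near: "\<And>p. real_polynomial_function p \<Longrightarrow> near (\<lambda>y. p y * u y) 0"
    using u by (auto simp: approximable_def)
  have coord: "real_polynomial_function (\<lambda>y::real^'m. (y $ j) ^ n)" for n
    by (intro real_polynomial_function_power real_polynomial_function.intros(1) bounded_linear_vec_nth)
  have cos_bdd: "poly_bounded (\<lambda>y. cos (t * y $ j + \<theta>))" for t \<theta>
    by (intro poly_bounded_bounded[where c = 1]) auto
  have near_cos: "near (\<lambda>y. p y * (cos (t * y $ j + \<theta>) * u y)) 0"
    if p: "real_polynomial_function p" for p
  proof -
    obtain C where C: "C > 0" "\<And>n. l2 (\<lambda>y. (y $ j) ^ n * p y) \<le> C * M n"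
      using M_bound[OF p] by blast
    define f where "f n t \<theta> y = (y $ j) ^ n * (cos (t * y $ j + \<theta>) * (p y * u y))"
      for n :: nat and t \<theta> and y :: "real^'m"
    have f_bdd: "poly_bounded (f n t \<theta>)" for n t \<theta>
      unfolding f_def
      by (intro poly_bounded_mult poly_bounded_polynomial[OF coord] poly_bounded_polynomial[OF p]
          cos_bdd approximable_poly_bounded[OF u])
    define P where "P n t r \<longleftrightarrow> (\<forall>\<theta>. near (f n t \<theta>) r)" for n t r
    have P_start: "P n 0 0" for n
      unfolding P_def
    proof
      fix \<theta>
      have "near (\<lambda>y. ((y $ j) ^ n * (cos \<theta> * p y)) * u y) 0"
        by (intro u_near polynomial_closure coord p)
      moreover have "(\<lambda>y. ((y $ j) ^ n * (cos \<theta> * p y)) * u y) = f n 0 \<theta>"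
        by (simp add: f_def fun_eq_iff)
      ultimately show "near (f n 0 \<theta>) 0" by simp
    qed
    \<comment> \<open>Both the a priori bound (\<open>J = 0\<close>) and the Taylor remainder are instances of this estimate.\<close>
    have f_le: "l2 (\<lambda>y. c y * ((y $ j) ^ n * (p y * u y))) \<le> b * (C * M (n + J))"
      if c: "c \<in> borel_measurable borel" "\<And>y. \<bar>c y\<bar> \<le> b * \<bar>y $ j\<bar> ^ J" and b: "b \<ge> 0"
      for c b J n
    proof -
      have "poly_bounded c"
        unfolding poly_bounded_def
      proof (intro conjI exI allI)
        show "\<bar>c y\<bar> \<le> b * (1 + (y $ j) ^ (2 * J))" for y
        proof -
          have "2 * (\<bar>y $ j\<bar> ^ J) \<le> (\<bar>y $ j\<bar> ^ J)\<^sup>2 + 1"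
            using sum_squares_bound[of "\<bar>y $ j\<bar> ^ J" 1] by simp
          moreover have "(\<bar>y $ j\<bar> ^ J)\<^sup>2 = (y $ j) ^ (2 * J)"
            by (simp add: power_mult[symmetric] mult.commute power_even_abs)
          moreover have "0 \<le> \<bar>y $ j\<bar> ^ J" by simp
          ultimately have "\<bar>y $ j\<bar> ^ J \<le> 1 + (y $ j) ^ (2 * J)" by linarith
          then show ?thesis using c(2)[of y] b by (meson mult_left_mono order_trans)
        qed
      qed (intro c polynomial_closure coord)+
      then have bdd: "poly_bounded (\<lambda>y. c y * ((y $ j) ^ n * (p y * u y)))"
        by (intro poly_bounded_mult poly_bounded_polynomial[OF coord] poly_bounded_polynomial[OF p]
          approximable_poly_bounded[OF u])
      have "l2 (\<lambda>y. c y * ((y $ j) ^ n * (p y * u y))) \<le> l2 (\<lambda>y. b * ((y $ j) ^ (n + J) * p y))"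
      proof (intro l2_mono bdd poly_bounded_polynomial polynomial_closure coord p)
        fix y :: "real^'m"
        have "\<bar>c y * ((y $ j) ^ n * (p y * u y))\<bar> = \<bar>c y\<bar> * (\<bar>y $ j\<bar> ^ n * (\<bar>p y\<bar> * \<bar>u y\<bar>))"
          by (simp add: abs_mult power_abs)
        also have "\<dots> \<le> (b * \<bar>y $ j\<bar> ^ J) * (\<bar>y $ j\<bar> ^ n * (\<bar>p y\<bar> * 1))"
          using c(2)[of y] u_le[of y] b by (intro mult_mono mult_left_mono) auto
        also have "\<dots> = \<bar>b * ((y $ j) ^ (n + J) * p y)\<bar>"
          using b by (simp add: abs_mult power_abs power_add)
        finally show "\<bar>c y * ((y $ j) ^ n * (p y * u y))\<bar> \<le> \<bar>b * ((y $ j) ^ (n + J) * p y)\<bar>" .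
      qed
      also have "\<dots> \<le> b * (C * M (n + J))"
        using C(2)[of "n + J"] b by (simp add: l2_cmult mult_left_mono)
      finally show ?thesis .
    qed
    have P_bound: "P n t (C * M n)" for n t
      unfolding P_def
    proof
      fix \<theta>
      have "l2 (f n t \<theta>) = l2 (\<lambda>y. cos (t * y $ j + \<theta>) * ((y $ j) ^ n * (p y * u y)))"
        by (rule arg_cong[where f = l2]) (simp add: f_def fun_eq_iff)
      also have "\<dots> \<le> 1 * (C * M (n + 0))" by (rule f_le) auto
      finally show "near (f n t \<theta>) (C * M n)" using near_mono[OF near_l2] by simp
    qed
    have P_taylor: "P n (t + h) ((\<Sum>k<J. h ^ k / fact k * r k) + h ^ J / fact J * (C * M (n + J)))"
      if h: "0 \<le> h" and r: "\<And>k. k < J \<Longrightarrow> P (n + k) t (r k)" for n t h J r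
      unfolding P_def
    proof
      fix \<theta>
      define T where "T y = (\<Sum>k<J. (h * y $ j) ^ k / fact k
        * cos ((t * y $ j + \<theta>) + real k * (pi / 2)))" for y :: "real^'m"
      define R where "R y = cos ((t * y $ j + \<theta>) + h * y $ j) - T y" for y :: "real^'m"
      have R: "\<bar>R y\<bar> \<le> h ^ J / fact J * \<bar>y $ j\<bar> ^ J" for y
        unfolding R_def T_def
        using cos_shift_taylor[of "t * y $ j + \<theta>" "h * y $ j" J] h
        by (simp add: abs_mult power_mult_distrib)
      have R_meas: "R \<in> borel_measurable borel" unfolding R_def T_def by measurable
      let ?main = "\<lambda>k y. h ^ k / fact k * f (n + k) t (\<theta> + real k * (pi / 2)) y"
      have split: "f n (t + h) \<theta> y = (\<Sum>k<J. ?main k y) + R y * ((y $ j) ^ n * (p y * u y))" for y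
      proof -
        have "cos ((t + h) * y $ j + \<theta>) = T y + R y"
          by (simp add: R_def algebra_simps)
        then have "f n (t + h) \<theta> y = T y * ((y $ j) ^ n * (p y * u y)) + R y * ((y $ j) ^ n * (p y * u y))"
          by (simp add: f_def algebra_simps)
        also have "T y * ((y $ j) ^ n * (p y * u y)) = (\<Sum>k<J. ?main k y)"
          unfolding T_def sum_distrib_right
          by (intro sum.cong) (auto simp: f_def power_mult_distrib power_add ac_simps)
        finally show ?thesis .
      qed
      have main: "near (\<lambda>y. \<Sum>k<J. ?main k y) (\<Sum>k<J. h ^ k / fact k * r k)"
        using r h unfolding P_def
        by (intro near_sum near_cmult poly_bounded_cmult f_bdd) auto
      have "l2 (\<lambda>y. R y * ((y $ j) ^ n * (p y * u y))) \<le> h ^ J / fact J * (C * M (n + J))"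
        using h by (intro f_le R_meas R) auto
      then have rest: "near (\<lambda>y. R y * ((y $ j) ^ n * (p y * u y))) (h ^ J / fact J * (C * M (n + J)))"
        by (rule near_mono[OF near_l2])
      have main_bdd: "poly_bounded (\<lambda>y. \<Sum>k<J. ?main k y)"
        by (intro poly_bounded_sum poly_bounded_cmult f_bdd)
      have "(\<lambda>y. R y * ((y $ j) ^ n * (p y * u y))) = (\<lambda>y. f n (t + h) \<theta> y - (\<Sum>k<J. ?main k y))"
        by (simp add: split)
      then have rest_bdd: "poly_bounded (\<lambda>y. R y * ((y $ j) ^ n * (p y * u y)))"
        using poly_bounded_diff[OF f_bdd main_bdd] by simp
      show "near (f n (t + h) \<theta>) ((\<Sum>k<J. h ^ k / fact k * r k) + h ^ J / fact J * (C * M (n + J)))"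
        using near_add[OF main_bdd main rest_bdd rest] unfolding split[symmetric] .
    qed
    have "P 0 t \<epsilon>" if "\<epsilon> > 0" for \<epsilon>
    proof (rule quasi_analytic_propagation[where P = P and M = "\<lambda>n. C * M n"])
      show "C * M n > 0" for n using C(1) M_pos by simp
      show "incseq (\<lambda>n. C * M (Suc n) / (C * M n))" using ratio C(1) by simp
      show "\<not> summable (\<lambda>n. C * M n / (C * M (Suc n)))" using div C(1) by simp
      show "P n t s" if "P n t r" "r \<le> s" for n t r s
        using that near_mono unfolding P_def by blast
    qed (use P_start P_bound P_taylor t that in auto)
    then have small: "near (f 0 t \<theta>) \<epsilon>" if "\<epsilon> > 0" for \<epsilon> using that by (simp add: P_def)
    have "near (f 0 t \<theta>) 0"
      unfolding near_def
    proof (intro allI impI)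
      fix \<epsilon> :: real assume "\<epsilon> > 0"
      then show "\<exists>p. real_polynomial_function p \<and> l2 (\<lambda>y. f 0 t \<theta> y - p y) < 0 + \<epsilon>"
        using small[of "\<epsilon> / 2"] unfolding near_def by (auto dest!: spec[of _ "\<epsilon> / 2"])
    qed
    moreover have "f 0 t \<theta> = (\<lambda>y. p y * (cos (t * y $ j + \<theta>) * u y))"
      by (simp add: f_def fun_eq_iff)
    ultimately show ?thesis by simp
  qed
  have "\<bar>cos (t * y $ j + \<theta>) * u y\<bar> \<le> 1" for y
    using mult_mono[OF abs_cos_le_one u_le] by (simp add: abs_mult)
  then show ?thesis
    unfolding approximable_def using near_cos u_meas by auto
qed


lemma approximable_cos_mult:
  assumes growth: "quasi_analytic_growth j" and u: "approximable u"
  shows "approximable (\<lambda>y. cos (t * y $ j + \<theta>) * u y)"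
proof (cases "t \<ge> 0")
  case True
  then show ?thesis by (intro approximable_cos_mult_nonneg[OF assms]) auto
next
  case False
  then have "approximable (\<lambda>y. cos (- t * y $ j + - \<theta>) * u y)"
    by (intro approximable_cos_mult_nonneg[OF assms]) auto
  moreover have "cos (- t * y $ j + - \<theta>) = cos (t * y $ j + \<theta>)" for y :: "real^'m"
    using cos_minus[of "t * y $ j + \<theta>"] by simp
  ultimately show ?thesis by simp
qed

lemma approximable_pointwise_limit:
  assumes g: "\<And>n. approximable (g n)"
    and lim: "\<And>y. (\<lambda>n. g n y) \<longlonglongrightarrow> f y"
  shows "approximable f"
proof -
  have f_meas: "f \<in> borel_measurable borel"
    using lim g by (intro borel_measurable_LIMSEQ_real[of _ g f]) (auto simp: approximable_def)
  have f_le: "\<bar>f y\<bar> \<le> 1" for y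
    using g by (intro LIMSEQ_le_const2[OF tendsto_rabs[OF lim]]) (auto simp: approximable_def)
  have "near (\<lambda>y. p y * f y) 0" if p: "real_polynomial_function p" for p
  proof (rule near_zero_limit[where g = "\<lambda>n y. p y * g n y"])
    note p_bdd = poly_bounded_polynomial[OF p]
    have f_bdd: "poly_bounded f" using f_meas f_le by (rule poly_bounded_bounded)
    show "poly_bounded (\<lambda>y. p y * f y)" by (intro poly_bounded_mult p_bdd f_bdd)
    show "poly_bounded (\<lambda>y. p y * g n y)" for n
      by (intro poly_bounded_mult p_bdd approximable_poly_bounded g)
    show "near (\<lambda>y. p y * g n y) 0" for n
      using g[of n] p by (simp add: approximable_def)
    have "(\<lambda>n. \<integral>y. (p y * f y - p y * g n y)\<^sup>2 \<partial>\<mu>) \<longlonglongrightarrow> (\<integral>y. 0 \<partial>\<mu>)"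
    proof (rule integral_dominated_convergence[where w = "\<lambda>y. 4 * (p y * p y)"])
      show "integrable \<mu> (\<lambda>y. 4 * (p y * p y))"
        by (intro poly_bounded_integrable poly_bounded_cmult poly_bounded_mult p_bdd)
      have "(\<lambda>n. (p y * f y - p y * g n y)\<^sup>2) \<longlonglongrightarrow> (p y * f y - p y * f y)\<^sup>2" for y
        by (intro tendsto_intros lim)
      then show "AE y in \<mu>. (\<lambda>n. (p y * f y - p y * g n y)\<^sup>2) \<longlonglongrightarrow> 0" by simp
      show "AE y in \<mu>. norm ((p y * f y - p y * g n y)\<^sup>2) \<le> 4 * (p y * p y)" for n
      proof (rule AE_I2)
        fix y
        have "\<bar>f y - g n y\<bar> \<le> 2"
          using f_le[of y] g[of n] abs_triangle_ineq4[of "f y" "g n y"]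
          by (auto simp: approximable_def dest!: spec[of _ y])
        then have "(f y - g n y)\<^sup>2 \<le> 2\<^sup>2"
          by (subst abs_le_square_iff[symmetric]) simp
        then have "(p y)\<^sup>2 * (f y - g n y)\<^sup>2 \<le> (p y)\<^sup>2 * 2\<^sup>2"
          by (rule mult_left_mono) simp
        then show "norm ((p y * f y - p y * g n y)\<^sup>2) \<le> 4 * (p y * p y)"
          by (simp add: right_diff_distrib[symmetric] power_mult_distrib power2_eq_square[of "p y"])
      qed
      have g_meas: "g n \<in> borel_measurable borel" for n
        using g[of n] by (simp add: approximable_def)
      show "(\<lambda>y. (p y * f y - p y * g n y)\<^sup>2) \<in> borel_measurable \<mu>" for n
        using f_meas g_meas[of n] poly_bounded_measurable[OF p_bdd] by simp
    qed simp
    then show "(\<lambda>n. l2 (\<lambda>y. p y * f y - p y * g n y)) \<longlonglongrightarrow> 0"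
      unfolding l2_def using tendsto_real_sqrt by fastforce
  qed
  then show ?thesis using f_meas f_le by (simp add: approximable_def)
qed

lemma approximable_gaussian:
  assumes growth: "\<And>j. quasi_analytic_growth j"
    and "s > 0"
  shows "approximable (\<lambda>y. exp (- (s * (norm (y - a))\<^sup>2)))"
proof -
  define \<kappa> where "\<kappa> = sqrt (2 * s)"
  have \<kappa>: "\<kappa>\<^sup>2 = 2 * s" using \<open>s > 0\<close> by (simp add: \<kappa>_def)
  have step: "approximable (\<lambda>y. exp (- (s * (y $ j - a $ j)\<^sup>2)) * u y)" if u: "approximable u" for u j
  proof -
    have powers: "approximable (\<lambda>y. cos (t * y $ j + \<theta>) ^ k * u y)" for t \<theta> k
    proof (induction k)
      case (Suc k)
      then show ?case using approximable_cos_mult[OF growth Suc] by (simp add: mult.assoc)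
    qed (simp add: u)
    show ?thesis
    proof (rule approximable_pointwise_limit)
      let ?t = "\<lambda>n. \<kappa> / sqrt (real (Suc n))"
      show "approximable (\<lambda>y. cos (?t n * y $ j + - (?t n * a $ j)) ^ Suc n * u y)" for n
        by (rule powers)
      fix y :: "real^'m"
      have "(\<lambda>n. cos (\<kappa> * (y $ j - a $ j) / sqrt (real (Suc n))) ^ Suc n * u y)
          \<longlonglongrightarrow> exp (- ((\<kappa> * (y $ j - a $ j))\<^sup>2 / 2)) * u y"
        by (intro tendsto_intros cos_power_tendsto_gaussian)
      moreover have "\<kappa> * (y $ j - a $ j) / sqrt (real (Suc n)) = ?t n * y $ j + - (?t n * a $ j)" for n
        by (simp add: right_diff_distrib diff_divide_distrib)
      ultimately show "(\<lambda>n. cos (?t n * y $ j + - (?t n * a $ j)) ^ Suc n * u y)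
          \<longlonglongrightarrow> exp (- (s * (y $ j - a $ j)\<^sup>2)) * u y"
        by (simp only: power_mult_distrib \<kappa>) simp
    qed
  qed
  have "approximable (\<lambda>y. \<Prod>j\<in>J. exp (- (s * (y $ j - a $ j)\<^sup>2)))" if "finite J" for J
    using that
  proof (induction J rule: finite_induct)
    case (insert j J)
    then show ?case using step[OF insert.IH, of j] by simp
  qed (simp add: approximable_one)
  then have "approximable (\<lambda>y. \<Prod>j\<in>UNIV. exp (- (s * (y $ j - a $ j)\<^sup>2)))" by simp
  moreover have "(\<Prod>j\<in>UNIV. exp (- (s * (y $ j - a $ j)\<^sup>2))) = exp (- (s * (norm (y - a))\<^sup>2))" for y
  proof -
    have "(norm (y - a))\<^sup>2 = (\<Sum>j\<in>UNIV. (y $ j - a $ j)\<^sup>2)"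
      unfolding power2_norm_eq_inner inner_vec_def by (simp add: power2_eq_square)
    then show ?thesis
      by (simp add: exp_sum[symmetric] sum_distrib_left sum_negf)
  qed
  ultimately show ?thesis by simp
qed

end

section \<open>Testing the sign of a polynomial on the support\<close>

text \<open>
  The complement is a union of open null sets, of which countably many suffice by Lindeloef's theorem.
\<close>

lemma null_set_complement_support:
  fixes \<nu> :: "(real^'m::finite) measure"
  assumes sets: "sets \<nu> = sets borel"
  shows "- support \<nu> \<in> null_sets \<nu>"
proof -
  define F where "F = {U :: (real^'m) set. open U \<and> emeasure \<nu> U = 0}"
  have "- support \<nu> = \<Union>F"
    by (auto simp: support_def F_def not_gr_zero)
  moreover obtain F' where "F' \<subseteq> F" "countable F'" "\<Union>F' = \<Union>F"
    using Lindelof[of F] by (auto simp: F_def)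
  moreover have "U \<in> null_sets \<nu>" if "U \<in> F" for U
    using that sets by (auto simp: F_def null_sets_def)
  then have "(\<Union>U\<in>F'. U) \<in> null_sets \<nu>"
    using \<open>F' \<subseteq> F\<close> \<open>countable F'\<close> by (intro null_sets_UN') auto
  ultimately show ?thesis by simp
qed

text \<open>
  A narrow Gaussian \<open>g\<close> at \<open>y0\<close> satisfies \<open>\<integral> g\<^sup>2 h < 0\<close>, since its mass near \<open>y0\<close> decays more slowly with
  the parameter \<open>s\<close> than its values away from \<open>y0\<close>. It is replaced by a polynomial that approximates
  it in \<open>L\<^sup>2\<close> for the weight \<open>w = 1 + h\<^sup>2\<close>; as \<open>\<bar>h\<bar> \<le> w\<close>, the integral changes by little.
\<close>

lemma exists_square_weight_negative:
  fixes Y :: "(real^'m::finite) set" and \<nu> :: "(real^'m) measure"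
  assumes sets: "sets \<nu> = sets borel"
    and Y: "support \<nu> = Y" "closed Y"
    and int: "\<And>p. real_polynomial_function p \<Longrightarrow> set_integrable \<nu> Y p"
    and carleman: "\<And>j. carleman Y \<nu> j"
    and h: "real_polynomial_function h" and y0: "y0 \<in> Y" "h y0 < 0"
  obtains p where "real_polynomial_function p" "(LINT y:Y|\<nu>. (p y)\<^sup>2 * h y) < 0"
proof -
  have Y_meas [measurable]: "Y \<in> sets \<nu>" using Y(2) sets by simp
  have meas_eq: "borel_measurable \<nu> = borel_measurable borel"
    by (rule measurable_cong_sets) (auto simp: sets)
  note poly_meas = borel_measurable_polynomial
  have ind_meas: "(indicator Y :: real^'m \<Rightarrow> real) \<in> borel_measurable borel"
    using Y(2) by auto

  \<comment> \<open>Dominates \<open>\<bar>h\<bar>\<close>; being a polynomial, it preserves the growth condition on the moments.\<close>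
  define w where "w y = 1 + h y * h y" for y
  have w_poly: "real_polynomial_function w"
    unfolding w_def by (intro polynomial_closure h)
  have w_pos: "w y \<ge> 1" for y by (simp add: w_def)
  have h_le_w: "\<bar>h y\<bar> \<le> w y" for y
    using sum_squares_bound[of "\<bar>h y\<bar>" 1] zero_le_square[of "h y"] abs_mult_self_eq[of "h y"]
    by (simp add: w_def power2_eq_square)

  define \<mu>\<^sub>0 where "\<mu>\<^sub>0 = density \<nu> (\<lambda>y. ennreal (indicator Y y))"
  define \<mu> where "\<mu> = density \<nu> (\<lambda>y. ennreal (indicator Y y * w y))"
  have integral_\<mu>\<^sub>0: "integral\<^sup>L \<mu>\<^sub>0 f = (LINT y:Y|\<nu>. f y)"
    and integrable_\<mu>\<^sub>0: "integrable \<mu>\<^sub>0 f \<longleftrightarrow> set_integrable \<nu> Y f"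
    if "f \<in> borel_measurable borel" for f :: "real^'m \<Rightarrow> real"
    unfolding \<mu>\<^sub>0_def set_lebesgue_integral_def set_integrable_def
    using that ind_meas by (subst integral_density integrable_density; simp add: meas_eq)+
  have integral_\<mu>: "integral\<^sup>L \<mu> f = (LINT y:Y|\<nu>. w y * f y)"
    and integrable_\<mu>: "integrable \<mu> f \<longleftrightarrow> set_integrable \<nu> Y (\<lambda>y. w y * f y)"
    if "f \<in> borel_measurable borel" for f :: "real^'m \<Rightarrow> real"
    unfolding \<mu>_def set_lebesgue_integral_def set_integrable_def
    using that ind_meas poly_meas[OF w_poly] w_pos order_trans[OF zero_le_one w_pos]
    by (subst integral_density integrable_density; simp add: meas_eq mult.assoc)+
  interpret N: moment_measure \<mu>\<^sub>0
    by unfold_locales (auto simp: \<mu>\<^sub>0_def sets integrable_\<mu>\<^sub>0[unfolded \<mu>\<^sub>0_def] poly_meas int)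
  interpret M: moment_measure \<mu>
  proof
    fix p :: "real^'m \<Rightarrow> real" assume "real_polynomial_function p"
    then show "integrable \<mu> p"
      by (simp add: integrable_\<mu> poly_meas int polynomial_closure w_poly)
  qed (simp add: \<mu>_def sets)

  have growth: "M.quasi_analytic_growth j" for j
  proof -
    define m where "m n = (LINT y:Y|\<nu>. (y $ j) ^ (2 * n))" for n
    have coord: "real_polynomial_function (\<lambda>y::real^'m. (y $ j) ^ n)" for n
      by (intro real_polynomial_function_power real_polynomial_function.intros(1) bounded_linear_vec_nth)
    have coord_meas: "(\<lambda>y::real^'m. (y $ j) ^ n) \<in> borel_measurable borel" for n
      by (intro poly_meas coord)
    have m_l2: "m n = (N.l2 (\<lambda>y. (y $ j) ^ n))\<^sup>2" for n
      unfolding m_def N.l2_square by (simp add: integral_\<mu>\<^sub>0 coord_meas power_mult[symmetric] mult.commute)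
    have m_nonneg: "m n \<ge> 0" for n by (simp add: m_l2)
    have m_logconvex: "(m (Suc n))\<^sup>2 \<le> m n * m (Suc (Suc n))" for n
    proof -
      have "(y $ j) ^ n * (y $ j) ^ Suc (Suc n) = (y $ j) ^ (2 * Suc n)" for y :: "real^'m"
        unfolding power_add[symmetric] by (rule arg_cong[where f = "(^) (y $ j)"]) simp
      then have "m (Suc n) = (\<integral>y. (y $ j) ^ n * (y $ j) ^ Suc (Suc n) \<partial>\<mu>\<^sub>0)"
        unfolding m_def
        by (simp only: integral_\<mu>\<^sub>0[OF coord_meas])
      then have "\<bar>m (Suc n)\<bar> \<le> N.l2 (\<lambda>y. (y $ j) ^ n) * N.l2 (\<lambda>y. (y $ j) ^ Suc (Suc n))"
        by (simp only:) (intro N.l2_cauchy_schwarz N.poly_bounded_polynomial coord)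
      then have "\<bar>m (Suc n)\<bar>\<^sup>2 \<le> (N.l2 (\<lambda>y. (y $ j) ^ n) * N.l2 (\<lambda>y. (y $ j) ^ Suc (Suc n)))\<^sup>2"
        by (intro power_mono) auto
      then show ?thesis by (simp only: m_l2[symmetric] power_mult_distrib power2_abs)
    qed
    have m_carleman: "suminf (\<lambda>d. inverse (ennreal (m (Suc d) powr (1 / (2 * real (Suc d)))))) = \<infinity>"
      using carleman[of j] by (simp add: carleman_def m_def)
    note M = fourth_root_moment_growth[OF m_nonneg m_logconvex m_carleman]
    have "\<exists>C>0. \<forall>n. M.l2 (\<lambda>y. (y $ j) ^ n * p y) \<le> C * sqrt (sqrt (1 + m (2 * n)))"
      if p: "real_polynomial_function p" for p
    proof -
      define K where "K = N.l2 (\<lambda>y. w y * (p y)\<^sup>2)"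
      have wp: "real_polynomial_function (\<lambda>y. w y * (p y)\<^sup>2)"
        by (intro polynomial_closure w_poly real_polynomial_function_power p)
      have "M.l2 (\<lambda>y. (y $ j) ^ n * p y) \<le> (sqrt K + 1) * sqrt (sqrt (1 + m (2 * n)))" for n
      proof -
        have "(M.l2 (\<lambda>y. (y $ j) ^ n * p y))\<^sup>2 = (\<integral>y. (y $ j) ^ (2 * n) * (w y * (p y)\<^sup>2) \<partial>\<mu>\<^sub>0)"
        proof -
          have "w y * ((y $ j) ^ n * p y)\<^sup>2 = (y $ j) ^ (2 * n) * (w y * (p y)\<^sup>2)" for y :: "real^'m"
            by (simp add: power_mult_distrib power_mult[symmetric] mult.commute[of 2])
          moreover have "(\<lambda>y. ((y $ j) ^ n * p y)\<^sup>2) \<in> borel_measurable borel"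
            "(\<lambda>y. (y $ j) ^ (2 * n) * (w y * (p y)\<^sup>2)) \<in> borel_measurable borel"
            by (intro poly_meas polynomial_closure real_polynomial_function_power[of "\<lambda>y. _ y * _ y"]
                coord p wp)+
          ultimately show ?thesis
            by (simp only: M.l2_square integral_\<mu> integral_\<mu>\<^sub>0)
        qed
        also have "\<dots> \<le> N.l2 (\<lambda>y. (y $ j) ^ (2 * n)) * K"
          unfolding K_def
          by (rule order_trans[OF abs_ge_self N.l2_cauchy_schwarz])
            (intro N.poly_bounded_polynomial coord wp)+
        also have "N.l2 (\<lambda>y. (y $ j) ^ (2 * n)) = sqrt (m (2 * n))"
          by (simp add: m_l2)
        also have "\<dots> * K \<le> sqrt (1 + m (2 * n)) * K"
          by (intro mult_right_mono) (auto simp: K_def)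
        finally have "sqrt ((M.l2 (\<lambda>y. (y $ j) ^ n * p y))\<^sup>2) \<le> sqrt (sqrt (1 + m (2 * n)) * K)"
          by (rule real_sqrt_le_mono)
        then have "M.l2 (\<lambda>y. (y $ j) ^ n * p y) \<le> sqrt K * sqrt (sqrt (1 + m (2 * n)))"
          by (simp add: real_sqrt_mult mult.commute)
        also have "\<dots> \<le> (sqrt K + 1) * sqrt (sqrt (1 + m (2 * n)))"
          by (intro mult_right_mono) (use m_nonneg in auto)
        finally show ?thesis .
      qed
      moreover have "sqrt K + 1 > 0" by (simp add: K_def add_nonneg_pos)
      ultimately show ?thesis by blast
    qed
    then show ?thesis
      unfolding M.quasi_analytic_growth_def
      using M by (intro exI[of _ "\<lambda>n. sqrt (sqrt (1 + m (2 * n)))"]) blast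
  qed
  note approx = M.approximable_gaussian[OF growth]

  define c where "c = - h y0 / 2"
  have c: "c > 0" using y0 by (simp add: c_def)
  obtain \<delta> where \<delta>: "\<delta> > 0" "\<And>y. dist y y0 < \<delta> \<Longrightarrow> h y < - c"
  proof -
    have "continuous (at y0) h" by (rule continuous_real_polymonial_function[OF h])
    then obtain d where "d > 0" "\<And>y. dist y y0 < d \<Longrightarrow> dist (h y) (h y0) < c"
      unfolding continuous_at_eps_delta using c by blast
    then show ?thesis
      by (intro that[of d]) (fastforce simp: c_def dist_real_def)+
  qed
  define B where "B = ball y0 (\<delta> / 2)"
  have B_meas: "B \<in> sets \<nu>" by (simp add: B_def sets)
  define A where "A = measure \<nu> (Y \<inter> B)"
  have Y_fin: "emeasure \<nu> Y < \<infinity>"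
  proof -
    have "set_integrable \<nu> Y (\<lambda>y. 1 :: real)" by (intro int polynomial_closure)
    then show ?thesis
      using sets_eq_imp_space_eq[OF sets]
      by (simp add: set_integrable_def integrable_indicator_iff)
  qed
  have A: "A > 0"
  proof -
    have "0 < emeasure \<nu> B"
      using y0(1) \<delta>(1) Y(1) by (auto simp: B_def support_def)
    also have "emeasure \<nu> B = emeasure \<nu> (B - - Y)"
      using null_set_complement_support[OF sets] Y(1) B_meas
      by (intro emeasure_Diff_null_set[symmetric]) auto
    also have "B - - Y = Y \<inter> B" by auto
    finally have "0 < emeasure \<nu> (Y \<inter> B)" .
    moreover have "emeasure \<nu> (Y \<inter> B) < \<infinity>"
      using Y_fin by (meson Int_lower1 Y_meas emeasure_mono le_less_trans)
    ultimately show ?thesis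
      by (simp add: A_def measure_def enn2real_positive_iff)
  qed
  define H where "H = (LINT y:Y|\<nu>. w y)"
  have H: "H \<ge> 0" unfolding H_def set_lebesgue_integral_def
    using w_pos order_trans[OF zero_le_one w_pos] by (intro Bochner_Integration.integral_nonneg) simp
  \<comment> \<open>Chosen such that \<open>x = 3 s \<delta>\<^sup>2 / 2\<close>, the difference of the two decay rates below, exceeds \<open>H / (c A)\<close>.\<close>
  define s where "s = (H / (c * A) + 1) * 2 / (3 * \<delta>\<^sup>2)"
  have HcA: "0 \<le> H / (c * A)" using H c A by simp
  have s: "s > 0"
    unfolding s_def using \<delta>(1) HcA by (intro divide_pos_pos mult_pos_pos add_nonneg_pos) auto
  define g where "g y = exp (- (s * (norm (y - y0))\<^sup>2))" for y :: "real^'m"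
  have g_approx: "M.approximable g" unfolding g_def by (rule approx[OF s])
  have g_bdd: "M.poly_bounded g" by (rule M.approximable_poly_bounded[OF g_approx])
  have g_meas: "g \<in> borel_measurable borel" by (rule M.poly_bounded_measurable[OF g_bdd])
  have g_le: "\<bar>g y\<bar> \<le> 1" for y using g_approx by (simp add: M.approximable_def)
  have set_int: "set_integrable \<nu> Y f" if "N.poly_bounded f" for f
    using N.poly_bounded_integrable[OF that] integrable_\<mu>\<^sub>0 N.poly_bounded_measurable[OF that] by simp
  have g_bdd': "N.poly_bounded g" by (rule N.poly_bounded_bounded[OF g_meas g_le])
  define \<beta> where "\<beta> = - (LINT y:Y|\<nu>. (g y)\<^sup>2 * h y)"
  have \<beta>: "\<beta> > 0"
  proof -
    have "(g y)\<^sup>2 * h y \<le> - c * exp (- (s * \<delta>\<^sup>2 / 2)) * indicator B y + exp (- (2 * s * \<delta>\<^sup>2)) * w y" for y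
    proof -
      have g2: "(g y)\<^sup>2 = exp (- (2 * s * (norm (y - y0))\<^sup>2))"
        by (simp add: g_def exp_double[symmetric] mult.assoc)
      have w0: "0 \<le> exp (- (2 * s * \<delta>\<^sup>2)) * w y" using order_trans[OF zero_le_one w_pos] by simp
      consider "y \<in> B" | "y \<notin> B" "dist y y0 < \<delta>" | "y \<notin> B" "dist y y0 \<ge> \<delta>" by linarith
      then show ?thesis
      proof cases
        case 1
        then have d: "norm (y - y0) \<le> \<delta> / 2" by (simp add: B_def dist_norm norm_minus_commute)
        then have hc: "h y \<le> - c" using \<delta> by (intro less_imp_le \<delta>(2)) (simp add: dist_norm)
        have "(norm (y - y0))\<^sup>2 \<le> (\<delta> / 2)\<^sup>2" using d by (intro power_mono) auto
        then have "s * (2 * (norm (y - y0))\<^sup>2) \<le> s * (2 * (\<delta> / 2)\<^sup>2)"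
          using s by (intro mult_left_mono) auto
        then have "exp (- (s * \<delta>\<^sup>2 / 2)) \<le> (g y)\<^sup>2"
          unfolding g2 by (simp add: power2_eq_square algebra_simps)
        then have "(g y)\<^sup>2 * h y \<le> exp (- (s * \<delta>\<^sup>2 / 2)) * - c"
          using hc c mult_mono[of "exp (- (s * \<delta>\<^sup>2 / 2))" "(g y)\<^sup>2" c "- h y"] by simp
        then show ?thesis using 1 w0 by (simp add: mult.commute)
      next
        case 2
        then have "(g y)\<^sup>2 * h y \<le> 0" using \<delta>(2)[of y] c by (intro mult_nonneg_nonpos) auto
        then show ?thesis using 2 w0 by simp
      next
        case 3
        have "\<delta>\<^sup>2 \<le> (norm (y - y0))\<^sup>2" using 3 \<delta>(1) by (intro power_mono) (auto simp: dist_norm)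
        then have "2 * s * \<delta>\<^sup>2 \<le> 2 * s * (norm (y - y0))\<^sup>2" using s by (intro mult_left_mono) auto
        then have "(g y)\<^sup>2 \<le> exp (- (2 * s * \<delta>\<^sup>2))" unfolding g2 by simp
        then have "(g y)\<^sup>2 * \<bar>h y\<bar> \<le> exp (- (2 * s * \<delta>\<^sup>2)) * w y"
          using h_le_w[of y] by (intro mult_mono) auto
        moreover have "(g y)\<^sup>2 * h y \<le> (g y)\<^sup>2 * \<bar>h y\<bar>" by (intro mult_left_mono) auto
        ultimately show ?thesis using 3 by simp
      qed
    qed
    moreover have "set_integrable \<nu> Y (\<lambda>y. (g y)\<^sup>2 * h y)"
      unfolding power2_eq_square
      by (intro set_int N.poly_bounded_mult g_bdd' N.poly_bounded_polynomial h)
    moreover have ind: "set_integrable \<nu> Y (\<lambda>y. indicator B y :: real)"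
      by (intro set_int N.poly_bounded_bounded[where c = 1]) (auto simp: B_def indicator_def)
    moreover have w_int: "set_integrable \<nu> Y w" by (intro int w_poly)
    ultimately have "(LINT y:Y|\<nu>. (g y)\<^sup>2 * h y) \<le> (LINT y:Y|\<nu>.
        - c * exp (- (s * \<delta>\<^sup>2 / 2)) * indicator B y + exp (- (2 * s * \<delta>\<^sup>2)) * w y)"
      by (intro set_integral_mono) auto
    also have "\<dots> = - c * exp (- (s * \<delta>\<^sup>2 / 2)) * (LINT y:Y|\<nu>. indicator B y) + exp (- (2 * s * \<delta>\<^sup>2)) * H"
      unfolding H_def
      by (simp only: set_integral_add set_integral_mult_right set_integrable_mult_right ind w_int)
    also have "(LINT y:Y|\<nu>. indicator B y) = A"
      unfolding A_def set_lebesgue_integral_def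
      using sets_eq_imp_space_eq[OF sets] by (simp add: indicator_inter_arith[symmetric])
    also have "- c * exp (- (s * \<delta>\<^sup>2 / 2)) * A + exp (- (2 * s * \<delta>\<^sup>2)) * H < 0"
    proof -
      define x where "x = s * (3 * \<delta>\<^sup>2) / 2"
      have x: "x = H / (c * A) + 1" using \<delta>(1) by (simp add: x_def s_def)
      have "H / (c * A) < x" by (simp add: x)
      also have "x < exp x" using exp_ge_add_one_self[of x] by linarith
      finally have "H < exp x * (c * A)" using c A by (simp add: field_simps)
      then have "exp (- (2 * s * \<delta>\<^sup>2)) * H < exp (- (2 * s * \<delta>\<^sup>2)) * (exp x * (c * A))" by simp
      also have "\<dots> = exp (- (2 * s * \<delta>\<^sup>2) + x) * (c * A)" by (simp only: exp_add mult.assoc)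
      also have "- (2 * s * \<delta>\<^sup>2) + x = - (s * \<delta>\<^sup>2 / 2)" by (simp add: x_def)
      finally show ?thesis by (simp add: algebra_simps)
    qed
    finally show ?thesis by (simp add: \<beta>_def)
  qed

  define L where "L = M.l2 (\<lambda>y. 1)"
  have L: "L \<ge> 0" by (simp add: L_def)
  define \<epsilon> where "\<epsilon> = min 1 (\<beta> / (2 * (2 * L + 1)))"
  have \<epsilon>: "\<epsilon> > 0" using \<beta> L by (simp add: \<epsilon>_def)
  have "M.near (\<lambda>y. 1 * g y) 0"
    using g_approx polynomial_closure(1)[of 1] unfolding M.approximable_def by blast
  then obtain p where p: "real_polynomial_function p" "M.l2 (\<lambda>y. g y - p y) < \<epsilon>"
    using \<epsilon> unfolding M.near_def by auto
  define d where "d y = \<bar>g y - p y\<bar>" for y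
  have gp_bdd: "M.poly_bounded (\<lambda>y. g y - p y)"
    by (intro M.poly_bounded_diff g_bdd M.poly_bounded_polynomial p)
  have d_bdd: "M.poly_bounded d"
    using gp_bdd unfolding d_def M.poly_bounded_def by auto
  have d_bdd': "N.poly_bounded d"
    using d_bdd unfolding M.poly_bounded_def N.poly_bounded_def .
  have d_l2: "M.l2 d < \<epsilon>" using p(2) by (simp add: M.l2_def d_def)
  have d_meas: "d \<in> borel_measurable borel" by (rule M.poly_bounded_measurable[OF d_bdd])
  have pointwise: "(p y)\<^sup>2 * h y \<le> (g y)\<^sup>2 * h y + w y * (2 * (1 * d y) + d y * d y)" for y
  proof -
    have "(p y)\<^sup>2 - (g y)\<^sup>2 = (g y - p y)\<^sup>2 - 2 * g y * (g y - p y)"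
      by (simp add: power2_eq_square algebra_simps)
    then have "\<bar>(p y)\<^sup>2 - (g y)\<^sup>2\<bar> \<le> (g y - p y)\<^sup>2 + 2 * (\<bar>g y\<bar> * \<bar>g y - p y\<bar>)"
      using abs_triangle_ineq4[of "(g y - p y)\<^sup>2" "2 * g y * (g y - p y)"] by (simp add: abs_mult)
    also have "\<dots> \<le> d y * d y + 2 * (1 * d y)"
      using mult_right_mono[OF g_le[of y], of "d y"] by (simp add: d_def power2_eq_square)
    finally have "\<bar>(p y)\<^sup>2 - (g y)\<^sup>2\<bar> * \<bar>h y\<bar> \<le> (d y * d y + 2 * (1 * d y)) * w y"
      using h_le_w[of y] by (intro mult_mono) (auto simp: d_def)
    then have "((p y)\<^sup>2 - (g y)\<^sup>2) * h y \<le> (d y * d y + 2 * (1 * d y)) * w y"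
      using abs_ge_self[of "((p y)\<^sup>2 - (g y)\<^sup>2) * h y"] by (simp add: abs_mult)
    then show ?thesis by (simp add: algebra_simps)
  qed
  have rest_bdd: "M.poly_bounded (\<lambda>y. 2 * (1 * d y) + d y * d y)"
    by (intro M.poly_bounded_add M.poly_bounded_cmult M.poly_bounded_mult d_bdd
        M.poly_bounded_polynomial polynomial_closure)
  have rest_int: "set_integrable \<nu> Y (\<lambda>y. w y * (2 * (1 * d y) + d y * d y))"
    by (intro set_int N.poly_bounded_add N.poly_bounded_cmult N.poly_bounded_mult d_bdd'
        N.poly_bounded_polynomial polynomial_closure w_poly)
  have gh_int: "set_integrable \<nu> Y (\<lambda>y. (g y)\<^sup>2 * h y)"
    unfolding power2_eq_square
    by (intro set_int N.poly_bounded_mult g_bdd' N.poly_bounded_polynomial h)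
  have ph_int: "set_integrable \<nu> Y (\<lambda>y. (p y)\<^sup>2 * h y)"
    by (intro int polynomial_closure real_polynomial_function_power p h)
  have "(LINT y:Y|\<nu>. (p y)\<^sup>2 * h y)
      \<le> (LINT y:Y|\<nu>. (g y)\<^sup>2 * h y + w y * (2 * (1 * d y) + d y * d y))"
    using ph_int gh_int rest_int pointwise by (intro set_integral_mono) auto
  also have "\<dots> = - \<beta> + (\<integral>y. 2 * (1 * d y) + d y * d y \<partial>\<mu>)"
    using gh_int rest_int integral_\<mu>[OF M.poly_bounded_measurable[OF rest_bdd]] by (simp add: \<beta>_def)
  also have "(\<integral>y. 2 * (1 * d y) + d y * d y \<partial>\<mu>) = 2 * (\<integral>y. 1 * d y \<partial>\<mu>) + (\<integral>y. d y * d y \<partial>\<mu>)"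
    using M.poly_bounded_integrable[OF d_bdd] M.poly_bounded_integrable[OF M.poly_bounded_mult[OF d_bdd d_bdd]]
    by simp
  also have "(\<integral>y. 1 * d y \<partial>\<mu>) \<le> L * M.l2 d"
    unfolding L_def
    by (rule order_trans[OF abs_ge_self M.l2_cauchy_schwarz])
      (intro M.poly_bounded_polynomial polynomial_closure d_bdd)+
  also have "(\<integral>y. d y * d y \<partial>\<mu>) = M.l2 d * M.l2 d"
    using M.l2_square[of d] by (simp add: power2_eq_square)
  also have "- \<beta> + (2 * (L * M.l2 d) + M.l2 d * M.l2 d) < 0"
  proof -
    have "L * M.l2 d \<le> L * \<epsilon>" using d_l2 L by (intro mult_left_mono) auto
    moreover have "M.l2 d * M.l2 d \<le> 1 * \<epsilon>" using d_l2 by (intro mult_mono) (auto simp: \<epsilon>_def)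
    moreover have "(2 * L + 1) * \<epsilon> \<le> (2 * L + 1) * (\<beta> / (2 * (2 * L + 1)))"
      using L by (intro mult_left_mono) (auto simp: \<epsilon>_def)
    moreover have "(2 * L + 1) * (\<beta> / (2 * (2 * L + 1))) = \<beta> / 2" using L by (simp add: field_simps)
    moreover have "(2 * L + 1) * \<epsilon> = 2 * (L * \<epsilon>) + \<epsilon>" by (simp add: algebra_simps)
    ultimately show ?thesis using \<beta> by linarith
  qed
  finally show ?thesis using p(1) that by auto
qed

section \<open>Quadratic modules and Bernstein expansions\<close>

locale quadratic_module =
  fixes Q :: "'a::comm_ring_1 set"
  assumes one_mem: "1 \<in> Q"
    and add_mem: "p \<in> Q \<Longrightarrow> q \<in> Q \<Longrightarrow> p + q \<in> Q"
    and square_mult_mem: "q \<in> Q \<Longrightarrow> p\<^sup>2 * q \<in> Q"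
begin

lemma zero_mem: "0 \<in> Q"
  using square_mult_mem[OF one_mem, of 0] by simp

lemma square_mem: "p\<^sup>2 \<in> Q"
  using square_mult_mem[OF one_mem, of p] by simp

lemma sum_mem: "(\<And>i. i \<in> I \<Longrightarrow> f i \<in> Q) \<Longrightarrow> (\<Sum>i\<in>I. f i) \<in> Q"
  by (induction I rule: infinite_finite_induct) (auto simp: zero_mem add_mem)

text \<open>
  A quadratic module need not be closed under products, but a ball constraint yields all products of
  the interval constraints. With \<open>\<Pi>\<close> the product over \<open>J\<close> and \<open>\<Sigma>\<close> the sum of squares over \<open>J\<close>, adding an
  index \<open>j\<close> increases \<open>\<Pi> - (1 - \<Sigma>)\<close> by \<open>\<xi>\<^sub>j\<^sup>2 (1 - \<Pi>)\<close> and \<open>1 - \<Pi>\<close> by \<open>\<xi>\<^sub>j\<^sup>2 \<Pi>\<close>. So both stay in the module,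
  by a simultaneous induction.
\<close>

lemma prod_one_minus_squares_mem:
  assumes "finite I" and ball: "1 - (\<Sum>i\<in>I. (\<xi> i)\<^sup>2) \<in> Q" and "J \<subseteq> I"
  shows "(\<Prod>i\<in>J. 1 - (\<xi> i)\<^sup>2) \<in> Q"
proof -
  have sub_ball: "1 - (\<Sum>i\<in>J. (\<xi> i)\<^sup>2) \<in> Q" if "J \<subseteq> I" for J
  proof -
    have "(\<Sum>i\<in>I. (\<xi> i)\<^sup>2) = (\<Sum>i\<in>I - J. (\<xi> i)\<^sup>2) + (\<Sum>i\<in>J. (\<xi> i)\<^sup>2)"
      using that \<open>finite I\<close> by (rule sum.subset_diff)
    then have "1 - (\<Sum>i\<in>J. (\<xi> i)\<^sup>2) = (1 - (\<Sum>i\<in>I. (\<xi> i)\<^sup>2)) + (\<Sum>i\<in>I - J. (\<xi> i)\<^sup>2)"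
      by simp
    then show ?thesis by (simp only: add_mem ball sum_mem square_mem)
  qed
  have "(\<Prod>i\<in>J. 1 - (\<xi> i)\<^sup>2) - (1 - (\<Sum>i\<in>J. (\<xi> i)\<^sup>2)) \<in> Q \<and> 1 - (\<Prod>i\<in>J. 1 - (\<xi> i)\<^sup>2) \<in> Q"
    if "finite J" "J \<subseteq> I" for J
    using that
  proof (induction J rule: finite_induct)
    case (insert j J)
    let ?P = "\<Prod>i\<in>J. 1 - (\<xi> i)\<^sup>2" and ?S = "\<Sum>i\<in>J. (\<xi> i)\<^sup>2"
    have 1: "?P - (1 - ?S) \<in> Q" and 2: "1 - ?P \<in> Q" using insert by auto
    have P: "?P \<in> Q" using add_mem[OF 1 sub_ball[of J]] insert.prems by simp
    have "(1 - (\<xi> j)\<^sup>2) * ?P - (1 - ((\<xi> j)\<^sup>2 + ?S)) = (?P - (1 - ?S)) + (\<xi> j)\<^sup>2 * (1 - ?P)"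
      by (simp add: algebra_simps)
    moreover have "1 - (1 - (\<xi> j)\<^sup>2) * ?P = (1 - ?P) + (\<xi> j)\<^sup>2 * ?P"
      by (simp add: algebra_simps)
    ultimately have "(1 - (\<xi> j)\<^sup>2) * ?P - (1 - ((\<xi> j)\<^sup>2 + ?S)) \<in> Q" "1 - (1 - (\<xi> j)\<^sup>2) * ?P \<in> Q"
      by (simp_all only: 1 2 P add_mem square_mult_mem)
    then show ?case using insert.hyps by simp
  qed (simp add: zero_mem)
  from this[of J] have "(\<Prod>i\<in>J. 1 - (\<xi> i)\<^sup>2) - (1 - (\<Sum>i\<in>J. (\<xi> i)\<^sup>2)) \<in> Q"
    using assms finite_subset by blast
  from add_mem[OF this sub_ball[OF \<open>J \<subseteq> I\<close>]] show ?thesis by simp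
qed

text \<open>
  From \<open>u + w = 1\<close> follow \<open>u = u\<^sup>2 + u w\<close> and \<open>w = w\<^sup>2 + u w\<close>. Splitting off squares, every \<open>u\<^sup>a w\<^sup>b\<close> is
  therefore of the form \<open>s\<^sup>2 + r\<^sup>2 u w\<close>. In the expansion of the product over all indices only products
  of the \<open>u w\<close> with square coefficients remain.
\<close>

lemma prod_powers_mem:
  assumes "finite I" and sum: "\<And>i. i \<in> I \<Longrightarrow> u i + w i = 1"
    and prods: "\<And>J. J \<subseteq> I \<Longrightarrow> (\<Prod>i\<in>J. u i * w i) \<in> Q"
  shows "(\<Prod>i\<in>I. u i ^ a i * w i ^ b i) \<in> Q"
proof -
  have factor: "\<exists>s r. u i ^ a i * w i ^ b i = s\<^sup>2 + r\<^sup>2 * (u i * w i)" if "i \<in> I" for i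
  proof -
    define z where "z = u i ^ (a i div 2) * w i ^ (b i div 2)"
    have u: "u i = (u i)\<^sup>2 + u i * w i" and w: "w i = (w i)\<^sup>2 + u i * w i"
      using arg_cong[OF sum[OF that], of "\<lambda>s. u i * s"] arg_cong[OF sum[OF that], of "\<lambda>s. s * w i"]
      by (simp_all add: algebra_simps power2_eq_square)
    have a: "u i ^ a i = (u i ^ (a i div 2))\<^sup>2 * u i ^ (a i mod 2)"
      by (simp only: power_mult[symmetric] power_add[symmetric]) simp
    have b: "w i ^ b i = (w i ^ (b i div 2))\<^sup>2 * w i ^ (b i mod 2)"
      by (simp only: power_mult[symmetric] power_add[symmetric]) simp
    have "u i ^ a i * w i ^ b i = z\<^sup>2 * (u i ^ (a i mod 2) * w i ^ (b i mod 2))"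
      by (subst a, subst b) (simp add: z_def power_mult_distrib ac_simps)
    moreover have "\<exists>s r. u i ^ (a i mod 2) * w i ^ (b i mod 2) = s\<^sup>2 + r\<^sup>2 * (u i * w i)"
    proof -
      consider "a i mod 2 = 0" "b i mod 2 = 0" | "a i mod 2 = 1" "b i mod 2 = 0"
        | "a i mod 2 = 0" "b i mod 2 = 1" | "a i mod 2 = 1" "b i mod 2 = 1" by linarith
      then show ?thesis
      proof cases
        case 1 then show ?thesis by (intro exI[of _ 1] exI[of _ 0]) simp
      next
        case 2 then show ?thesis using u by (intro exI[of _ "u i"] exI[of _ 1]) simp
      next
        case 3 then show ?thesis using w by (intro exI[of _ "w i"] exI[of _ 1]) simp
      next
        case 4 then show ?thesis by (intro exI[of _ 0] exI[of _ 1]) simp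
      qed
    qed
    then obtain s r where "u i ^ (a i mod 2) * w i ^ (b i mod 2) = s\<^sup>2 + r\<^sup>2 * (u i * w i)" by blast
    ultimately have "u i ^ a i * w i ^ b i = (z * s)\<^sup>2 + (z * r)\<^sup>2 * (u i * w i)"
      by (simp add: power_mult_distrib distrib_left mult.assoc)
    then show ?thesis by blast
  qed
  then obtain s r where sr: "\<And>i. i \<in> I \<Longrightarrow> u i ^ a i * w i ^ b i = (s i)\<^sup>2 + (r i)\<^sup>2 * (u i * w i)"
    by metis
  let ?F = "\<lambda>J. \<Prod>i\<in>J. u i ^ a i * w i ^ b i" and ?V = "\<lambda>K. \<Prod>i\<in>K. u i * w i"
  have "q\<^sup>2 * ?F J * ?V K \<in> Q"
    if "finite J" "J \<subseteq> I" "K \<subseteq> I" "J \<inter> K = {}" for J K q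
    using that
  proof (induction J arbitrary: K q rule: finite_induct)
    case empty
    then show ?case by (simp add: square_mult_mem prods)
  next
    case (insert j J)
    have "finite K" using insert.prems \<open>finite I\<close> finite_subset by blast
    have "(q * s j)\<^sup>2 * ?F J * ?V K
        + (q * r j)\<^sup>2 * ?F J * ?V (insert j K) \<in> Q"
      using insert.prems insert.hyps by (intro add_mem insert.IH) auto
    also have "(q * s j)\<^sup>2 * ?F J * ?V K
        + (q * r j)\<^sup>2 * ?F J * ?V (insert j K)
        = q\<^sup>2 * ((s j)\<^sup>2 + (r j)\<^sup>2 * (u j * w j)) * ?F J * ?V K"
      using insert.prems \<open>finite K\<close>
      by (subst prod.insert) (auto simp: power_mult_distrib algebra_simps)
    also have "(s j)\<^sup>2 + (r j)\<^sup>2 * (u j * w j) = u j ^ a j * w j ^ b j"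
      using sr insert.prems by simp
    finally show ?case using insert.hyps by (simp add: mult.assoc)
  qed
  from this[of I "{}" 1] show ?thesis using \<open>finite I\<close> by simp
qed

end

lemma binomial_ratio_prod:
  fixes a k D :: nat
  assumes "a \<le> D" "k \<le> D"
  shows "real (k choose a) / real (D choose a) = (\<Prod>l<a. real (k - l) / real (D - l))"
proof (cases "a \<le> k")
  case True
  have "real (k choose a) / real (D choose a)
      = (\<Prod>l<a. real (k - l) / real (a - l)) / (\<Prod>l<a. real (D - l) / real (a - l))"
    using True assms by (simp add: binomial_altdef_of_nat atLeast0LessThan)
  also have "\<dots> = (\<Prod>l<a. (real (k - l) / real (a - l)) / (real (D - l) / real (a - l)))"
    by (simp only: prod_dividef)
  also have "\<dots> = (\<Prod>l<a. real (k - l) / real (D - l))"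
    by (intro prod.cong) auto
  finally show ?thesis .
next
  case False
  then have zero: "(\<Prod>l<a. real (k - l) / real (D - l)) = 0"
    by (intro prod_zero[of "{..<a}"] bexI[of _ k]) auto
  show ?thesis unfolding zero using False by simp
qed

lemma binomial_ratio_approx:
  fixes a k D A :: nat
  assumes "a \<le> A" "A < D" "k \<le> D"
  shows "\<bar>real (k choose a) / real (D choose a) - (real k / real D) ^ a\<bar>
    \<le> real A * (real A / real (D - A))"
    and "\<bar>real (k choose a) / real (D choose a)\<bar> \<le> 1"
proof -
  have factor: "\<bar>real (k - l) / real (D - l)\<bar> \<le> 1" if "l < a" for l
    using that assms by (simp add: divide_le_eq)
  have diff: "\<bar>real (k - l) / real (D - l) - real k / real D\<bar> \<le> real A / real (D - A)" if "l < a" for l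
  proof -
    have pos: "real D > 0" "real (D - l) > 0" "real (D - A) > 0" using that assms by auto
    have lA: "real l / real (D - l) \<le> real A / real (D - A)"
      using that assms by (intro frac_le) auto
    show ?thesis
    proof (cases "l \<le> k")
      case True
      have "\<bar>real (k - l) / real (D - l) - real k / real D\<bar> = \<bar>real k / real D - real (k - l) / real (D - l)\<bar>"
        by (rule abs_minus_commute)
      also have "real k / real D - real (k - l) / real (D - l) = real l * (real D - real k) / (real D * real (D - l))"
        using True that assms pos by (simp add: field_simps of_nat_diff)
      also have "\<bar>\<dots>\<bar> = real l * (real D - real k) / (real D * real (D - l))"
        using assms by (intro abs_of_nonneg) simp
      also have "\<dots> \<le> real l * real D / (real D * real (D - l))"
        by (intro divide_right_mono mult_left_mono) auto
      also have "\<dots> = real l / real (D - l)"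
        using pos by simp
      also note lA
      finally show ?thesis .
    next
      case False
      then have "real k / real D \<le> real l / real (D - l)"
        using that assms by (intro frac_le) auto
      moreover have "0 \<le> real k / real D" by simp
      ultimately show ?thesis using lA False by simp
    qed
  qed
  have "\<bar>(\<Prod>l<a. real (k - l) / real (D - l)) - (\<Prod>l<a. real k / real D)\<bar>
      \<le> (\<Sum>l<a. \<bar>real (k - l) / real (D - l) - real k / real D\<bar>)"
    using norm_prod_diff[of "{..<a}" "\<lambda>l. real (k - l) / real (D - l)" "\<lambda>l. real k / real D"] factor assms
    by (simp add: divide_le_eq)
  also have "\<dots> \<le> (\<Sum>l<a. real A / real (D - A))"
    by (intro sum_mono diff) auto
  also have "\<dots> \<le> real A * (real A / real (D - A))"
    using assms by (simp add: mult_right_mono divide_right_mono)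
  finally show "\<bar>real (k choose a) / real (D choose a) - (real k / real D) ^ a\<bar>
    \<le> real A * (real A / real (D - A))"
    using assms by (simp add: binomial_ratio_prod)
  have "\<bar>\<Prod>l<a. real (k - l) / real (D - l)\<bar> \<le> 1"
    unfolding abs_prod using factor by (intro prod_le_1) auto
  then show "\<bar>real (k choose a) / real (D choose a)\<bar> \<le> 1"
    using assms by (simp add: binomial_ratio_prod)
qed

text \<open>
  Multiply \<open>u\<^sup>a\<close> by \<open>(u + w)\<^sup>D\<^sup>-\<^sup>a = 1\<close> and expand.
\<close>

lemma power_bernstein:
  fixes u w :: "'n xpoly"
  assumes sum: "u + w = 1" and "a \<le> D"
  shows "u ^ a = (\<Sum>k\<le>D. Const (real (k choose a) / real (D choose a)) *
    (Const (real (D choose k)) * (u ^ k * w ^ (D - k))))"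
proof -
  have Const_of_nat: "Const (real n) = of_nat n" for n
    by (induction n) (simp_all add: Const_hom.hom_0 Const_hom.hom_add Const_hom.hom_1)
  have "(\<Sum>k\<le>D. Const (real (k choose a) / real (D choose a)) *
      (Const (real (D choose k)) * (u ^ k * w ^ (D - k))))
      = (\<Sum>k\<in>{a..D}. of_nat ((D - a) choose (k - a)) * (u ^ k * w ^ (D - k)))"
  proof (rule sum.mono_neutral_cong_right)
    fix k assume k: "k \<in> {a..D}"
    have "real (k choose a) * real (D choose k) = real (D choose a) * real ((D - a) choose (k - a))"
      using choose_mult[of a k D] k by (simp only: of_nat_mult[symmetric] atLeastAtMost_iff mult.commute)
    moreover have "real (D choose a) \<noteq> 0" using assms by simp
    ultimately have "real (k choose a) / real (D choose a) * real (D choose k) = real ((D - a) choose (k - a))"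
      by (simp add: field_simps)
    then have merge: "Const (real (k choose a) / real (D choose a)) * Const (real (D choose k))
        = Const (real ((D - a) choose (k - a)))"
      by (simp only: Const_hom.hom_mult[symmetric])
    show "Const (real (k choose a) / real (D choose a)) *
      (Const (real (D choose k)) * (u ^ k * w ^ (D - k)))
      = of_nat ((D - a) choose (k - a)) * (u ^ k * w ^ (D - k))"
      by (simp only: mult.assoc[symmetric] merge) (simp only: Const_of_nat)
  qed (auto simp: Const_hom.hom_0 binomial_eq_0)
  also have "\<dots> = (\<Sum>k\<le>D - a. of_nat ((D - a) choose k) * (u ^ (k + a) * w ^ (D - (k + a))))"
    by (rule sum.reindex_bij_witness[of _ "\<lambda>k. k + a" "\<lambda>k. k - a"]) (use assms in auto)
  also have "\<dots> = u ^ a * (\<Sum>k\<le>D - a. of_nat ((D - a) choose k) * u ^ k * w ^ (D - a - k))"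
    by (simp add: sum_distrib_left power_add algebra_simps)
  also have "\<dots> = u ^ a * (u + w) ^ (D - a)" by (simp only: binomial_ring)
  finally show ?thesis by (simp add: sum)
qed

text \<open>
  Affine coordinates of the box \<open>[-R, R]\<^sup>n\<close> with values in \<open>[0, 1]\<close>.
\<close>

definition unit_coord :: "real \<Rightarrow> 'n \<Rightarrow> 'n xpoly" where
  "unit_coord R i = Const (1 / (2 * R)) * (Var i + Const R)"

definition unit_cocoord :: "real \<Rightarrow> 'n \<Rightarrow> 'n xpoly" where
  "unit_cocoord R i = Const (1 / (2 * R)) * (Const R - Var i)"

definition unit_substitution :: "real \<Rightarrow> 'n::finite xpoly \<Rightarrow> 'n xpoly" where
  "unit_substitution R = Const_hom.extend (\<lambda>\<alpha>. \<Prod>i\<in>UNIV. unit_coord R i ^ Poly_Mapping.lookup \<alpha> i)"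

text \<open>
  The polynomial that becomes \<open>f\<close> when \<open>unit_coord R i\<close> is substituted for the \<open>i\<close>-th variable.
\<close>

definition in_unit_coords :: "real \<Rightarrow> 'n::finite xpoly \<Rightarrow> 'n xpoly" where
  "in_unit_coords R = Const_hom.extend
     (\<lambda>\<alpha>. \<Prod>i\<in>UNIV. (Const (2 * R) * Var i - Const R) ^ Poly_Mapping.lookup \<alpha> i)"

text \<open>
  The coefficients of \<open>f\<close> in the tensor product Bernstein basis of degree \<open>D\<close> in each variable, obtained
  from \<open>power_bernstein\<close> for each monomial in the unit coordinates. Equal entries of a polynomial matrix
  have equal coefficients, so symmetry passes on to the coefficient matrices.
\<close>

definition bernstein_coeff :: "real \<Rightarrow> 'n::finite xpoly \<Rightarrow> nat \<Rightarrow> ('n \<Rightarrow> nat) \<Rightarrow> real" where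
  "bernstein_coeff R f D \<kappa> = (\<Sum>\<alpha>\<in>Poly_Mapping.keys (in_unit_coords R f).
     Poly_Mapping.lookup (in_unit_coords R f) \<alpha> *
     (\<Prod>i\<in>UNIV. real (\<kappa> i choose Poly_Mapping.lookup \<alpha> i) / real (D choose Poly_Mapping.lookup \<alpha> i)))"

definition bernstein_basis :: "real \<Rightarrow> nat \<Rightarrow> ('n::finite \<Rightarrow> nat) \<Rightarrow> 'n xpoly" where
  "bernstein_basis R D \<kappa> = (\<Prod>i\<in>UNIV. Const (real (D choose \<kappa> i)) *
     (unit_coord R i ^ \<kappa> i * unit_cocoord R i ^ (D - \<kappa> i)))"

definition bernstein_node :: "real \<Rightarrow> nat \<Rightarrow> ('n::finite \<Rightarrow> nat) \<Rightarrow> real^'n" where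
  "bernstein_node R D \<kappa> = (\<chi> i. R * (2 * (real (\<kappa> i) / real D) - 1))"

lemma single_eq_Const_mult_prod_Var:
  fixes \<alpha> :: "'n::finite expo"
  shows "Poly_Mapping.single \<alpha> c = Const c * (\<Prod>i\<in>UNIV. Var i ^ Poly_Mapping.lookup \<alpha> i)"
proof -
  have Var_power: "Var i ^ k = Poly_Mapping.single (Poly_Mapping.single i k) (1::real)" for i :: 'n and k
    by (induction k) (simp_all add: Var_def mult_single single_add[symmetric])
  have "(\<Prod>i\<in>I. Poly_Mapping.single (g i) (1::real)) = Poly_Mapping.single (\<Sum>i\<in>I. g i) 1"
    for g :: "'n \<Rightarrow> 'n expo" and I
    by (induction I rule: infinite_finite_induct) (simp_all add: mult_single)
  moreover have "(\<Sum>i\<in>UNIV. Poly_Mapping.single i (Poly_Mapping.lookup \<alpha> i)) = \<alpha>"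
    by (rule poly_mapping_eqI) (simp add: lookup_sum lookup_single when_def)
  ultimately show ?thesis
    by (simp add: Var_power Const_def mult_single)
qed

lemma unit_substitution_add: "unit_substitution R (f + g) = unit_substitution R f + unit_substitution R g"
  by (simp add: unit_substitution_def Const_hom.extend_add)

lemma unit_substitution_mult: "unit_substitution R (f * g) = unit_substitution R f * unit_substitution R g"
  unfolding unit_substitution_def
  by (rule Const_hom.extend_mult) (simp add: lookup_add power_add prod.distrib)

lemma unit_substitution_Const: "unit_substitution R (Const c) = Const c"
  by (simp add: unit_substitution_def Const_def[of c] Const_hom.extend_single)

lemma unit_substitution_Var: "unit_substitution R (Var i) = unit_coord R i"
proof -
  have "(\<Prod>k\<in>UNIV. unit_coord R k ^ Poly_Mapping.lookup (Poly_Mapping.single i (1::nat)) k)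
      = (\<Prod>k\<in>UNIV. if k = i then unit_coord R k else 1)"
    by (intro prod.cong) (auto simp: lookup_single when_def)
  then show ?thesis
    by (simp add: unit_substitution_def Var_def Const_hom.extend_single Const_hom.hom_1)
qed

lemma unit_substitution_in_unit_coords:
  assumes "R > 0" shows "unit_substitution R (in_unit_coords R f) = f"
proof (induction f rule: poly_mapping_induct_single)
  case (single \<alpha> c)
  let ?s = "unit_substitution R"
  have "?s 0 = 0"
    using unit_substitution_Const[of R 0] by (simp only: Const_hom.hom_0)
  then have minus: "?s (- g) = - ?s g" for g
    by (intro minus_unique[symmetric]) (simp only: unit_substitution_add[symmetric] right_minus)
  have diff: "?s (g - k) = ?s g - ?s k" for g k
    using unit_substitution_add[of R g "- k"] minus by simp
  have one: "?s 1 = 1"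
    using unit_substitution_Const[of R 1] by (simp only: Const_hom.hom_1)
  have power: "?s (g ^ k) = ?s g ^ k" for g k
    by (induction k) (simp_all add: unit_substitution_mult one)
  have prod: "?s (\<Prod>i\<in>I. g i) = (\<Prod>i\<in>I. ?s (g i))" for g and I :: "'a set"
    by (induction I rule: infinite_finite_induct) (simp_all add: unit_substitution_mult one)
  have Var: "?s (Const (2 * R) * Var i - Const R) = Var i" for i
  proof -
    have "Const (2 * R) * unit_coord R i = Const (2 * R * (1 / (2 * R))) * (Var i + Const R)"
      by (simp only: unit_coord_def mult.assoc[symmetric] Const_hom.hom_mult)
    also have "2 * R * (1 / (2 * R)) = 1" using assms by simp
    finally show ?thesis
      by (simp add: diff unit_substitution_mult unit_substitution_Const unit_substitution_Var Const_hom.hom_1)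
  qed
  have "in_unit_coords R (Poly_Mapping.single \<alpha> c)
      = Const c * (\<Prod>i\<in>UNIV. (Const (2 * R) * Var i - Const R) ^ Poly_Mapping.lookup \<alpha> i)"
    by (simp only: in_unit_coords_def Const_hom.extend_single)
  then have "?s (in_unit_coords R (Poly_Mapping.single \<alpha> c))
      = Const c * (\<Prod>i\<in>UNIV. Var i ^ Poly_Mapping.lookup \<alpha> i)"
    by (simp only: unit_substitution_mult prod power unit_substitution_Const Var)
  then show ?case by (simp only: single_eq_Const_mult_prod_Var)
next
  case (add f g)
  have "in_unit_coords R (f + g) = in_unit_coords R f + in_unit_coords R g"
    by (simp add: in_unit_coords_def Const_hom.extend_add)
  then show ?case using add by (simp add: unit_substitution_add)
qed

lemma unit_coord_sum: "R > 0 \<Longrightarrow> unit_coord R i + unit_cocoord R i = 1"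
proof -
  assume "R > 0"
  have "unit_coord R i + unit_cocoord R i = Const (1 / (2 * R)) * (Const R + Const R)"
    by (simp add: unit_coord_def unit_cocoord_def algebra_simps)
  also have "\<dots> = Const (1 / (2 * R) * (R + R))" by (simp only: Const_hom.hom_add Const_hom.hom_mult)
  also have "1 / (2 * R) * (R + R) = 1" using \<open>R > 0\<close> by simp
  finally show ?thesis by (simp only: Const_hom.hom_1)
qed

lemma bernstein_expansion:
  fixes f :: "'n::finite xpoly"
  assumes R: "R > 0"
    and D: "\<And>\<alpha> i. \<alpha> \<in> Poly_Mapping.keys (in_unit_coords R f) \<Longrightarrow> Poly_Mapping.lookup \<alpha> i \<le> D"
  shows "f = (\<Sum>\<kappa>\<in>PiE UNIV (\<lambda>_. {..D}). Const (bernstein_coeff R f D \<kappa>) * bernstein_basis R D \<kappa>)"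
proof -
  let ?g = "in_unit_coords R f" and ?K = "PiE (UNIV :: 'n set) (\<lambda>_. {..D})"
  let ?\<rho> = "\<lambda>\<alpha> \<kappa> i. real (\<kappa> i choose Poly_Mapping.lookup \<alpha> i) / real (D choose Poly_Mapping.lookup \<alpha> i)"
  have Const_prod: "(\<Prod>i\<in>I. Const (r i)) = Const (\<Prod>i\<in>I. r i)" for r :: "'n \<Rightarrow> real" and I
    by (induction I rule: infinite_finite_induct) (simp_all add: Const_hom.hom_1 Const_hom.hom_mult)
  have Const_sum: "(\<Sum>i\<in>I. Const (r i)) = Const (\<Sum>i\<in>I. r i)" for r :: "'n expo \<Rightarrow> real" and I
    by (induction I rule: infinite_finite_induct) (simp_all add: Const_hom.hom_0 Const_hom.hom_add)
  have monomial: "(\<Prod>i\<in>UNIV. unit_coord R i ^ Poly_Mapping.lookup \<alpha> i)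
      = (\<Sum>\<kappa>\<in>?K. Const (\<Prod>i\<in>UNIV. ?\<rho> \<alpha> \<kappa> i) * bernstein_basis R D \<kappa>)"
    if "\<alpha> \<in> Poly_Mapping.keys ?g" for \<alpha>
  proof -
    have "(\<Prod>i\<in>UNIV. unit_coord R i ^ Poly_Mapping.lookup \<alpha> i)
        = (\<Prod>i\<in>UNIV. \<Sum>k\<le>D. Const (real (k choose Poly_Mapping.lookup \<alpha> i) / real (D choose Poly_Mapping.lookup \<alpha> i)) *
            (Const (real (D choose k)) * (unit_coord R i ^ k * unit_cocoord R i ^ (D - k))))"
      by (intro prod.cong refl power_bernstein unit_coord_sum R D that)
    also have "\<dots> = (\<Sum>\<kappa>\<in>?K. \<Prod>i\<in>UNIV. Const (?\<rho> \<alpha> \<kappa> i) *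
            (Const (real (D choose \<kappa> i)) * (unit_coord R i ^ \<kappa> i * unit_cocoord R i ^ (D - \<kappa> i))))"
      by (rule prod_sum_PiE) auto
    also have "\<dots> = (\<Sum>\<kappa>\<in>?K. Const (\<Prod>i\<in>UNIV. ?\<rho> \<alpha> \<kappa> i) * bernstein_basis R D \<kappa>)"
      by (simp only: bernstein_basis_def prod.distrib Const_prod)
    finally show ?thesis .
  qed
  have "f = unit_substitution R ?g" using R by (simp add: unit_substitution_in_unit_coords)
  also have "\<dots> = (\<Sum>\<alpha>\<in>Poly_Mapping.keys ?g. Const (Poly_Mapping.lookup ?g \<alpha>) *
      (\<Sum>\<kappa>\<in>?K. Const (\<Prod>i\<in>UNIV. ?\<rho> \<alpha> \<kappa> i) * bernstein_basis R D \<kappa>))"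
    unfolding unit_substitution_def Const_hom.extend_def
    by (intro sum.cong refl) (simp add: monomial)
  also have "\<dots> = (\<Sum>\<kappa>\<in>?K. \<Sum>\<alpha>\<in>Poly_Mapping.keys ?g.
      Const (Poly_Mapping.lookup ?g \<alpha> * (\<Prod>i\<in>UNIV. ?\<rho> \<alpha> \<kappa> i)) * bernstein_basis R D \<kappa>)"
    unfolding sum_distrib_left by (subst sum.swap) (simp only: Const_hom.hom_mult mult.assoc)
  also have "\<dots> = (\<Sum>\<kappa>\<in>?K. Const (bernstein_coeff R f D \<kappa>) * bernstein_basis R D \<kappa>)"
    by (simp only: bernstein_coeff_def sum_distrib_right[symmetric] Const_sum)
  finally show ?thesis .
qed

text \<open>
  The coefficient of a monomial \<open>u\<^sup>a\<close> at the index \<open>\<kappa>\<close> is a product of binomial ratios, which differs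
  from the value of the monomial at the grid point \<open>\<kappa> / D\<close> by \<open>O(1 / D)\<close>, uniformly in \<open>\<kappa>\<close>.
\<close>

lemma bernstein_coeff_approx:
  fixes f :: "'n::finite xpoly"
  assumes R: "R > 0" and "\<epsilon> > 0"
  shows "\<forall>\<^sub>F D in sequentially. \<forall>\<kappa>. (\<forall>i. \<kappa> i \<le> D) \<longrightarrow>
    \<bar>bernstein_coeff R f D \<kappa> - eval_x f (bernstein_node R D \<kappa>)\<bar> < \<epsilon>"
    and "\<forall>\<^sub>F D in sequentially. f = (\<Sum>\<kappa>\<in>PiE UNIV (\<lambda>_. {..D}). Const (bernstein_coeff R f D \<kappa>) * bernstein_basis R D \<kappa>)"
proof -
  let ?g = "in_unit_coords R f"
  obtain A where A: "\<And>\<alpha> i. \<alpha> \<in> Poly_Mapping.keys ?g \<Longrightarrow> Poly_Mapping.lookup \<alpha> i \<le> A"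
  proof -
    let ?S = "(\<lambda>(\<alpha>, i). Poly_Mapping.lookup \<alpha> i) ` (Poly_Mapping.keys ?g \<times> UNIV)"
    have "finite ?S" by simp
    then show ?thesis
      by (intro that[of "Max ?S"] Max_ge) force+
  qed
  show "\<forall>\<^sub>F D in sequentially. f = (\<Sum>\<kappa>\<in>PiE UNIV (\<lambda>_. {..D}). Const (bernstein_coeff R f D \<kappa>) * bernstein_basis R D \<kappa>)"
    using eventually_ge_at_top[of A]
    by eventually_elim (intro bernstein_expansion R, use A order_trans in blast)
  define e where "e D = (\<Sum>\<alpha>\<in>Poly_Mapping.keys ?g. \<bar>Poly_Mapping.lookup ?g \<alpha>\<bar> *
     (real CARD('n) * (real A * (real A / real (D - A)))))" for D
  have "(\<lambda>n. real A / real n) \<longlonglongrightarrow> 0" by (rule lim_const_over_n)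
  then have "(\<lambda>n. real A / real (n + A - A)) \<longlonglongrightarrow> 0" by simp
  then have "(\<lambda>D. real A / real (D - A)) \<longlonglongrightarrow> 0"
    by (rule LIMSEQ_offset[where k = A])
  then have "e \<longlonglongrightarrow> (\<Sum>\<alpha>\<in>Poly_Mapping.keys ?g. \<bar>Poly_Mapping.lookup ?g \<alpha>\<bar> * (real CARD('n) * (real A * 0)))"
    unfolding e_def by (intro tendsto_intros)
  then have "e \<longlonglongrightarrow> 0" by simp
  then have "\<forall>\<^sub>F D in sequentially. e D < \<epsilon>" using \<open>\<epsilon> > 0\<close> by (rule order_tendstoD)
  then show "\<forall>\<^sub>F D in sequentially. \<forall>\<kappa>. (\<forall>i. \<kappa> i \<le> D) \<longrightarrow>
    \<bar>bernstein_coeff R f D \<kappa> - eval_x f (bernstein_node R D \<kappa>)\<bar> < \<epsilon>"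
    using eventually_gt_at_top[of A]
  proof eventually_elim
    case (elim D)
    show ?case
    proof (intro allI impI)
      fix \<kappa> :: "'n \<Rightarrow> nat" assume \<kappa>: "\<forall>i. \<kappa> i \<le> D"
      let ?\<rho> = "\<lambda>\<alpha> i. real (\<kappa> i choose Poly_Mapping.lookup \<alpha> i) / real (D choose Poly_Mapping.lookup \<alpha> i)"
      let ?p = "\<lambda>\<alpha> i. (real (\<kappa> i) / real D) ^ Poly_Mapping.lookup \<alpha> i"
      have coord: "eval_x (unit_coord R i) (bernstein_node R D \<kappa>) = real (\<kappa> i) / real D" for i
        using R by (simp add: unit_coord_def bernstein_node_def field_simps)
      have "eval_x f (bernstein_node R D \<kappa>) = eval_x (unit_substitution R ?g) (bernstein_node R D \<kappa>)"
        using R by (simp add: unit_substitution_in_unit_coords)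
      also have "\<dots> = (\<Sum>\<alpha>\<in>Poly_Mapping.keys ?g. Poly_Mapping.lookup ?g \<alpha> * (\<Prod>i\<in>UNIV. ?p \<alpha> i))"
        unfolding unit_substitution_def Const_hom.extend_def by (simp add: coord)
      finally have "bernstein_coeff R f D \<kappa> - eval_x f (bernstein_node R D \<kappa>) =
        (\<Sum>\<alpha>\<in>Poly_Mapping.keys ?g. Poly_Mapping.lookup ?g \<alpha> * ((\<Prod>i\<in>UNIV. ?\<rho> \<alpha> i) - (\<Prod>i\<in>UNIV. ?p \<alpha> i)))"
        by (simp add: bernstein_coeff_def sum_subtractf right_diff_distrib)
      also have "\<bar>\<dots>\<bar> \<le> (\<Sum>\<alpha>\<in>Poly_Mapping.keys ?g. \<bar>Poly_Mapping.lookup ?g \<alpha> * ((\<Prod>i\<in>UNIV. ?\<rho> \<alpha> i) - (\<Prod>i\<in>UNIV. ?p \<alpha> i))\<bar>)"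
        by (rule sum_abs)
      also have "\<dots> \<le> e D"
        unfolding e_def abs_mult
      proof (intro sum_mono mult_left_mono)
        fix \<alpha> assume \<alpha>: "\<alpha> \<in> Poly_Mapping.keys ?g"
        have "\<bar>(\<Prod>i\<in>UNIV. ?\<rho> \<alpha> i) - (\<Prod>i\<in>UNIV. ?p \<alpha> i)\<bar> \<le> (\<Sum>i\<in>UNIV. \<bar>?\<rho> \<alpha> i - ?p \<alpha> i\<bar>)"
        proof -
          have "norm (?\<rho> \<alpha> i) \<le> 1" for i
            using binomial_ratio_approx(2)[OF A[OF \<alpha>] elim(2)] \<kappa> by (simp only: real_norm_def)
          moreover have "norm (?p \<alpha> i) \<le> 1" for i
            using \<kappa> elim(2) by (simp add: power_le_one divide_le_eq)
          ultimately show ?thesis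
            using norm_prod_diff[of UNIV "?\<rho> \<alpha>" "?p \<alpha>"] by (simp only: real_norm_def)
        qed
        also have "\<dots> \<le> (\<Sum>i\<in>(UNIV::'n set). real A * (real A / real (D - A)))"
          using binomial_ratio_approx(1)[OF A[OF \<alpha>] elim(2)] \<kappa> by (intro sum_mono) auto
        also have "\<dots> = real CARD('n) * (real A * (real A / real (D - A)))" by simp
        finally show "\<bar>(\<Prod>i\<in>UNIV. ?\<rho> \<alpha> i) - (\<Prod>i\<in>UNIV. ?p \<alpha> i)\<bar> \<le> real CARD('n) * (real A * (real A / real (D - A)))" .
      qed simp
      finally show "\<bar>bernstein_coeff R f D \<kappa> - eval_x f (bernstein_node R D \<kappa>)\<bar> < \<epsilon>"
        using elim(1) by simp
    qed
  qed
qed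

lemma Const_mult_mem:
  fixes Q :: "'n xpoly set"
  assumes "quadratic_module Q" "q \<in> Q" "c \<ge> 0" shows "Const c * q \<in> Q"
proof -
  have "(Const c :: 'n xpoly) = (Const (sqrt c))\<^sup>2"
    using assms(3) by (simp add: power2_eq_square Const_hom.hom_mult[symmetric])
  then show ?thesis by (simp only: quadratic_module.square_mult_mem[OF assms(1,2)])
qed

text \<open>
  With \<open>\<xi>\<^sub>i = x\<^sub>i / R\<close> one has \<open>u\<^sub>i w\<^sub>i = (1 - \<xi>\<^sub>i\<^sup>2) / 4\<close>, and the products of the \<open>1 - \<xi>\<^sub>i\<^sup>2\<close> are in the module
  because of the ball constraint.
\<close>

lemma bernstein_basis_mem:
  fixes Q :: "'n::finite xpoly set"
  assumes Q: "quadratic_module Q" and R: "R > 0"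
    and ball: "Const (R\<^sup>2) - (\<Sum>i\<in>UNIV. (Var i)\<^sup>2) \<in> Q"
  shows "bernstein_basis R D \<kappa> \<in> Q"
proof -
  interpret quadratic_module Q by (rule Q)
  define \<xi> where "\<xi> i = Const (1 / R) * Var i" for i :: 'n
  have "1 - (\<Sum>i\<in>UNIV. (\<xi> i)\<^sup>2) = (Const (1 / R))\<^sup>2 * (Const (R\<^sup>2) - (\<Sum>i\<in>UNIV. (Var i)\<^sup>2))"
  proof -
    have "(Const (1 / R))\<^sup>2 * Const (R\<^sup>2) = Const (1 / R * (1 / R) * R\<^sup>2)"
      by (simp only: power2_eq_square[of "Const _"] Const_hom.hom_mult)
    also have "1 / R * (1 / R) * R\<^sup>2 = 1" using R by (simp add: power2_eq_square)
    finally show ?thesis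
      by (simp add: \<xi>_def power_mult_distrib right_diff_distrib sum_distrib_left Const_hom.hom_1)
  qed
  then have ball': "1 - (\<Sum>i\<in>UNIV. (\<xi> i)\<^sup>2) \<in> Q" using square_mult_mem[OF ball] by simp
  have uw: "unit_coord R i * unit_cocoord R i = (Const (1 / 2))\<^sup>2 * (1 - (\<xi> i)\<^sup>2)" for i
  proof -
    have half: "Const (1 / (2 * R)) = Const (1 / 2) * Const (1 / R)"
      by (simp add: Const_hom.hom_mult[symmetric])
    have one: "Const (1 / R) * Const R = 1"
      using R by (simp add: Const_hom.hom_mult[symmetric] Const_hom.hom_1)
    have u: "unit_coord R i = Const (1 / 2) * (\<xi> i + 1)"
      unfolding unit_coord_def half \<xi>_def one[symmetric] by (simp add: algebra_simps)
    have w: "unit_cocoord R i = Const (1 / 2) * (1 - \<xi> i)"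
      unfolding unit_cocoord_def half \<xi>_def one[symmetric] by (simp add: algebra_simps)
    show ?thesis unfolding u w by (simp add: power2_eq_square algebra_simps)
  qed
  have powers: "(\<Prod>i\<in>UNIV. unit_coord R i ^ \<kappa> i * unit_cocoord R i ^ (D - \<kappa> i)) \<in> Q"
  proof (rule prod_powers_mem)
    show "(\<Prod>i\<in>J. unit_coord R i * unit_cocoord R i) \<in> Q" for J
      using square_mult_mem[OF prod_one_minus_squares_mem[OF _ ball', of J], of "Const (1 / 2) ^ card J"]
      by (simp add: uw prod.distrib power_mult[symmetric] mult.commute[of 2])
  qed (use R in \<open>auto simp: unit_coord_sum\<close>)
  have const_prod: "(\<Prod>i\<in>I. Const (real (D choose \<kappa> i))) = Const (\<Prod>i\<in>I. real (D choose \<kappa> i))" for I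
    by (induction I rule: infinite_finite_induct) (simp_all add: Const_hom.hom_1 Const_hom.hom_mult)
  have "bernstein_basis R D \<kappa> = Const (\<Prod>i\<in>UNIV. real (D choose \<kappa> i)) *
      (\<Prod>i\<in>UNIV. unit_coord R i ^ \<kappa> i * unit_cocoord R i ^ (D - \<kappa> i))"
    unfolding bernstein_basis_def const_prod[symmetric] by (rule prod.distrib)
  then show ?thesis by (simp only:) (intro Const_mult_mem[OF Q powers] prod_nonneg, auto)
qed

section \<open>A Positivstellensatz for polynomial matrices\<close>

text \<open>
  The matrices \<open>g t t\<^sup>T\<close> generate everything that is needed from a matrix version of \<open>Q\<close>, although
  \<open>t\<close> ranges over real vectors only: the polynomial part of a representation can be left to \<open>g\<close>.
\<close>

inductive_set matrix_module :: "'n xpoly set \<Rightarrow> ('n xpoly^'p^'p) set" for Q where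
  zero: "0 \<in> matrix_module Q"
| rank_one: "g \<in> Q \<Longrightarrow> (\<chi> i j. Const (t i * t j) * g) \<in> matrix_module Q"
| add: "M \<in> matrix_module Q \<Longrightarrow> N \<in> matrix_module Q \<Longrightarrow> M + N \<in> matrix_module Q"

lemma matrix_module_sum:
  "(\<And>i. i \<in> I \<Longrightarrow> f i \<in> matrix_module Q) \<Longrightarrow> (\<Sum>i\<in>I. f i) \<in> matrix_module Q"
  by (induction I rule: infinite_finite_induct)
    (auto simp: matrix_module.zero matrix_module.add)

definition quad_form :: "('p::finite \<Rightarrow> 'p \<Rightarrow> real) \<Rightarrow> ('p \<Rightarrow> real) \<Rightarrow> real" where
  "quad_form c v = (\<Sum>i\<in>UNIV. \<Sum>j\<in>UNIV. v i * c i j * v j)"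

lemma quad_form_shift:
  fixes c :: "'p::finite \<Rightarrow> 'p \<Rightarrow> real"
  assumes sym: "\<And>i j. c i j = c j i"
  shows "quad_form c (\<lambda>k. v k - s * (if k = a then 1 else 0))
    = quad_form c v - 2 * s * (\<Sum>j\<in>UNIV. c a j * v j) + s\<^sup>2 * c a a"
proof -
  let ?d = "\<lambda>k. if k = a then 1 else 0 :: real"
  have "quad_form c (\<lambda>k. v k - s * ?d k)
      = (\<Sum>i\<in>UNIV. \<Sum>j\<in>UNIV. v i * c i j * v j - s * (?d i * (c i j * v j))
          - s * (?d j * (c j i * v i)) + s\<^sup>2 * (?d i * (?d j * c i j)))"
    unfolding quad_form_def
    by (intro sum.cong refl) (simp add: sym power2_eq_square algebra_simps)
  also have "\<dots> = quad_form c v - s * (\<Sum>i\<in>UNIV. ?d i * (\<Sum>j\<in>UNIV. c i j * v j))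
      - s * (\<Sum>i\<in>UNIV. \<Sum>j\<in>UNIV. ?d j * (c j i * v i))
      + s\<^sup>2 * (\<Sum>i\<in>UNIV. ?d i * (\<Sum>j\<in>UNIV. ?d j * c i j))"
    by (simp add: quad_form_def sum.distrib sum_subtractf sum_distrib_left)
  also have "(\<Sum>i\<in>UNIV. \<Sum>j\<in>UNIV. ?d j * (c j i * v i)) = (\<Sum>j\<in>UNIV. c a j * v j)"
    by (simp add: if_distrib[of "\<lambda>x. x * _"] sum.delta cong: if_cong)
  also have "(\<Sum>i\<in>UNIV. ?d i * (\<Sum>j\<in>UNIV. c i j * v j)) = (\<Sum>j\<in>UNIV. c a j * v j)"
    by (simp add: if_distrib[of "\<lambda>x. x * _"] sum.delta cong: if_cong)
  also have "(\<Sum>i\<in>UNIV. ?d i * (\<Sum>j\<in>UNIV. ?d j * c i j)) = c a a"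
    by (simp add: if_distrib[of "\<lambda>x. x * _"] sum.delta cong: if_cong)
  finally show ?thesis by simp
qed

lemma quad_form_unit: "quad_form c (\<lambda>k. if k = a then 1 else 0) = c a a"
  unfolding quad_form_def
  by (simp add: if_distrib[of "\<lambda>x. x * _"] if_distrib[of "\<lambda>x. _ * x"] sum.delta cong: if_cong)

text \<open>
  A real positive semidefinite matrix is a sum of rank one matrices, by symmetric elimination:
  subtract \<open>t t\<^sup>T\<close> with \<open>t\<close> proportional to a column whose diagonal entry is nonzero. The difference
  is again positive semidefinite and has fewer nonzero diagonal entries. If the diagonal vanishes,
  so does the matrix.
\<close>

lemma psd_mult_in_matrix_module:
  fixes c :: "'p::finite \<Rightarrow> 'p \<Rightarrow> real"
  assumes g: "g \<in> Q"
    and "\<And>i j. c i j = c j i" and "\<And>v. quad_form c v \<ge> 0"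
  shows "(\<chi> i j. Const (c i j) * g) \<in> matrix_module Q"
  using assms(2,3)
proof (induction "card {i. c i i \<noteq> 0}" arbitrary: c rule: less_induct)
  case less
  note sym = less.prems(1) and psd = less.prems(2)
  show ?case
  proof (cases "\<exists>a. c a a \<noteq> 0")
    case False
    have "c a b = 0" for a b
    proof (rule ccontr)
      assume ab: "c a b \<noteq> 0"
      let ?v = "\<lambda>k. if k = b then 1 else 0 :: real"
      have "(\<Sum>j\<in>UNIV. c a j * ?v j) = c a b"
        by (simp add: if_distrib[of "\<lambda>x. _ * x"] sum.delta cong: if_cong)
      then have "0 \<le> 0 - 2 * (1 / c a b) * c a b + (1 / c a b)\<^sup>2 * 0"
        using psd[of "\<lambda>k. ?v k - 1 / c a b * (if k = a then 1 else 0)"] False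
        unfolding quad_form_shift[OF sym] quad_form_unit by simp
      then show False using ab by simp
    qed
    then have "(\<chi> i j. Const (c i j) * g) = 0" by (simp add: vec_eq_iff Const_hom.hom_0)
    then show ?thesis by (simp add: matrix_module.zero)
  next
    case True
    then obtain a where a: "c a a \<noteq> 0" by blast
    have a_pos: "c a a > 0" using psd[of "\<lambda>k. if k = a then 1 else 0"] a by (simp add: quad_form_unit)
    define t where "t i = c a i / sqrt (c a a)" for i
    define c' where "c' i j = c i j - t i * t j" for i j
    have tt: "t i * t j = c a i * c a j / c a a" for i j
      using a_pos by (simp add: t_def)
    have quad_c': "quad_form c' v = quad_form c v - (\<Sum>j\<in>UNIV. c a j * v j)\<^sup>2 / c a a" for v
    proof -
      have "(\<Sum>i\<in>UNIV. \<Sum>j\<in>UNIV. v i * (t i * t j) * v j) = (\<Sum>j\<in>UNIV. c a j * v j)\<^sup>2 / c a a"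
        unfolding tt power2_eq_square sum_product sum_divide_distrib
        by (intro sum.cong refl) simp
      then show ?thesis
        by (simp add: quad_form_def c'_def right_diff_distrib left_diff_distrib sum_subtractf)
    qed
    have sym': "c' i j = c' j i" for i j by (simp add: c'_def sym[of i j] mult.commute)
    have psd': "quad_form c' v \<ge> 0" for v
    proof -
      \<comment> \<open>The shift by \<open>s\<close> in direction \<open>a\<close> minimises the form; the minimum is the Schur complement.\<close>
      define s where "s = (\<Sum>j\<in>UNIV. c a j * v j) / c a a"
      have "0 \<le> quad_form c v - 2 * s * (\<Sum>j\<in>UNIV. c a j * v j) + s\<^sup>2 * c a a"
        using psd[of "\<lambda>k. v k - s * (if k = a then 1 else 0)"] by (simp only: quad_form_shift[OF sym])
      also have "\<dots> = quad_form c' v"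
        unfolding quad_c' s_def using a by (simp add: field_simps power2_eq_square)
      finally show ?thesis .
    qed
    have "c' i i = 0" if "c i i = 0" for i
    proof -
      have "c' i i \<ge> 0" using psd'[of "\<lambda>k. if k = i then 1 else 0"] by (simp add: quad_form_unit)
      moreover have "c' i i \<le> 0" using that by (simp add: c'_def)
      ultimately show ?thesis by simp
    qed
    moreover have "c' a a = 0" using a by (simp add: c'_def tt)
    ultimately have "{i. c' i i \<noteq> 0} \<subset> {i. c i i \<noteq> 0}" using a by auto
    then have "card {i. c' i i \<noteq> 0} < card {i. c i i \<noteq> 0}" by (intro psubset_card_mono) auto
    then have "(\<chi> i j. Const (c' i j) * g) \<in> matrix_module Q" using sym' psd' by (rule less.hyps)
    then have "(\<chi> i j. Const (c' i j) * g) + (\<chi> i j. Const (t i * t j) * g) \<in> matrix_module Q"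
      by (intro matrix_module.add matrix_module.rank_one g)
    also have "(\<chi> i j. Const (c' i j) * g) + (\<chi> i j. Const (t i * t j) * g) = (\<chi> i j. Const (c i j) * g)"
      by (simp add: vec_eq_iff distrib_right[symmetric] Const_hom.hom_add[symmetric] c'_def)
    finally show ?thesis .
  qed
qed

lemma quad_form_perturb:
  fixes c d :: "'p::finite \<Rightarrow> 'p \<Rightarrow> real"
  assumes "\<And>i j. \<bar>c i j - d i j\<bar> \<le> \<epsilon>"
  shows "\<bar>quad_form c v - quad_form d v\<bar> \<le> \<epsilon> * real CARD('p) * (\<Sum>i\<in>UNIV. (v i)\<^sup>2)"
proof -
  have \<epsilon>: "\<epsilon> \<ge> 0" using assms order_trans[OF abs_ge_zero] by blast
  have "quad_form c v - quad_form d v = (\<Sum>i\<in>UNIV. \<Sum>j\<in>UNIV. v i * (c i j - d i j) * v j)"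
    by (simp add: quad_form_def sum_subtractf right_diff_distrib left_diff_distrib)
  also have "\<bar>\<dots>\<bar> \<le> (\<Sum>i\<in>UNIV. \<Sum>j\<in>UNIV. \<bar>v i * (c i j - d i j) * v j\<bar>)"
    by (intro order_trans[OF sum_abs] sum_mono sum_abs)
  also have "\<dots> \<le> (\<Sum>i\<in>(UNIV::'p set). \<Sum>j\<in>(UNIV::'p set). \<epsilon> * ((v i)\<^sup>2 / 2 + (v j)\<^sup>2 / 2))"
  proof (intro sum_mono)
    fix i j
    have "\<bar>v i\<bar> * \<bar>v j\<bar> \<le> (v i)\<^sup>2 / 2 + (v j)\<^sup>2 / 2"
      using sum_squares_bound[of "\<bar>v i\<bar>" "\<bar>v j\<bar>"] by simp
    then have "\<bar>c i j - d i j\<bar> * (\<bar>v i\<bar> * \<bar>v j\<bar>) \<le> \<epsilon> * ((v i)\<^sup>2 / 2 + (v j)\<^sup>2 / 2)"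
      using assms[of i j] \<epsilon> by (intro mult_mono) auto
    then show "\<bar>v i * (c i j - d i j) * v j\<bar> \<le> \<epsilon> * ((v i)\<^sup>2 / 2 + (v j)\<^sup>2 / 2)"
      by (simp add: abs_mult ac_simps)
  qed
  also have "\<dots> = \<epsilon> * real CARD('p) * (\<Sum>i\<in>UNIV. (v i)\<^sup>2)"
    by (simp add: sum_distrib_left[symmetric] sum.distrib sum_divide_distrib[symmetric])
  finally show ?thesis .
qed

definition coordinate_box :: "real \<Rightarrow> (real^'n) set" where
  "coordinate_box R = {x. \<forall>i. \<bar>x $ i\<bar> \<le> R}"

text \<open>
  For large degree the Bernstein coefficient matrices are so close to values of \<open>M\<close> in the box that
  they inherit positive semidefiniteness, and the Bernstein basis lies in \<open>Q\<close>.
\<close>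

theorem matrix_positive_on_box:
  fixes Q :: "'n::finite xpoly set" and M :: "'n xpoly^'p::finite^'p"
  assumes Q: "quadratic_module Q" and R: "R > 0"
    and ball: "Const (R\<^sup>2) - (\<Sum>i\<in>UNIV. (Var i)\<^sup>2) \<in> Q"
    and sym: "\<And>i j. M $ i $ j = M $ j $ i"
    and \<eta>: "\<eta> > 0"
    and pos: "\<And>x v. x \<in> coordinate_box R \<Longrightarrow>
      \<eta> * (\<Sum>i\<in>UNIV. (v i)\<^sup>2) \<le> quad_form (\<lambda>i j. eval_x (M $ i $ j) x) v"
  shows "M \<in> matrix_module Q"
proof -
  define \<epsilon> where "\<epsilon> = \<eta> / real CARD('p)"
  have \<epsilon>: "\<epsilon> > 0" using \<eta> by (simp add: \<epsilon>_def)
  have "\<forall>\<^sub>F D in sequentially. D > 0 \<and> (\<forall>i j.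
      M $ i $ j = (\<Sum>\<kappa>\<in>PiE UNIV (\<lambda>_. {..D}). Const (bernstein_coeff R (M $ i $ j) D \<kappa>) * bernstein_basis R D \<kappa>) \<and>
      (\<forall>\<kappa>. (\<forall>i. \<kappa> i \<le> D) \<longrightarrow>
        \<bar>bernstein_coeff R (M $ i $ j) D \<kappa> - eval_x (M $ i $ j) (bernstein_node R D \<kappa>)\<bar> < \<epsilon>))"
    by (intro eventually_conj eventually_all_finite eventually_gt_at_top
        bernstein_coeff_approx[OF R \<epsilon>])
  then obtain D where D: "D > 0"
    "\<And>i j. M $ i $ j = (\<Sum>\<kappa>\<in>PiE UNIV (\<lambda>_. {..D}). Const (bernstein_coeff R (M $ i $ j) D \<kappa>) * bernstein_basis R D \<kappa>)"
    "\<And>i j \<kappa>. (\<forall>i. \<kappa> i \<le> D) \<Longrightarrow>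
        \<bar>bernstein_coeff R (M $ i $ j) D \<kappa> - eval_x (M $ i $ j) (bernstein_node R D \<kappa>)\<bar> < \<epsilon>"
    by (auto simp: eventually_sequentially)
  define N where "N \<kappa> = (\<chi> i j. Const (bernstein_coeff R (M $ i $ j) D \<kappa>) * bernstein_basis R D \<kappa>)" for \<kappa>
  have N_mem: "N \<kappa> \<in> matrix_module Q" if \<kappa>: "\<forall>i. \<kappa> i \<le> D" for \<kappa>
    unfolding N_def
  proof (rule psd_mult_in_matrix_module)
    show "bernstein_basis R D \<kappa> \<in> Q" by (rule bernstein_basis_mem[OF Q R ball])
    show "bernstein_coeff R (M $ i $ j) D \<kappa> = bernstein_coeff R (M $ j $ i) D \<kappa>" for i j
      by (simp add: sym[of i j])
    fix v :: "'p \<Rightarrow> real"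
    let ?x = "bernstein_node R D \<kappa>"
    have "?x \<in> coordinate_box R"
    proof -
      have "\<bar>R * (2 * (real (\<kappa> i) / real D) - 1)\<bar> \<le> R * 1" for i
      proof -
        have "0 \<le> real (\<kappa> i) / real D" "real (\<kappa> i) / real D \<le> 1"
          using \<kappa> D(1) by (auto simp: divide_le_eq)
        then have "\<bar>2 * (real (\<kappa> i) / real D) - 1\<bar> \<le> 1" by (intro abs_leI) linarith+
        then have "R * \<bar>2 * (real (\<kappa> i) / real D) - 1\<bar> \<le> R * 1"
          using R by (intro mult_left_mono) auto
        then show ?thesis unfolding abs_mult using R by simp
      qed
      then show ?thesis by (simp add: coordinate_box_def bernstein_node_def)
    qed
    from pos[OF this, of v]
    have "\<eta> * (\<Sum>i\<in>UNIV. (v i)\<^sup>2) \<le> quad_form (\<lambda>i j. eval_x (M $ i $ j) ?x) v" .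
    moreover have "\<bar>quad_form (\<lambda>i j. bernstein_coeff R (M $ i $ j) D \<kappa>) v - quad_form (\<lambda>i j. eval_x (M $ i $ j) ?x) v\<bar>
        \<le> \<epsilon> * real CARD('p) * (\<Sum>i\<in>UNIV. (v i)\<^sup>2)"
      using D(3)[OF \<kappa>] by (intro quad_form_perturb less_imp_le)
    moreover have "\<epsilon> * real CARD('p) = \<eta>" by (simp add: \<epsilon>_def)
    ultimately show "quad_form (\<lambda>i j. bernstein_coeff R (M $ i $ j) D \<kappa>) v \<ge> 0" by simp
  qed
  have "M = (\<Sum>\<kappa>\<in>PiE UNIV (\<lambda>_. {..D}). N \<kappa>)"
    unfolding vec_eq_iff sum_component N_def using D(2) by simp
  also have "\<dots> \<in> matrix_module Q"
    by (intro matrix_module_sum N_mem) (auto simp: PiE_iff)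
  finally show ?thesis .
qed

text \<open>
  By Bernoulli's inequality \<open>(1 + 2 k z) (1 - z)\<^sup>2\<^sup>k \<le> (1 - z\<^sup>2)\<^sup>2\<^sup>k \<le> 1\<close> for \<open>0 \<le> z \<le> 1\<close>. So subtracting
  \<open>(z - 1)\<^sup>2\<^sup>k z\<close> does little harm where \<open>z\<close> is nonnegative, whereas it adds at least \<open>\<bar>z\<bar>\<close> where \<open>z\<close> is
  negative.
\<close>

lemma mult_one_minus_power_le:
  fixes z :: real
  assumes "z \<le> 1"
  shows "(z - 1) ^ (2 * k) * z \<le> 1 / real (2 * k + 1)"
proof (cases "z \<le> 0")
  case True
  then have "(z - 1) ^ (2 * k) * z \<le> 0" by (intro mult_nonneg_nonpos) (auto simp: zero_le_even_power)
  then show ?thesis by (rule order_trans) simp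
next
  case False
  have "(1 + real (2 * k) * z) * (1 - z) ^ (2 * k) \<le> (1 + z) ^ (2 * k) * (1 - z) ^ (2 * k)"
    using False assms by (intro mult_right_mono Bernoulli_inequality) auto
  also have "\<dots> = (1 - z\<^sup>2) ^ (2 * k)"
    by (simp add: power_mult_distrib[symmetric] power2_eq_square algebra_simps)
  also have "\<dots> \<le> 1" using False assms by (intro power_le_one) (auto simp: power_le_one)
  finally have 1: "(1 + real (2 * k) * z) * (1 - z) ^ (2 * k) \<le> 1" .
  have "(real (2 * k + 1) * z) * (1 - z) ^ (2 * k) \<le> (1 + real (2 * k) * z) * (1 - z) ^ (2 * k)"
    using False assms by (intro mult_right_mono) (auto simp: algebra_simps)
  then have "(real (2 * k + 1) * z) * (1 - z) ^ (2 * k) \<le> 1" using 1 by linarith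
  moreover have "(z - 1) ^ (2 * k) = (1 - z) ^ (2 * k)"
    by (simp add: power_mult power2_commute)
  ultimately show ?thesis by (simp add: le_divide_eq ac_simps)
qed

lemma continuous_on_eval_x: "continuous_on S (\<lambda>x. eval_x f x)"
  using continuous_real_polymonial_function[OF real_polynomial_function_eval_x[of f]]
  by (intro continuous_at_imp_continuous_on) auto

lemma compact_coordinate_box: "compact (coordinate_box R :: (real^'n::finite) set)"
proof -
  have "coordinate_box R = cbox (\<chi> i. - R) ((\<chi> i. R) :: real^'n)"
    by (auto simp: coordinate_box_def mem_box_cart abs_le_iff) (metis minus_le_iff)+
  then show ?thesis by simp
qed

definition eval_form :: "'n::finite xpoly^'p::finite^'p \<Rightarrow> real^'n \<Rightarrow> real^'p \<Rightarrow> real" where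
  "eval_form M x v = quad_form (\<lambda>i j. eval_x (M $ i $ j) x) (\<lambda>i. v $ i)"

lemma eval_form_eq_inner: "eval_form M x v = v \<bullet> (meval_x M x *v v)"
  by (simp add: eval_form_def quad_form_def inner_vec_def matrix_vector_mult_def meval_x_def
      sum_distrib_left mult.assoc)

lemma continuous_on_eval_form: "continuous_on S (\<lambda>z. eval_form M (fst z) (snd z))"
  unfolding eval_form_def quad_form_def
  by (intro continuous_intros continuous_on_compose2[OF continuous_on_eval_x[of UNIV]]) auto

text \<open>
  Compactness of the product of the box with the unit sphere: every \<open>(x, v)\<close> in it lies in the open
  set where the quadratic form of \<open>M\<close> is positive or in one where some \<open>g \<in> Q\<close> is negative.
  The positive parts for a finite subcover have a sum that is bounded below on the compact set.
\<close>

lemma finite_negativity_cover: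
  fixes Q :: "'n::finite xpoly set" and M :: "'n xpoly^'p::finite^'p"
  assumes pos: "\<And>x v. (\<And>g. g \<in> Q \<Longrightarrow> eval_x g x \<ge> 0) \<Longrightarrow> v \<noteq> 0 \<Longrightarrow> eval_form M x v > 0"
  obtains F \<delta> where "finite F" "F \<subseteq> Q" "\<delta> > 0"
    "\<And>x v. x \<in> coordinate_box R \<Longrightarrow> norm v = 1 \<Longrightarrow> eval_form M x v \<ge> \<delta> \<or> (\<exists>g\<in>F. eval_x g x \<le> - \<delta>)"
proof -
  define K where "K = (coordinate_box R :: (real^'n) set) \<times> (sphere 0 1 :: (real^'p) set)"
  have K: "compact K" unfolding K_def by (intro compact_Times compact_coordinate_box compact_sphere)
  define f where "f = case_option (\<lambda>z. eval_form M (fst z) (snd z)) (\<lambda>g z. - eval_x g (fst z))"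
  have f_cont: "continuous_on UNIV (f a)" for a
    unfolding f_def
    by (cases a) (auto intro!: continuous_on_eval_form continuous_intros
        continuous_on_compose2[OF continuous_on_eval_x[of UNIV]])
  have cover: "K \<subseteq> (\<Union>a\<in>insert None (Some ` Q). {z. 0 < f a z})"
  proof
    fix z assume "z \<in> K"
    then have "snd z \<noteq> 0" by (auto simp: K_def)
    then show "z \<in> (\<Union>a\<in>insert None (Some ` Q). {z. 0 < f a z})"
      using pos[of "fst z" "snd z"] by (force simp: f_def not_le)
  qed
  have opens: "open {z. 0 < f a z}" for a
    using open_Collect_less[OF continuous_on_const f_cont] .
  obtain C where C: "C \<subseteq> insert None (Some ` Q)" "finite C" "K \<subseteq> (\<Union>a\<in>C. {z. 0 < f a z})"
    by (rule compactE_image[OF K opens cover])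
  define \<Phi> where "\<Phi> z = (\<Sum>a\<in>C. max 0 (f a z))" for z
  define F where "F = {g. Some g \<in> C}"
  have F: "finite F" "F \<subseteq> Q"
  proof -
    have "Some ` F \<subseteq> C" by (auto simp: F_def)
    then show "finite F" by (rule finite_imageD[OF finite_subset[OF _ C(2)]]) simp
    show "F \<subseteq> Q" using C(1) by (auto simp: F_def)
  qed
  have "\<exists>m>0. \<forall>z\<in>K. m \<le> \<Phi> z"
  proof (cases "K = {}")
    case True
    then show ?thesis by (intro exI[of _ 1]) auto
  next
    case False
    have "continuous_on K \<Phi>"
      unfolding \<Phi>_def by (intro continuous_intros continuous_on_subset[OF f_cont]) auto
    then obtain z0 where z0: "z0 \<in> K" "\<And>z. z \<in> K \<Longrightarrow> \<Phi> z0 \<le> \<Phi> z"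
      using continuous_attains_inf[OF K False] by blast
    obtain a where "a \<in> C" "0 < f a z0" using C(3) z0(1) by blast
    then have "0 < \<Phi> z0" unfolding \<Phi>_def using C(2) by (intro sum_pos2[of C a]) auto
    then show ?thesis using z0(2) by blast
  qed
  then obtain m where m: "m > 0" "\<And>z. z \<in> K \<Longrightarrow> m \<le> \<Phi> z" by blast
  \<comment> \<open>A sum of \<open>card C\<close> nonnegative terms that is at least \<open>m\<close> has a term of at least \<open>\<delta>\<close>; adding \<open>1\<close> covers \<open>C = {}\<close>.\<close>
  define \<delta> where "\<delta> = m / (real (card C) + 1)"
  have \<delta>: "\<delta> > 0" using m(1) by (simp add: \<delta>_def)
  have "eval_form M x v \<ge> \<delta> \<or> (\<exists>g\<in>F. eval_x g x \<le> - \<delta>)" if "x \<in> coordinate_box R" "norm v = 1" for x v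
  proof -
    have "\<exists>a\<in>C. \<delta> \<le> f a (x, v)"
    proof (rule ccontr)
      assume "\<not> ?thesis"
      then have "\<Phi> (x, v) \<le> (\<Sum>a\<in>C. \<delta>)"
        unfolding \<Phi>_def using \<delta> by (intro sum_mono) (auto simp: not_le less_imp_le)
      also have "\<dots> < m" using m(1) by (simp add: \<delta>_def field_simps)
      finally show False using m(2)[of "(x, v)"] that by (simp add: K_def)
    qed
    then obtain a where "a \<in> C" "\<delta> \<le> f a (x, v)" by blast
    then show ?thesis by (cases a) (auto simp: f_def F_def intro!: bexI)
  qed
  then show ?thesis using that F \<delta> by blast
qed

text \<open>
  With finitely many certificates \<open>g\<close>, scaled to \<open>\<bar>g\<bar> \<le> 1\<close> on the box, subtract \<open>c \<Sum> (g - 1)\<^sup>2\<^sup>k g\<close> times the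
  identity from \<open>M\<close>. Where the form of \<open>M\<close> is at least \<open>\<delta>\<close>, this costs at most \<open>\<delta> / 2\<close> if \<open>k\<close> is large.
  Elsewhere some \<open>g\<close> is negative, and a large \<open>c\<close> compensates the negativity of \<open>M\<close>. The result is
  positive definite on the box, and what was subtracted lies in the module.
\<close>

theorem matrix_positivstellensatz:
  fixes Q :: "'n::finite xpoly set" and M :: "'n xpoly^'p::finite^'p"
  assumes Q: "quadratic_module Q"
    and archimedean: "Const C - (\<Sum>i\<in>UNIV. (Var i)\<^sup>2) \<in> Q"
    and sym: "M \<in> symmetric_matrices"
    and pos: "\<And>x. (\<And>g. g \<in> Q \<Longrightarrow> eval_x g x \<ge> 0) \<Longrightarrow> pd (meval_x M x)"
  shows "M \<in> matrix_module Q"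
proof -
  interpret quadratic_module Q by (rule Q)
  define R where "R = sqrt (\<bar>C\<bar> + 1)"
  have R: "R > 0" by (simp add: R_def)
  have ball: "Const (R\<^sup>2) - (\<Sum>i\<in>UNIV. (Var i)\<^sup>2) \<in> Q"
  proof -
    have "Const (R\<^sup>2) - (\<Sum>i\<in>UNIV. (Var i)\<^sup>2)
        = Const (\<bar>C\<bar> + 1 - C) * 1 + (Const C - (\<Sum>i\<in>UNIV. (Var i :: 'n xpoly)\<^sup>2))"
    proof -
      have "Const (R\<^sup>2) = Const (\<bar>C\<bar> + 1 - C) + Const C"
        by (simp add: R_def Const_hom.hom_add[symmetric])
      then show ?thesis by simp
    qed
    also have "\<dots> \<in> Q" by (intro add_mem archimedean Const_mult_mem[OF Q one_mem]) simp
    finally show ?thesis .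
  qed
  have sym': "M $ i $ j = M $ j $ i" for i j
    using sym by (auto simp: symmetric_matrices_def transpose_def vec_eq_iff)
  obtain F \<delta> where F: "finite F" "F \<subseteq> Q" and \<delta>: "\<delta> > 0"
    and cert: "\<And>x v. x \<in> coordinate_box R \<Longrightarrow> norm v = 1 \<Longrightarrow>
      eval_form M x v \<ge> \<delta> \<or> (\<exists>g\<in>F. eval_x g x \<le> - \<delta>)"
    using pos finite_negativity_cover[of Q M R] unfolding pd_def eval_form_eq_inner by metis
  obtain L where L: "L > 0" "\<And>g x. g \<in> F \<Longrightarrow> x \<in> coordinate_box R \<Longrightarrow> \<bar>eval_x g x\<bar> \<le> L"
  proof -
    have "bounded (\<Union>g\<in>F. eval_x g ` coordinate_box R)"
      using F(1) compact_imp_bounded[OF compact_continuous_image[OF continuous_on_eval_x compact_coordinate_box]]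
      by (intro bounded_UN) auto
    then show ?thesis using that unfolding bounded_pos by fastforce
  qed
  obtain W where W: "W > 0" "\<And>x v. x \<in> coordinate_box R \<Longrightarrow> norm v = 1 \<Longrightarrow> \<bar>eval_form M x v\<bar> \<le> W"
  proof -
    have "bounded ((\<lambda>z. eval_form M (fst z) (snd z)) ` (coordinate_box R \<times> sphere 0 1))"
      by (intro compact_imp_bounded compact_continuous_image continuous_on_eval_form
          compact_Times compact_coordinate_box compact_sphere)
    then show ?thesis using that unfolding bounded_pos by (fastforce simp: image_iff)
  qed
  \<comment> \<open>A certificate that is at most \<open>-\<delta> / L\<close> after scaling then contributes at least \<open>W + \<delta>\<close>.\<close>
  define c where "c = (W + \<delta>) * L / \<delta>"
  have c: "c > 0" using W(1) \<delta> L(1) by (simp add: c_def)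
  obtain k :: nat where k: "c * real (card F) / (\<delta> / 2) \<le> real k" using real_arch_simple by blast
  have small: "c * (real (card F) / real (2 * k + 1)) \<le> \<delta> / 2"
  proof -
    have "c * real (card F) \<le> real k * (\<delta> / 2)" using k \<delta> by (simp add: field_simps)
    also have "\<dots> \<le> real (2 * k + 1) * (\<delta> / 2)" using \<delta> by (intro mult_right_mono) auto
    finally show ?thesis by (simp add: divide_le_eq mult.commute)
  qed
  define h where "h g = Const (1 / L) * g" for g :: "'n xpoly"
  define \<psi> where "\<psi> g = ((h g - 1) ^ k)\<^sup>2 * h g" for g
  have \<psi>_mem: "\<psi> g \<in> Q" if "g \<in> F" for g
    unfolding \<psi>_def h_def using that F(2) L(1)
    by (intro square_mult_mem Const_mult_mem[OF Q]) auto
  define P where "P = Const c * (\<Sum>g\<in>F. \<psi> g)"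
  have P_mem: "P \<in> Q" unfolding P_def using c by (intro Const_mult_mem[OF Q] sum_mem \<psi>_mem) auto
  define E where "E = (\<chi> i j. Const (if i = j then 1 else 0) * P :: 'n xpoly^'p^'p)"
  have E_mem: "E \<in> matrix_module Q"
    unfolding E_def
  proof (rule psd_mult_in_matrix_module[OF P_mem])
    fix v :: "'p \<Rightarrow> real"
    have "quad_form (\<lambda>i j. if i = j then 1 else 0) v = (\<Sum>i\<in>UNIV. v i * v i)"
      unfolding quad_form_def
      by (intro sum.cong refl) (simp add: if_distrib[of "\<lambda>x. x * _"] if_distrib[of "\<lambda>x. _ * x"] cong: if_cong)
    then show "quad_form (\<lambda>i j. if i = j then 1 else 0) v \<ge> 0" by (simp add: sum_nonneg)
  qed auto
  define \<phi> where "\<phi> z = (z - 1) ^ (2 * k) * z" for z :: real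
  have eval_P: "eval_x P x = c * (\<Sum>g\<in>F. \<phi> (eval_x g x / L))" for x
    by (simp add: \<phi>_def P_def \<psi>_def h_def power_mult[symmetric] mult.commute)
  have lower: "\<delta> / 2 \<le> eval_form M x v - eval_x P x" if x: "x \<in> coordinate_box R" and v: "norm v = 1" for x v
  proof -
    have le_1: "eval_x g x / L \<le> 1" if "g \<in> F" for g
      using L(2)[OF that x] L(1) by (simp add: divide_le_eq)
    have term_le: "\<phi> (eval_x g x / L) \<le> 1 / real (2 * k + 1)" if "g \<in> F" for g
      unfolding \<phi>_def by (rule mult_one_minus_power_le[OF le_1[OF that]])
    have sum_le: "(\<Sum>g\<in>G. \<phi> (eval_x g x / L)) \<le> real (card F) / real (2 * k + 1)"
      if "G \<subseteq> F" for G
    proof -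
      have "(\<Sum>g\<in>G. \<phi> (eval_x g x / L)) \<le> (\<Sum>g\<in>G. 1 / real (2 * k + 1))"
        using that by (intro sum_mono term_le) auto
      also have "\<dots> = real (card G) / real (2 * k + 1)" by simp
      also have "\<dots> \<le> real (card F) / real (2 * k + 1)"
        using card_mono[OF F(1) that] by (intro divide_right_mono) auto
      finally show ?thesis .
    qed
    from cert[OF x v] show ?thesis
    proof
      assume "eval_form M x v \<ge> \<delta>"
      moreover have "eval_x P x \<le> c * (real (card F) / real (2 * k + 1))"
        unfolding eval_P using sum_le[of F] c by (intro mult_left_mono) auto
      ultimately show ?thesis using small by linarith
    next
      assume "\<exists>g\<in>F. eval_x g x \<le> - \<delta>"
      then obtain g where g: "g \<in> F" "eval_x g x \<le> - \<delta>" by blast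
      have neg: "eval_x g x / L \<le> - (\<delta> / L)" using g(2) L(1) by (simp add: divide_le_eq)
      have dL: "\<delta> / L > 0" using \<delta> L(1) by simp
      have "1 \<le> (1 - eval_x g x / L) ^ (2 * k)" using neg dL by (intro one_le_power) linarith
      also have "\<dots> = (eval_x g x / L - 1) ^ (2 * k)" by (simp add: power_mult power2_commute)
      finally have "\<phi> (eval_x g x / L) \<le> 1 * (eval_x g x / L)"
        unfolding \<phi>_def using neg dL by (intro mult_right_mono_neg) auto
      then have g_term: "\<phi> (eval_x g x / L) \<le> - (\<delta> / L)" using neg by simp
      have "(\<Sum>g\<in>F. \<phi> (eval_x g x / L))
          \<le> - (\<delta> / L) + real (card F) / real (2 * k + 1)"
        using g_term sum_le[of "F - {g}"] by (subst sum.remove[OF F(1) g(1)]) auto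
      then have "eval_x P x \<le> c * (- (\<delta> / L) + real (card F) / real (2 * k + 1))"
        unfolding eval_P using c by (intro mult_left_mono) auto
      also have "\<dots> = - (W + \<delta>) + c * (real (card F) / real (2 * k + 1))"
      proof -
        have "c * (\<delta> / L) = W + \<delta>" using \<delta> L(1) by (simp add: c_def)
        then show ?thesis by (simp only: distrib_left mult_minus_right)
      qed
      finally have "eval_x P x \<le> - (W + \<delta>) + \<delta> / 2" using small by linarith
      moreover have "- W \<le> eval_form M x v" using W(2)[OF x v] by linarith
      ultimately show ?thesis using \<delta> by linarith
    qed
  qed
  have "M - E \<in> matrix_module Q"
  proof (rule matrix_positive_on_box[OF Q R ball])
    show "(M - E) $ i $ j = (M - E) $ j $ i" for i j
      using sym'[of i j] by (simp add: E_def)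
    show "\<delta> / 2 > 0" using \<delta> by simp
    fix x :: "real^'n" and v :: "'p \<Rightarrow> real"
    assume x: "x \<in> coordinate_box R"
    have quad_E: "quad_form (\<lambda>i j. eval_x ((M - E) $ i $ j) x) v
        = quad_form (\<lambda>i j. eval_x (M $ i $ j) x) v - eval_x P x * (\<Sum>i\<in>UNIV. (v i)\<^sup>2)" for v
    proof -
      have "(\<Sum>i\<in>UNIV. \<Sum>j\<in>UNIV. v i * ((if i = j then 1 else 0) * eval_x P x) * v j)
          = eval_x P x * (\<Sum>i\<in>UNIV. (v i)\<^sup>2)"
        unfolding sum_distrib_left
        by (intro sum.cong refl)
          (simp add: if_distrib[of "\<lambda>x. x * _"] if_distrib[of "\<lambda>x. _ * x"] power2_eq_square cong: if_cong)
      then show ?thesis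
        by (simp add: quad_form_def E_def left_diff_distrib right_diff_distrib sum_subtractf)
    qed
    define V where "V = (\<chi> i. v i)"
    have V: "(\<Sum>i\<in>UNIV. (v i)\<^sup>2) = (norm V)\<^sup>2"
      unfolding power2_norm_eq_inner by (simp add: V_def inner_vec_def power2_eq_square)
    have quad_M: "quad_form (\<lambda>i j. eval_x (M $ i $ j) x) v = eval_form M x V" by (simp add: eval_form_def V_def)
    have "\<delta> / 2 * (norm V)\<^sup>2 \<le> eval_form M x V - eval_x P x * (norm V)\<^sup>2"
    proof (cases "V = 0")
      case True
      then show ?thesis by (simp add: eval_form_def quad_form_def)
    next
      case False
      then have "norm (V /\<^sub>R norm V) = 1" by simp
      from lower[OF x this]
      have "(norm V)\<^sup>2 * (\<delta> / 2) \<le> (norm V)\<^sup>2 * (eval_form M x (V /\<^sub>R norm V) - eval_x P x)"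
        by (intro mult_left_mono) auto
      moreover have "(norm V)\<^sup>2 * eval_form M x (V /\<^sub>R norm V) = eval_form M x V"
        unfolding eval_form_def quad_form_def sum_distrib_left using False
        by (intro sum.cong refl) (simp add: field_simps power2_eq_square)
      ultimately show ?thesis by (simp add: right_diff_distrib mult.commute)
    qed
    then show "\<delta> / 2 * (\<Sum>i\<in>UNIV. (v i)\<^sup>2) \<le> quad_form (\<lambda>i j. eval_x ((M - E) $ i $ j) x) v"
      unfolding quad_E V quad_M .
  qed
  then have "(M - E) + E \<in> matrix_module Q" by (intro matrix_module.add E_mem)
  then show ?thesis by simp
qed

section \<open>The moment relaxation\<close>

lemma sum_append:
  fixes f g :: "nat \<Rightarrow> 'a::comm_monoid_add"
  shows "(\<Sum>k<l + l'. if k < l then f k else g (k - l)) = (\<Sum>k<l. f k) + (\<Sum>k<l'. g k)"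
proof (induction l')
  case 0
  show ?case by (auto intro: sum.cong)
qed (simp add: add.assoc)

lemma sos_polys_zero: "0 \<in> sos_polys"
  unfolding sos_polys_def by (rule CollectI, rule exI[of _ 0]) auto

lemma sos_polys_square: "p\<^sup>2 \<in> sos_polys"
  unfolding sos_polys_def by (rule CollectI, rule exI[of _ 1], rule exI[of _ "\<lambda>_. p"]) auto

lemma sos_polys_add:
  assumes "p \<in> sos_polys" "q \<in> sos_polys" shows "p + q \<in> sos_polys"
proof -
  obtain l f l' g where "p = (\<Sum>k<l::nat. (f k)\<^sup>2)" "q = (\<Sum>k<l'::nat. (g k)\<^sup>2)"
    using assms unfolding sos_polys_def by blast
  then have "p + q = (\<Sum>k<l + l'. (if k < l then f k else g (k - l))\<^sup>2)"
    by (simp only: sum_append[symmetric] if_distrib[of "\<lambda>x. x\<^sup>2"])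
  then show ?thesis
    unfolding sos_polys_def
    by (intro CollectI exI[of _ "l + l'"] exI[of _ "\<lambda>k. if k < l then f k else g (k - l)"]) simp
qed

lemma sos_polys_square_mult:
  assumes "q \<in> sos_polys" shows "p\<^sup>2 * q \<in> sos_polys"
proof -
  obtain l f where "q = (\<Sum>k<l::nat. (f k)\<^sup>2)"
    using assms unfolding sos_polys_def by blast
  then have "p\<^sup>2 * q = (\<Sum>k<l. (p * f k)\<^sup>2)"
    by (simp add: sum_distrib_left power_mult_distrib)
  then show ?thesis unfolding sos_polys_def by (intro CollectI exI[of _ l] exI[of _ "\<lambda>k. p * f k"]) simp
qed

lemma sos_matrices_zero: "0 \<in> sos_matrices"
  unfolding sos_matrices_def by (rule CollectI, rule exI[of _ 0]) (auto simp: vec_eq_iff)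

lemma sos_matrices_rank_one: "(\<chi> i j. t i * t j) \<in> sos_matrices"
  unfolding sos_matrices_def
  by (rule CollectI, rule exI[of _ 1], rule exI[of _ "\<lambda>_. t"]) (auto simp: vec_eq_iff)

lemma sos_matrices_add:
  assumes "S \<in> sos_matrices" "S' \<in> sos_matrices" shows "S + S' \<in> sos_matrices"
proof -
  obtain l T l' T' where S: "S = (\<chi> i j. \<Sum>k<l::nat. T k i * T k j)"
    and S': "S' = (\<chi> i j. \<Sum>k<l'::nat. T' k i * T' k j)"
    using assms unfolding sos_matrices_def by blast
  define U where "U k = (if k < l then T k else T' (k - l))" for k
  have "S $ i $ j + S' $ i $ j = (\<Sum>k<l + l'. U k i * U k j)" for i j
  proof -
    have "S $ i $ j + S' $ i $ j
        = (\<Sum>k<l + l'. if k < l then T k i * T k j else T' (k - l) i * T' (k - l) j)"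
      using sum_append[where f = "\<lambda>k. T k i * T k j" and g = "\<lambda>k. T' k i * T' k j" and l = l and l' = l']
      by (simp add: S S')
    also have "\<dots> = (\<Sum>k<l + l'. U k i * U k j)" by (intro sum.cong) (auto simp: U_def)
    finally show ?thesis .
  qed
  then have "S + S' = (\<chi> i j. \<Sum>k<l + l'. U k i * U k j)" by (simp add: vec_eq_iff)
  then show ?thesis unfolding sos_matrices_def by blast
qed

text \<open>
  The index map \<open>r\<close> covers both multiplication of an SOS matrix by a square (\<open>r\<close> the identity) and the
  Kronecker product of \<open>t t\<^sup>T\<close> with an SOS matrix (\<open>r\<close> the second component of an index pair).
\<close>

lemma sos_matrices_scale:
  fixes S :: "'a::comm_semiring_0^'q::finite^'q" and r :: "'p::finite \<Rightarrow> 'q" and t :: "'p \<Rightarrow> 'a"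
  assumes "S \<in> sos_matrices"
  shows "(\<chi> a b. t a * t b * S $ r a $ r b) \<in> sos_matrices"
proof -
  obtain l T where S: "S = (\<chi> i j. \<Sum>k<l::nat. T k i * T k j)"
    using assms unfolding sos_matrices_def by blast
  have "(\<chi> a b. t a * t b * S $ r a $ r b) = (\<chi> a b. \<Sum>k<l. (t a * T k (r a)) * (t b * T k (r b)))"
    by (simp add: vec_eq_iff S sum_distrib_left ac_simps)
  then show ?thesis
    unfolding sos_matrices_def by (intro CollectI exI[of _ l] exI[of _ "\<lambda>k a. t a * T k (r a)"]) simp
qed

lemma sum_UNIV_pair:
  fixes f :: "'p::finite \<times> 'q::finite \<Rightarrow> 'a::comm_monoid_add"
  shows "(\<Sum>a\<in>UNIV. f a) = (\<Sum>i\<in>UNIV. \<Sum>k\<in>UNIV. f (i, k))"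
  by (simp add: sum.cartesian_product UNIV_Times_UNIV[symmetric] del: UNIV_Times_UNIV)

lemma trace_transpose_mult:
  fixes S G :: "'a::semiring_1^'q::finite^'q"
  shows "trace (transpose S ** G) = (\<Sum>k\<in>UNIV. \<Sum>b\<in>UNIV. S $ b $ k * G $ b $ k)"
  by (simp add: trace_def matrix_matrix_mult_def transpose_def)

lemma block_inner_nth:
  fixes A :: "'a::semiring_1^('p::finite \<times> 'q::finite)^('p \<times> 'q)"
  shows "block_inner A B $ i $ j = (\<Sum>k\<in>UNIV. \<Sum>b\<in>UNIV. A $ (j, b) $ (i, k) * B $ b $ k)"
proof -
  have "(\<Sum>a\<in>UNIV. \<Sum>b\<in>UNIV. A $ (a, b) $ (i, k) * ((if a = j then 1 else 0) * B $ b $ k))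
      = (\<Sum>b\<in>UNIV. A $ (j, b) $ (i, k) * B $ b $ k)" for k
  proof -
    have "(\<Sum>a\<in>UNIV. \<Sum>b\<in>UNIV. A $ (a, b) $ (i, k) * ((if a = j then 1 else 0) * B $ b $ k))
        = (\<Sum>a\<in>UNIV. if a = j then (\<Sum>b\<in>UNIV. A $ (a, b) $ (i, k) * B $ b $ k) else 0)"
      by (intro sum.cong) auto
    then show ?thesis by simp
  qed
  then show ?thesis
    by (simp add: block_inner_def partial_trace_def trace_def matrix_matrix_mult_def
        transpose_def kronecker_def mat_def sum_UNIV_pair)
qed

lemma quadratic_module_quad_module:
  fixes G :: "('n, 'm::finite) xypoly^'q::finite^'q"
  shows "quadratic_module (quad_module Y \<nu> G)"
proof
  have mem: "\<sigma> + integral_y Y \<nu> (trace (transpose S ** G)) \<in> quad_module Y \<nu> G"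
    if "\<sigma> \<in> sos_polys" "S \<in> sos_matrices" for \<sigma> S
    using that unfolding quad_module_def by blast
  show "1 \<in> quad_module Y \<nu> G"
    using mem[OF sos_polys_square[of 1] sos_matrices_zero] by (simp add: trace_transpose_mult)
  fix p q :: "'n xpoly"
  assume "p \<in> quad_module Y \<nu> G"
  then obtain \<sigma> S where p: "p = \<sigma> + integral_y Y \<nu> (trace (transpose S ** G))"
    "\<sigma> \<in> sos_polys" "S \<in> sos_matrices"
    unfolding quad_module_def by blast
  show "q\<^sup>2 * p \<in> quad_module Y \<nu> G"
  proof -
    let ?S = "\<chi> a b. embed_x q * embed_x q * S $ a $ b"
    have "trace (transpose ?S ** G) = embed_x (q\<^sup>2) * trace (transpose S ** G)"
      by (simp add: trace_transpose_mult sum_distrib_left embed_x_mult power2_eq_square mult.assoc)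
    then have "q\<^sup>2 * p = q\<^sup>2 * \<sigma> + integral_y Y \<nu> (trace (transpose ?S ** G))"
      by (simp add: p(1) distrib_left integral_y_embed_x_mult)
    also have "\<dots> \<in> quad_module Y \<nu> G"
      using p(2,3) by (intro mem sos_polys_square_mult sos_matrices_scale[where r = "\<lambda>a. a"])
    finally show ?thesis .
  qed
  assume "q \<in> quad_module Y \<nu> G"
  then obtain \<sigma>' S' where q: "q = \<sigma>' + integral_y Y \<nu> (trace (transpose S' ** G))"
    "\<sigma>' \<in> sos_polys" "S' \<in> sos_matrices"
    unfolding quad_module_def by blast
  have "trace (transpose (S + S') ** G) = trace (transpose S ** G) + trace (transpose S' ** G)"
    by (simp add: trace_transpose_mult distrib_right sum.distrib)
  then have "p + q = (\<sigma> + \<sigma>') + integral_y Y \<nu> (trace (transpose (S + S') ** G))"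
    by (simp add: p(1) q(1) integral_y_add)
  also have "\<dots> \<in> quad_module Y \<nu> G"
    using p q by (intro mem sos_polys_add sos_matrices_add)
  finally show "p + q \<in> quad_module Y \<nu> G" .
qed

definition matrix_quad_module ::
    "(real^'m::finite) set \<Rightarrow> (real^'m) measure \<Rightarrow> ('n, 'm) xypoly^'q^'q \<Rightarrow> ('n xpoly^'p^'p) set" where
  "matrix_quad_module Y \<nu> G =
     {S\<^sub>0 + mintegral_y Y \<nu> (block_inner S G) | S\<^sub>0 S. S\<^sub>0 \<in> sos_matrices \<and> S \<in> sos_matrices}"

text \<open>
  For \<open>g = \<sigma> + \<integral> tr (S\<^sup>T G) d\<nu>\<close> the matrix \<open>g t t\<^sup>T\<close> is represented by \<open>\<sigma> t t\<^sup>T\<close> and the Kronecker product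
  of \<open>t t\<^sup>T\<close> with \<open>S\<close>.
\<close>

lemma matrix_module_subset_matrix_quad_module:
  fixes G :: "('n, 'm::finite) xypoly^'q::finite^'q"
  assumes "M \<in> matrix_module (quad_module Y \<nu> G)"
  shows "(M :: 'n xpoly^'p::finite^'p) \<in> matrix_quad_module Y \<nu> G"
  using assms
proof induction
  case zero
  have "mintegral_y Y \<nu> (block_inner 0 G) = 0"
    by (simp add: vec_eq_iff mintegral_y_def block_inner_nth)
  then show ?case
    unfolding matrix_quad_module_def
    by (intro CollectI exI[of _ 0]) (simp add: sos_matrices_zero)
next
  case (rank_one g t)
  then obtain \<sigma> S where g: "g = \<sigma> + integral_y Y \<nu> (trace (transpose S ** G))"
    "\<sigma> \<in> sos_polys" "S \<in> sos_matrices"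
    unfolding quad_module_def by blast
  define S\<^sub>0 where "S\<^sub>0 = (\<chi> i j. Const (t i) * Const (t j) * \<sigma>)"
  define S' where "S' = (\<chi> a b. embed_x (Const (t (fst a))) * embed_x (Const (t (fst b))) * S $ snd a $ snd b)"
  have "S\<^sub>0 \<in> sos_matrices"
  proof -
    obtain l f where \<sigma>: "\<sigma> = (\<Sum>k<l::nat. (f k)\<^sup>2)" using g(2) unfolding sos_polys_def by blast
    have "S\<^sub>0 = (\<chi> i j. \<Sum>k<l. (Const (t i) * f k) * (Const (t j) * f k))"
      by (simp add: S\<^sub>0_def \<sigma> vec_eq_iff sum_distrib_left power2_eq_square ac_simps)
    then show ?thesis
      unfolding sos_matrices_def by (intro CollectI exI[of _ l] exI[of _ "\<lambda>k i. Const (t i) * f k"]) simp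
  qed
  moreover have "S' \<in> sos_matrices"
    unfolding S'_def by (rule sos_matrices_scale[OF g(3)])
  moreover have "(\<chi> i j. Const (t i * t j) * g) = S\<^sub>0 + mintegral_y Y \<nu> (block_inner S' G)"
  proof -
    have "block_inner S' G $ i $ j = embed_x (Const (t i * t j)) * trace (transpose S ** G)" for i j
      unfolding block_inner_nth trace_transpose_mult S'_def Const_hom.hom_mult embed_x_mult
      by (simp add: sum_distrib_left ac_simps)
    then show ?thesis
      by (simp add: vec_eq_iff S\<^sub>0_def mintegral_y_def integral_y_embed_x_mult g(1) distrib_left
          Const_hom.hom_mult)
  qed
  ultimately show ?case unfolding matrix_quad_module_def by blast
next
  case (add M N)
  then obtain S\<^sub>0 S S\<^sub>0' S' where M: "M = S\<^sub>0 + mintegral_y Y \<nu> (block_inner S G)"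
      "S\<^sub>0 \<in> sos_matrices" "S \<in> sos_matrices"
    and N: "N = S\<^sub>0' + mintegral_y Y \<nu> (block_inner S' G)"
      "S\<^sub>0' \<in> sos_matrices" "S' \<in> sos_matrices"
    unfolding matrix_quad_module_def by blast
  have "mintegral_y Y \<nu> (block_inner (S + S') G)
      = mintegral_y Y \<nu> (block_inner S G) + mintegral_y Y \<nu> (block_inner S' G)"
    by (simp add: vec_eq_iff mintegral_y_def block_inner_nth integral_y_add[symmetric]
        distrib_right sum.distrib)
  then have "M + N = (S\<^sub>0 + S\<^sub>0') + mintegral_y Y \<nu> (block_inner (S + S') G)"
    by (simp add: M(1) N(1))
  then show ?case
    unfolding matrix_quad_module_def
    using sos_matrices_add[OF M(2) N(2)] sos_matrices_add[OF M(3) N(3)] by blast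
qed

lemma eval_form_sos_nonneg:
  assumes "S \<in> sos_matrices" shows "eval_form S x v \<ge> 0"
proof -
  obtain l T where S: "S = (\<chi> i j. \<Sum>k<l::nat. T k i * T k j)"
    using assms unfolding sos_matrices_def by blast
  have "eval_form S x v = (\<Sum>i\<in>UNIV. \<Sum>j\<in>UNIV. \<Sum>k<l. (v $ i * eval_x (T k i) x) * (v $ j * eval_x (T k j) x))"
    by (simp add: eval_form_def quad_form_def S sum_distrib_left sum_distrib_right ac_simps)
  also have "\<dots> = (\<Sum>k<l. \<Sum>i\<in>UNIV. \<Sum>j\<in>UNIV. (v $ i * eval_x (T k i) x) * (v $ j * eval_x (T k j) x))"
    by (subst sum.swap[of _ "{..<l}"], subst sum.swap[of _ UNIV "{..<l}"]) simp
  also have "\<dots> = (\<Sum>k<l. (\<Sum>i\<in>UNIV. v $ i * eval_x (T k i) x)\<^sup>2)"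
    by (simp only: power2_eq_square sum_product)
  also have "\<dots> \<ge> 0" by (intro sum_nonneg) auto
  finally show ?thesis .
qed

lemma eval_form_add: "eval_form (M + N) x v = eval_form M x v + eval_form N x v"
  by (simp add: eval_form_def quad_form_def distrib_left distrib_right sum.distrib)

text \<open>
  Writing \<open>S = T\<^sup>T T\<close>, the integrand is the sum of the values of the quadratic form of \<open>G(x, y)\<close> at the
  vectors \<open>w\<close> whose \<open>k\<close>-th entry is \<open>\<Sum>i. v\<^sub>i T\<^sub>t\<^sub>,\<^sub>(\<^sub>i\<^sub>,\<^sub>k\<^sub>)\<close>, one for each row \<open>t\<close> of \<open>T\<close>.
\<close>

lemma eval_form_mintegral_nonneg:
  fixes G :: "('n::finite, 'm::finite) xypoly^'q::finite^'q"
  assumes int: "\<And>p. real_polynomial_function p \<Longrightarrow> set_integrable \<nu> Y p"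
    and x: "x \<in> feasible_set Y G" and S: "S \<in> sos_matrices"
  shows "eval_form (mintegral_y Y \<nu> (block_inner S G)) x v \<ge> 0"
proof -
  obtain l T where T: "S = (\<chi> a b. \<Sum>k<l::nat. T k a * T k b)"
    using S unfolding sos_matrices_def by blast
  define w where "w y t = (\<chi> k. \<Sum>i\<in>UNIV. v $ i * eval_xy (T t (i, k)) x y)" for y t
  define H where "H i j = block_inner S G $ i $ j" for i j
  have H_int: "set_integrable \<nu> Y (\<lambda>y. v $ i * eval_xy (H i j) x y * v $ j)" for i j
    by (intro int real_polynomial_function.intros(2-4) real_polynomial_function_eval_xy)
  have "eval_form (mintegral_y Y \<nu> (block_inner S G)) x v
      = (\<Sum>i\<in>UNIV. \<Sum>j\<in>UNIV. v $ i * (LINT y:Y|\<nu>. eval_xy (H i j) x y) * v $ j)"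
    by (simp add: eval_form_def quad_form_def mintegral_y_def eval_x_integral_y[OF int] H_def)
  also have "\<dots> = (\<Sum>i\<in>UNIV. \<Sum>j\<in>UNIV. LINT y:Y|\<nu>. v $ i * eval_xy (H i j) x y * v $ j)"
    by simp
  also have "\<dots> = (LINT y:Y|\<nu>. \<Sum>i\<in>UNIV. \<Sum>j\<in>UNIV. v $ i * eval_xy (H i j) x y * v $ j)"
    by (simp only: set_lebesgue_integral_def scaleR_sum_right Bochner_Integration.integral_sum
        Bochner_Integration.integrable_sum H_int[unfolded set_integrable_def])
  also have "\<dots> \<ge> 0"
  proof -
    have "0 \<le> (\<Sum>i\<in>UNIV. \<Sum>j\<in>UNIV. v $ i * eval_xy (H i j) x y * v $ j)" if y: "y \<in> Y" for y
    proof -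
      let ?e = "\<lambda>t b k i j. eval_xy (G $ b $ k) x y * (v $ i * eval_xy (T t (i, k)) x y)
        * (v $ j * eval_xy (T t (j, b)) x y)"
      have "(\<Sum>i\<in>UNIV. \<Sum>j\<in>UNIV. v $ i * eval_xy (H i j) x y * v $ j)
          = (\<Sum>i\<in>UNIV. \<Sum>j\<in>UNIV. \<Sum>k\<in>UNIV. \<Sum>b\<in>UNIV. \<Sum>t<l. ?e t b k i j)"
        unfolding H_def block_inner_nth T
        by (simp add: sum_distrib_left sum_distrib_right ac_simps)
      also have "\<dots> = (\<Sum>t<l. \<Sum>b\<in>UNIV. \<Sum>k\<in>UNIV. \<Sum>i\<in>UNIV. \<Sum>j\<in>UNIV. ?e t b k i j)"
        unfolding sum.cartesian_product
        by (rule sum.reindex_bij_witness[of _ "\<lambda>(t, b, k, i, j). (i, j, k, b, t)" "\<lambda>(i, j, k, b, t). (t, b, k, i, j)"])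
          auto
      also have "\<dots> = (\<Sum>t<l. w y t \<bullet> (meval_xy G x y *v w y t))"
      proof (rule sum.cong[OF refl])
        fix t
        have "w y t \<bullet> (meval_xy G x y *v w y t)
            = (\<Sum>b\<in>UNIV. \<Sum>k\<in>UNIV. w y t $ b * (eval_xy (G $ b $ k) x y * w y t $ k))"
          by (simp add: inner_vec_def matrix_vector_mult_def meval_xy_def sum_distrib_left)
        also have "\<dots> = (\<Sum>b\<in>UNIV. \<Sum>k\<in>UNIV. \<Sum>i\<in>UNIV. \<Sum>j\<in>UNIV. ?e t b k i j)"
        proof (intro sum.cong refl)
          fix b k
          have "w y t $ b * (eval_xy (G $ b $ k) x y * w y t $ k)
              = eval_xy (G $ b $ k) x y * (w y t $ k * w y t $ b)" by simp
          also have "w y t $ k * w y t $ b = (\<Sum>i\<in>UNIV. \<Sum>j\<in>UNIV.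
              (v $ i * eval_xy (T t (i, k)) x y) * (v $ j * eval_xy (T t (j, b)) x y))"
            by (simp add: w_def sum_product)
          finally show "w y t $ b * (eval_xy (G $ b $ k) x y * w y t $ k) = (\<Sum>i\<in>UNIV. \<Sum>j\<in>UNIV. ?e t b k i j)"
            by (simp add: sum_distrib_left mult.assoc)
        qed
        finally show "(\<Sum>b\<in>UNIV. \<Sum>k\<in>UNIV. \<Sum>i\<in>UNIV. \<Sum>j\<in>UNIV. ?e t b k i j)
            = w y t \<bullet> (meval_xy G x y *v w y t)" by simp
      qed
      also have "\<dots> \<ge> 0"
        using x y by (intro sum_nonneg) (auto simp: feasible_set_def psd_def)
      finally show ?thesis .
    qed
    then show ?thesis
      unfolding set_lebesgue_integral_def
      by (intro Bochner_Integration.integral_nonneg) (auto simp: indicator_def)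
  qed
  finally show ?thesis .
qed

text \<open>
  At a point outside \<open>X\<close> the form \<open>v\<^sup>T G v\<close> is negative for some \<open>y0 \<in> Y\<close> and some \<open>v\<close>. Taking \<open>S\<close> to be the
  square of the row \<open>p(y) v\<^sup>T\<close>, where \<open>p\<close> concentrates near \<open>y0\<close>, gives an element of the module
  that is negative at the point.
\<close>

lemma nonneg_quad_module_imp_feasible:
  fixes Y :: "(real^'m::finite) set" and G :: "('n::finite, 'm) xypoly^'q::finite^'q"
  assumes sets: "sets \<nu> = sets borel" and Y: "support \<nu> = Y" "closed Y"
    and int: "\<And>p. real_polynomial_function p \<Longrightarrow> set_integrable \<nu> Y p"
    and carleman: "\<And>j. carleman Y \<nu> j"
    and sym: "G \<in> symmetric_matrices"
    and nonneg: "\<And>g. g \<in> quad_module Y \<nu> G \<Longrightarrow> eval_x g x \<ge> 0"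
  shows "x \<in> feasible_set Y G"
proof (rule ccontr)
  assume "x \<notin> feasible_set Y G"
  then obtain y0 where y0: "y0 \<in> Y" "\<not> psd (meval_xy G x y0)" by (auto simp: feasible_set_def)
  have "meval_xy G x y0 \<in> symmetric_matrices"
    using sym by (auto simp: symmetric_matrices_def transpose_def vec_eq_iff meval_xy_def)
  then obtain v where v: "v \<bullet> (meval_xy G x y0 *v v) < 0" using y0(2) by (auto simp: psd_def not_le)
  define h where "h y = v \<bullet> (meval_xy G x y *v v)" for y
  have h: "h y = (\<Sum>b\<in>UNIV. \<Sum>k\<in>UNIV. v $ b * (eval_xy (G $ b $ k) x y * v $ k))" for y
    by (simp add: h_def inner_vec_def matrix_vector_mult_def meval_xy_def sum_distrib_left)
  have "real_polynomial_function h"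
    unfolding h
    by (intro real_polynomial_function_sum real_polynomial_function.intros(2-4)
        real_polynomial_function_eval_xy) auto
  from exists_square_weight_negative[OF sets Y int carleman this y0(1)] v
  obtain p where p: "real_polynomial_function p" "(LINT y:Y|\<nu>. (p y)\<^sup>2 * h y) < 0"
    unfolding h_def by blast
  obtain f where f: "p = (\<lambda>y. eval_x f y)" using real_polynomial_function_eq_eval[OF p(1)] by blast
  define S where "S = (\<chi> i j. (embed_y f * embed_x (Const (v $ i))) * (embed_y f * embed_x (Const (v $ j)))
    :: ('n, 'm) xypoly^'q^'q)"
  have "S \<in> sos_matrices" unfolding S_def by (rule sos_matrices_rank_one)
  then have "0 + integral_y Y \<nu> (trace (transpose S ** G)) \<in> quad_module Y \<nu> G"
    unfolding quad_module_def using sos_polys_zero by blast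
  from nonneg[OF this] have "0 \<le> (LINT y:Y|\<nu>. eval_xy (trace (transpose S ** G)) x y)"
    by (simp add: eval_x_integral_y[OF int])
  moreover have "eval_xy (trace (transpose S ** G)) x y = (p y)\<^sup>2 * h y" for y
    unfolding h trace_transpose_mult S_def f
    by (subst (2) sum.swap) (simp add: sum_distrib_left power2_eq_square ac_simps)
  ultimately show False using p(2) by simp
qed

lemma eval_form_pencil:
  "eval_form (pencil \<Lambda>\<^sub>0 \<Lambda> \<gamma>) x v = eval_form \<Lambda>\<^sub>0 x v - (\<Sum>i\<in>UNIV. \<gamma> $ i * eval_form (\<Lambda> i) x v)"
proof -
  have "eval_form (pencil \<Lambda>\<^sub>0 \<Lambda> \<gamma>) x v = eval_form \<Lambda>\<^sub>0 x v
      - (\<Sum>a\<in>UNIV. \<Sum>b\<in>UNIV. \<Sum>i\<in>UNIV. \<gamma> $ i * (v $ a * eval_x (\<Lambda> i $ a $ b) x * v $ b))"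
    by (simp add: eval_form_def quad_form_def pencil_def right_diff_distrib left_diff_distrib sum_subtractf
        sum_distrib_left sum_distrib_right ac_simps)
  also have "(\<Sum>a\<in>UNIV. \<Sum>b\<in>UNIV. \<Sum>i\<in>UNIV. \<gamma> $ i * (v $ a * eval_x (\<Lambda> i $ a $ b) x * v $ b))
      = (\<Sum>i\<in>UNIV. \<Sum>a\<in>UNIV. \<Sum>b\<in>UNIV. \<gamma> $ i * (v $ a * eval_x (\<Lambda> i $ a $ b) x * v $ b))"
    unfolding sum.cartesian_product
    by (rule sum.reindex_bij_witness[of _ "\<lambda>(i, a, b). (a, b, i)" "\<lambda>(a, b, i). (i, a, b)"]) auto
  finally show ?thesis
    by (simp add: eval_form_def quad_form_def sum_distrib_left)
qed

lemma pencil_symmetric: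
  assumes "\<Lambda>\<^sub>0 \<in> symmetric_matrices" "\<And>i. \<Lambda> i \<in> symmetric_matrices"
  shows "pencil \<Lambda>\<^sub>0 \<Lambda> \<gamma> \<in> symmetric_matrices"
  using assms by (simp add: symmetric_matrices_def transpose_def vec_eq_iff pencil_def)

lemma meval_x_symmetric: "M \<in> symmetric_matrices \<Longrightarrow> meval_x M x \<in> symmetric_matrices"
  by (simp add: symmetric_matrices_def transpose_def vec_eq_iff meval_x_def)

theorem theorem5p1:
  fixes Y :: "(real^'m::finite) set"
    and \<nu> :: "(real^'m) measure"
    and G :: "('n::finite, 'm) xypoly^'q::finite^'q"
    and c :: "real^'r::finite"
    and \<Lambda>\<^sub>0 :: "'n xpoly^'p::finite^'p"
    and \<Lambda> :: "'r \<Rightarrow> 'n xpoly^'p^'p"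
  assumes "closed Y"
    and "G \<in> symmetric_matrices"
    and "sets \<nu> = sets borel"
    and "support \<nu> = Y"
    and "\<And>h :: 'm xpoly. (\<integral>\<^sup>+y\<in>Y. ennreal \<bar>eval_x h y\<bar> \<partial>\<nu>) < \<infinity>"
    and "\<Lambda>\<^sub>0 \<in> symmetric_matrices"
    and "\<And>i. \<Lambda> i \<in> symmetric_matrices"
    and "\<exists>C>0. Const C - (\<Sum>i\<in>UNIV. (Var i)\<^sup>2) \<in> quad_module Y \<nu> G"
    and "\<And>j. carleman Y \<nu> j"
    and "\<exists>\<gamma>. \<forall>x\<in>feasible_set Y G. pd (meval_x (pencil \<Lambda>\<^sub>0 \<Lambda> \<gamma>) x)"
  shows "(\<lambda>k. tau Y \<nu> G c \<Lambda>\<^sub>0 \<Lambda> k) \<longlonglongrightarrow> tau_star Y G c \<Lambda>\<^sub>0 \<Lambda>"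
proof -
  let ?P = "pencil \<Lambda>\<^sub>0 \<Lambda>" and ?X = "feasible_set Y G"
  have sym: "?P \<gamma> \<in> symmetric_matrices" for \<gamma> by (rule pencil_symmetric[OF assms(6,7)])
  have int: "set_integrable \<nu> Y p" if p: "real_polynomial_function p" for p
  proof -
    obtain h where h: "p = (\<lambda>y. eval_x h y)" using real_polynomial_function_eq_eval[OF p] by blast
    have p_meas: "p \<in> borel_measurable borel" by (rule borel_measurable_polynomial[OF p])
    have "borel_measurable \<nu> = (borel_measurable borel :: (real^'m \<Rightarrow> real) set)"
      by (rule measurable_cong_sets) (auto simp: assms(3))
    then have meas: "(\<lambda>y. indicator Y y *\<^sub>R p y) \<in> borel_measurable \<nu>"
      by (simp only:) (intro borel_measurable_scaleR borel_measurable_indicator borel_closed p_meas assms(1))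
    have "(\<integral>\<^sup>+y. ennreal (norm (indicator Y y *\<^sub>R p y)) \<partial>\<nu>) = (\<integral>\<^sup>+y\<in>Y. ennreal \<bar>eval_x h y\<bar> \<partial>\<nu>)"
      by (intro nn_integral_cong) (simp add: h indicator_def)
    then show ?thesis
      unfolding set_integrable_def using assms(5)[of h] by (intro integrableI_bounded[OF meas]) simp
  qed

  have upper: "\<forall>\<^sub>F k in sequentially. tau Y \<nu> G c \<Lambda>\<^sub>0 \<Lambda> k \<le> ereal (c \<bullet> \<gamma>)"
    if \<gamma>: "\<And>x. x \<in> ?X \<Longrightarrow> pd (meval_x (?P \<gamma>) x)" for \<gamma>
  proof -
    obtain C where "Const C - (\<Sum>i\<in>UNIV. (Var i)\<^sup>2) \<in> quad_module Y \<nu> G" using assms(8) by blast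
    then have "?P \<gamma> \<in> matrix_module (quad_module Y \<nu> G)"
    proof (rule matrix_positivstellensatz[OF quadratic_module_quad_module _ sym])
      fix x assume "\<And>g. g \<in> quad_module Y \<nu> G \<Longrightarrow> eval_x g x \<ge> 0"
      then have "x \<in> ?X"
        by (intro nonneg_quad_module_imp_feasible[OF assms(3,4,1) int assms(9,2)])
      then show "pd (meval_x (?P \<gamma>) x)" by (rule \<gamma>)
    qed
    then have "?P \<gamma> \<in> matrix_quad_module Y \<nu> G" by (rule matrix_module_subset_matrix_quad_module)
    then obtain S\<^sub>0 S where S: "?P \<gamma> = S\<^sub>0 + mintegral_y Y \<nu> (block_inner S G)"
      "S\<^sub>0 \<in> sos_matrices" "S \<in> sos_matrices"
      unfolding matrix_quad_module_def by blast
    have "\<forall>\<^sub>F k in sequentially. k \<ge> mdeg S\<^sub>0 + mdeg_x S + mdeg_y S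
        + half_up (mdeg_x G) + half_up (mdeg_y G)"
      by (rule eventually_ge_at_top)
    then show ?thesis
    proof eventually_elim
      case (elim k)
      show ?case
        unfolding tau_def
        by (rule INF_lower, rule CollectI, rule exI[of _ S\<^sub>0], rule exI[of _ S]) (use S elim in auto)
    qed
  qed

  have lower: "tau_star Y G c \<Lambda>\<^sub>0 \<Lambda> \<le> tau Y \<nu> G c \<Lambda>\<^sub>0 \<Lambda> k" for k
    unfolding tau_star_def tau_def
  proof (rule INF_superset_mono[OF _ order_refl], safe)
    fix \<gamma> S\<^sub>0 S x
    assume S: "?P \<gamma> = S\<^sub>0 + mintegral_y Y \<nu> (block_inner S G)" "S\<^sub>0 \<in> sos_matrices" "S \<in> sos_matrices"
      and x: "x \<in> ?X"
    have "eval_form (?P \<gamma>) x v \<ge> 0" for v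
      unfolding S(1) eval_form_add
      using eval_form_sos_nonneg[OF S(2)] eval_form_mintegral_nonneg[OF int x S(3)] by (intro add_nonneg_nonneg)
    then show "psd (meval_x (?P \<gamma>) x)"
      using meval_x_symmetric[OF sym] by (simp add: psd_def eval_form_eq_inner)
  qed

  obtain \<gamma>\<^sub>0 where \<gamma>\<^sub>0: "\<And>x. x \<in> ?X \<Longrightarrow> pd (meval_x (?P \<gamma>\<^sub>0) x)" using assms(10) by blast
  show ?thesis
  proof (rule order_tendstoI)
    fix a assume "a < tau_star Y G c \<Lambda>\<^sub>0 \<Lambda>"
    then show "\<forall>\<^sub>F k in sequentially. a < tau Y \<nu> G c \<Lambda>\<^sub>0 \<Lambda> k"
      using lower by (auto intro: always_eventually less_le_trans)
  next
    fix a assume "tau_star Y G c \<Lambda>\<^sub>0 \<Lambda> < a"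
    then obtain \<gamma> where \<gamma>: "\<And>x. x \<in> ?X \<Longrightarrow> psd (meval_x (?P \<gamma>) x)" "ereal (c \<bullet> \<gamma>) < a"
      unfolding tau_star_def INF_less_iff by blast
    define \<gamma>t where "\<gamma>t t = (1 - t) *\<^sub>R \<gamma> + t *\<^sub>R \<gamma>\<^sub>0" for t :: real
    have pd_t: "pd (meval_x (?P (\<gamma>t t)) x)" if t: "0 < t" "t \<le> 1" and x: "x \<in> ?X" for t x
    proof -
      have "eval_form (?P (\<gamma>t t)) x v > 0" if "v \<noteq> 0" for v
      proof -
        have "eval_form (?P (\<gamma>t t)) x v = (1 - t) * eval_form (?P \<gamma>) x v + t * eval_form (?P \<gamma>\<^sub>0) x v"
          by (simp add: eval_form_pencil \<gamma>t_def sum.distrib sum_subtractf sum_distrib_left algebra_simps)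
        moreover have "(1 - t) * eval_form (?P \<gamma>) x v \<ge> 0"
          using \<gamma>(1)[OF x] t by (simp add: psd_def eval_form_eq_inner)
        moreover have "t * eval_form (?P \<gamma>\<^sub>0) x v > 0"
          using \<gamma>\<^sub>0[OF x] t that by (simp add: pd_def eval_form_eq_inner)
        ultimately show ?thesis by linarith
      qed
      then show ?thesis using meval_x_symmetric[OF sym] by (simp add: pd_def eval_form_eq_inner)
    qed
    have "((\<lambda>t. ereal (c \<bullet> \<gamma>t t)) \<longlongrightarrow> ereal (c \<bullet> \<gamma>t 0)) (at_right 0)"
      unfolding \<gamma>t_def by (intro tendsto_intros)
    then have "((\<lambda>t. ereal (c \<bullet> \<gamma>t t)) \<longlongrightarrow> ereal (c \<bullet> \<gamma>)) (at_right 0)"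
      by (simp add: \<gamma>t_def)
    then have "\<forall>\<^sub>F t in at_right 0. ereal (c \<bullet> \<gamma>t t) < a" using \<gamma>(2) by (rule order_tendstoD)
    moreover have "\<forall>\<^sub>F t in at_right (0::real). t \<in> {0<..<1}" by (rule eventually_at_right_real) simp
    ultimately have "\<forall>\<^sub>F t in at_right 0. ereal (c \<bullet> \<gamma>t t) < a \<and> t \<in> {0<..<1}"
      by (rule eventually_conj)
    then obtain t where t: "ereal (c \<bullet> \<gamma>t t) < a" "0 < t" "t < 1"
      using eventually_happens'[of "at_right (0::real)"] by fastforce
    then have "\<forall>\<^sub>F k in sequentially. tau Y \<nu> G c \<Lambda>\<^sub>0 \<Lambda> k \<le> ereal (c \<bullet> \<gamma>t t)"
      by (intro upper pd_t) auto
    then show "\<forall>\<^sub>F k in sequentially. tau Y \<nu> G c \<Lambda>\<^sub>0 \<Lambda> k < a"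
      by eventually_elim (use t(1) in auto)
  qed
qed

end
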